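(* Let $A,B\in\mathcal{T}'$ with $A\rhd B$ (one-step reduction of $\lambda\beta\mathsf{R}'$), and suppose an assignment derivation assigning the vector $[A]$ to $A$ is given. Then the assignment $[B]$ to $B$ produced from it by the assignment algorithm described in the context satisfies $[A]\succ[B]$.
   Context: Ordinals: for $\alpha,\beta<\varepsilon_0$ let $\alpha\oplus\beta$, $\alpha\otimes\beta$ be the natural (Hessenberg) sum and product; $2^\alpha:=\omega^{\alpha_0}\cdot 2^k$ where $\alpha=\omega\cdot\alpha_0+k$, $k<\omega$. The norm is $\mathrm{no}(0)=0$, $\mathrm{no}(\alpha)=k+\mathrm{no}(\alpha_1)+\dots+\mathrm{no}(\alpha_k)$ for $\alpha=\omega^{\alpha_1}+\dots+\omega^{\alpha_k}$, $\alpha_1\ge\dots\ge\alpha_k$. Let $F_0(x)=2^x$, $F_{j+1}(x)=F_j^{x+1}(x)$, $\Phi(x)=F_5(x+100)$, and $\psi(\alpha):=\max(\{0\}\cup\{\psi(\beta)+1:\beta<\alpha,\ \mathrm{no}(\beta)\le\Phi(\mathrm{no}(\alpha))\})$ for $\alpha<\varepsilon_0$. Types: $0$ and $(\sigma\tau)$; $\mathrm{lv}(0)=0$, $\mathrm{lv}(\sigma\tau)=\max(\mathrm{lv}(\sigma)+1,\mathrm{lv}(\tau))$. To each typed variable $X^\sigma$ is associated a vector $\vec x=\langle x_0,\dots,x_{\mathrm{lv}(\sigma)}\rangle$ of distinct ordinal variables, each ordinal variable belonging to exactly one such vector. Ordinal terms $\mathcal{O}$: ordinal variables, $0,1,\omega$,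 and $f+g$, $2^f\cdot g$, $\psi(\omega\cdot f+g)$ for $f,g\in\mathcal{O}$; closed terms are interpreted as ordinals $<\varepsilon_0$ ($+$ as $\oplus$, $\cdot$ as $\otimes$). $h$ is $x$-free if no $x_i$ occurs in it. A vector of level $n$ is $\vec h=\langle h_0,\dots,h_n\rangle$ with $h_i\in\mathcal{O}$; $h_i:=0$ for $i>n$; vector sums are componentwise (level = max); $2\vec v=\vec v+\vec v$; $\{\vec x:=\vec a\}$ replaces each $x_i$ by $a_i$; $\vec 1=\langle1,\dots,1\rangle$. Classes $\mathcal{B}_i$: $1\in\mathcal{B}_i$; $\omega\in\mathcal{B}_i$ ($i\ge1$); closed under $+$; $2^f\cdot g\in\mathcal{B}_i$ if $f\in\mathcal{B}_{i+1},g\in\mathcal{B}_i,i\ge1$; $\psi(\omega\cdot f+g)\in\mathcal{B}_0$ if $f\in\mathcal{B}_1,g\in\mathcal{B}_0$, $\mathrm{no}(f)\le F_2(g)$; $\mathcal{B}_0\subseteq\mathcal{B}_i$. A closed vector $\vec f$ has bounded norm if $\mathrm{no}(f_i)\le\mathrm{no}(f_0)$ for all $i$. For $f,g\in\mathcal{O}$, $f\prec g$ iff $\chi(f)<\chi(g)$ for every substitution $\chi$ defined on all components of every variable vector $\vec x$ some component of which occurs in $f$ or $g$, with each $\chi(\vec x)$ a vector with $\chi(x_i)\in\mathcal{B}_i$ of bounded norm; $\preceq$ likewise (also for expressions involving $\mathrm{no}$ and $F_j$). For vectors: $\vec f\prec\vec g$ iff $f_0\prec g_0$ and $f_i\preceq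 g_i$ for $i>0$. Classes $\mathcal{C}^{\vec x}_i$: $1\in\mathcal{C}^{\vec x}_i$; $\omega\in\mathcal{C}^{\vec x}_i$ ($i\ge1$); $y^\rho_i\in\mathcal{C}^{\vec x}_i$ for every variable $Y^\rho$, $i\le\mathrm{lv}(\rho)$; closed under $+$; $2^f\cdot g\in\mathcal{C}^{\vec x}_i$ if $f\in\mathcal{C}^{\vec x}_{i+1},g\in\mathcal{C}^{\vec x}_i,i\ge1$; $\psi(\omega\cdot f+g)\in\mathcal{C}^{\vec x}_0$ if $f\in\mathcal{C}^{\vec x}_1,g\in\mathcal{C}^{\vec x}_0$, $\mathrm{no}(f)\preceq F_2(g)$; $x$-free members of $\mathcal{C}^{\vec x}_0$ belong to all $\mathcal{C}^{\vec x}_i$. $\mathcal{C}^{\vec x}$: vectors with $h_i\in\mathcal{C}^{\vec x}_i$. Operator $\Box$: for $m:=\mathrm{lv}(\vec f)>\mathrm{lv}(\vec g)=:n$, $\vec f\Box\vec g$ has level $m$ with $(\vec f\Box\vec g)_0=\psi(\omega\cdot(\vec f\Box\vec g)_1+f_0+g_0+n)$, $(\vec f\Box\vec g)_i=2^{(\vec f\Box\vec g)_{i+1}}\cdot(f_i+g_i)$ for $1\le i\le n$, $(\vec f\Box\vec g)_i=f_i$ for $n<i\le m$; $\vec f\Box\vec g\restriction_i$ is its restriction to components $0..i$. Operator $\delta^{\vec x}$: let $n:=\mathrm{lv}(\vec x)+1$. For $h\in\mathcal{C}^{\vec x}_i$, $\delta^{\vec x}_i h$ is the level-$n$ vector: if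 $h$ is $x$-free, $(\delta^{\vec x}_ih)_j=h+1$ if $j=i$, $=1$ otherwise; else if $h\equiv x_i$: $\vec 1$; $h\equiv f+g$: $\delta^{\vec x}_if+\delta^{\vec x}_ig+\vec1$; $h\equiv2^f\cdot g$ ($i>0$): $2\delta^{\vec x}_{i+1}f+\delta^{\vec x}_ig+\vec1$; $h\equiv\psi(\omega\cdot f+g)$ ($i=0$): component $0$ is $\psi(\omega\cdot f\{\vec x:=\vec1\}+(\delta^{\vec x}_0g)_0)$, component $j\in[1,n]$ is $(\delta^{\vec x}_1f)_j+(\delta^{\vec x}_0g)_j$. $\mathrm{sz}^{\vec x}(h)=1$ if $h$ is $x$-free or some $x_i$; $=\mathrm{sz}^{\vec x}(f)+\mathrm{sz}^{\vec x}(g)+1$ for non-$x$-free $f+g$ or $\psi(\omega\cdot f+g)$; $=2\mathrm{sz}^{\vec x}(f)+\mathrm{sz}^{\vec x}(g)+1$ for non-$x$-free $2^f\cdot g$. For $\vec h\in\mathcal{C}^{\vec x}$ of level $m$, $\delta^{\vec x}\vec h$ has level $\max(n,m)$: $(\delta^{\vec x}\vec h)_0=2^n(\sum_{i\le m}\mathrm{sz}^{\vec x}(h_i))\cdot(\delta^{\vec x}_0h_0)_0$, $(\delta^{\vec x}\vec h)_j=\sum_{i\le m}(\delta^{\vec x}_ih_i)_j$ for $0<j\le n$, $=h_j$ for $j>n$. Terms $\mathcal{T}'$: typed variables (infinitely many per type), constants $\mathsf0:0$, $\mathsf S:00$, $\mathsf D_\tau:0\tau\tau\tau$, $\mathsf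 R_\tau:0(0\tau\tau)\tau\tau$, terms $\mathsf R_\tau^t:(0\tau\tau)\tau\tau$ for $t$ of type $0$, application, abstraction; $\mathsf R^t\{X:=A\}=\mathsf R^{t\{X:=A\}}$. $\lambda\beta\mathsf R'$ one-step reduction $\rhd$: $\mathsf D\mathsf0AB\rhd A$, $\mathsf D(\mathsf St)AB\rhd B$, $\mathsf Rt\rhd\mathsf R^t$, $\mathsf R^{\mathsf0}AB\rhd B$, $\mathsf R^{\mathsf St}AB\rhd At(\mathsf R^tAB)$, $(\lambda X.A)B\rhd A\{X:=B\}$ if $\mathrm{BV}(\lambda X.A)\cap\mathrm{FV}(B)=\emptyset$, closed under application on either side, $\mathsf R^s\rhd\mathsf R^t$ if $s\rhd t$, and $\lambda X.A\rhd\lambda X.B$ if $A\rhd B$ ($\xi$). A term is well-named if in each subterm $B$, $\mathrm{FV}(B)\cap\mathrm{BV}(B)=\emptyset$ and each binder occurs at most once; for well-named terms $A\rhd_\alpha B$ iff $A\rhd B'$ with $B'$ $\alpha$-equivalent to $B$. Assignment derivations (trees) assign to $A^\sigma$ a vector $[A]$ of level $\mathrm{lv}(\sigma)$: $[X^\sigma]=\vec x$, $[\mathsf0]=\langle1\rangle$, $[\mathsf S]=\langle1,1\rangle$, $[\mathsf D_\tau]=\langle1,\dots,1\rangle$ of level $\mathrm{lv}(\tau)+1$, $[\mathsf R_\tau]=\langle2,1,\dots,1,\omega\rangle$ of level $\mathrm{lv}(\tau)+2$; from derivations of $B^{\sigma\tau},C^\sigma$: $[BC]=[B]\Box[C]\restriction_{\mathrm{lv}(\tau)}$;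 from a derivation of $t$: $[\mathsf R_\tau^t]=\langle[t]_0,1,\dots,1,[t]_0\rangle$ of level $\mathrm{lv}(\tau)+2$; from derivations of $G_0,\dots,G_m$ with $G_0\rhd_\alpha\dots\rhd_\alpha G_m=:G$, $X$ not occurring in any subterm of $G_0$ of form $\mathsf R^t$, and $[G_0]\succ\dots\succ[G_m]$: $[\lambda X.G]=\delta^{\vec x}[G_0]+[G_m]\{\vec x:=\vec1\}$. Assignment derivations commute with substitution: from derivations of $H$ and $F$ one obtains (canonically) a derivation of $(H\{Y:=F\},[H]\{\vec y:=[F]\})$. Algorithm (recursion on term length), given $A\rhd B$ and a derivation for $A$: for root rules $\mathsf D\mathsf0AB\rhd A$, $\mathsf D(\mathsf St)AB\rhd B$, $\mathsf R^{\mathsf0}AB\rhd B$ take the contained subderivation of the reduct; for $\mathsf Rt\rhd\mathsf R^t$ and $\mathsf R^{\mathsf St}FG\rhd Ft(\mathsf R^tFG)$ build the reduct's derivation from the contained subderivations for $t$ (resp. $t,F,G$); for $(\lambda X.G)H\rhd G\{X:=H\}$, where $[\lambda X.G]$ comes from $G_0,\dots,G_m$, take the canonical derivation of $(G\{X:=H\},[G_m]\{\vec x:=[H]\})$; for the application rules and $\mathsf R^s\rhd\mathsf R^t$ replace the reduced component's derivation by the one produced recursively; for $(\xi)$ $\lambda X.F\rhd\lambda X.G$ from $F\rhd G$, where $[\lambda X.F]$ comes from $F_0,\dots,F_m$, set $[\lambda X.G]=\delta^{\vec x}[F_0]+[G]\{\vec x:=\vec1\}$ with $[G]$ produced recursively.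 *)

theory Defs
  imports "HOL-Library.Multiset"
begin

section \<open>Ordinals below $\varepsilon_0$\<close>

text \<open>
  By Cantor normal form an ordinal below $\varepsilon_0$ is a finite multiset of such
  ordinals: \<open>Ord {#a\<^sub>1, \<dots>, a\<^sub>k#}\<close> is $\omega^{a_1} + \dots + \omega^{a_k}$ with the
  summands in weakly descending order. The order is the multiset extension of itself
  (the least fixed point is the only one, by induction on the nesting depth). In the
  semiring below, \<open>+\<close> and \<open>*\<close> are the natural (Hessenberg) sum and product.
\<close>

datatype eord = Ord "eord multiset"

primrec exps :: "eord \<Rightarrow> eord multiset" where
  "exps (Ord M) = M"

primrec no :: "eord \<Rightarrow> nat" where
  "no (Ord M) = (\<Sum>k\<in>#image_mset no M. k + 1)"

lemma no_less: "a \<in># M \<Longrightarrow> no a < no (Ord M)"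
  by (auto dest!: multi_member_split)

inductive eord_lt :: "eord \<Rightarrow> eord \<Rightarrow> bool" where
  "multp eord_lt M N \<Longrightarrow> eord_lt (Ord M) (Ord N)"

lemma eord_lt_iff: "eord_lt (Ord M) (Ord N) \<longleftrightarrow> multp eord_lt M N"
  using eord_lt.simps by blast

lemma transp_eord_lt: "transp eord_lt"
proof (rule transpI)
  fix a b c assume "eord_lt a b" "eord_lt b c"
  then show "eord_lt a c"
    by (cases a; cases b; cases c)
      (simp add: eord_lt_iff multp_def mult_def; erule (1) trancl_trans)
qed

lemma wfp_eord_lt: "wfp eord_lt"
proof -
  define R where "R = (\<lambda>a b. eord_lt a b \<and> Wellfounded.accp eord_lt b)"
  have "wfp R"
  proof (rule accp_wfpI, rule allI)
    fix b
    have R: "Wellfounded.accp R b" if "Wellfounded.accp eord_lt b" for b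
      by (rule predicate1D[OF accp_subset that]) (auto simp: R_def)
    show "Wellfounded.accp R b"
    proof (rule accp.intros)
      fix a assume "R a b"
      then have "Wellfounded.accp eord_lt b" "eord_lt a b" by (simp_all add: R_def)
      then have "Wellfounded.accp eord_lt a" by (rule accp_downward)
      then show "Wellfounded.accp R a" by (rule R)
    qed
  qed
  then have wfM: "wfp (multp R)" by (rule wfp_multp)
  have *: "set_mset M \<subseteq> {a. Wellfounded.accp eord_lt a} \<longrightarrow> Wellfounded.accp eord_lt (Ord M)"
    for M
    using wfM
  proof (induction M rule: wfp_induct_rule)
    case (less M)
    show ?case
    proof (rule impI, rule accp.intros)
      fix b assume M: "set_mset M \<subseteq> {a. Wellfounded.accp eord_lt a}" and "eord_lt b (Ord M)"
      then obtain N where b: "b = Ord N" and NM: "multp eord_lt N M"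
        by (cases b) (auto simp: eord_lt_iff)
      have "multp R N M"
        by (rule multp_mono_strong[OF NM transp_eord_lt])
          (use M in \<open>simp add: R_def subset_iff\<close>)
      moreover have "set_mset N \<subseteq> {a. Wellfounded.accp eord_lt a}"
      proof -
        obtain I J K where MN: "M = I + J" "N = I + K" and KJ: "\<forall>k\<in>#K. \<exists>x\<in>#J. eord_lt k x"
          using multp_implies_one_step[OF transp_eord_lt NM] by blast
        have "Wellfounded.accp eord_lt k" if "k \<in># N" for k
        proof (cases "k \<in># I")
          case True
          then show ?thesis using M MN by auto
        next
          case False
          then have "k \<in># K" using that MN by auto
          then obtain x where "x \<in># J" and k: "eord_lt k x" using KJ by blast
          then have "Wellfounded.accp eord_lt x" using M MN by auto
          then show ?thesis using k by (rule accp_downward)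
        qed
        then show ?thesis by blast
      qed
      ultimately show "Wellfounded.accp eord_lt b" unfolding b using less[of N] by simp
    qed
  qed
  have "Wellfounded.accp eord_lt a" for a
  proof (induction a)
    case (Ord M)
    then have "set_mset M \<subseteq> {a. Wellfounded.accp eord_lt a}" by auto
    then show ?case using *[of M] by simp
  qed
  then show ?thesis by (simp add: accp_wfpI)
qed

lemma totalp_eord_lt: "totalp eord_lt"
proof -
  have "totalp_on {a. no a < n} eord_lt" for n
  proof (induction n)
    case (Suc n)
    have *: "totalp_on {M. \<forall>x\<in>#M. no x < n} (multp eord_lt)"
      by (rule totalp_on_multp[OF Suc transp_eord_lt]) auto
    show ?case
    proof (rule totalp_onI)
      fix a b :: eord assume "a \<in> {a. no a < Suc n}" "b \<in> {a. no a < Suc n}" and ne: "a \<noteq> b"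
      moreover obtain M N where ab: "a = Ord M" "b = Ord N"
        by (metis eord.exhaust)
      ultimately have "no a \<le> n" "no b \<le> n" by auto
      then have "\<forall>x\<in>#M. no x < n" "\<forall>x\<in>#N. no x < n"
        unfolding ab by (auto dest!: no_less simp del: no.simps)
      then show "eord_lt a b \<or> eord_lt b a"
        using * ne unfolding totalp_on_def ab by (auto simp: eord_lt_iff)
    qed
  qed simp
  then show ?thesis
    unfolding totalp_on_def by (metis le_imp_less_Suc max.cobounded1 max.cobounded2 mem_Collect_eq)
qed

instantiation eord :: wellorder
begin

definition less_eord :: "eord \<Rightarrow> eord \<Rightarrow> bool" where
  "less_eord = eord_lt"

definition less_eq_eord :: "eord \<Rightarrow> eord \<Rightarrow> bool" where
  "less_eq_eord a b \<longleftrightarrow> eord_lt a b \<or> a = b"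

instance
proof
  have as: "asymp eord_lt" using wfp_eord_lt by (rule wfp_imp_asymp)
  fix a b c :: eord
  show "a < b \<longleftrightarrow> a \<le> b \<and> \<not> b \<le> a"
    using as by (auto simp: less_eord_def less_eq_eord_def dest: asympD)
  show "a \<le> a" by (simp add: less_eq_eord_def)
  show "a \<le> b \<Longrightarrow> b \<le> c \<Longrightarrow> a \<le> c"
    using transp_eord_lt by (auto simp: less_eq_eord_def dest: transpD)
  show "a \<le> b \<Longrightarrow> b \<le> a \<Longrightarrow> a = b"
    using as by (auto simp: less_eq_eord_def dest: asympD)
  show "a \<le> b \<or> b \<le> a"
    using totalp_eord_lt by (auto simp: less_eq_eord_def dest: totalpD)
  show "(\<And>x. (\<And>y. y < x \<Longrightarrow> P y) \<Longrightarrow> P x) \<Longrightarrow> P a" for P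
    using wfp_induct_rule[OF wfp_eord_lt, of P a] unfolding less_eord_def by simp
qed

end

lemma Ord_less_iff: "Ord M < Ord N \<longleftrightarrow> multp (<) M N"
  by (simp add: less_eord_def eord_lt_iff)

instantiation eord :: comm_semiring_1
begin

definition "0 = Ord {#}"
definition "1 = Ord {#0#}"
definition "a + b = Ord (exps a + exps b)"
definition "a * b = Ord (\<Sum>x\<in>#exps a. image_mset (\<lambda>y. x + y) (exps b))"

instance
proof
  fix a b c :: eord
  show s1: "a + b + c = a + (b + c)" "a + b = b + a" "0 + a = a" for a b c :: eord
    by (cases a; auto simp: plus_eord_def zero_eord_def ac_simps)+
  show "0 \<noteq> (1::eord)" by (simp add: zero_eord_def one_eord_def)
  interpret s: comm_monoid_add "(+)" "0::eord"
    by unfold_locales (use s1 in auto)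
  show "0 * a = 0" "a * 0 = 0" by (cases a; simp add: zero_eord_def times_eord_def)+
  show "1 * a = a" by (cases a) (simp add: one_eord_def times_eord_def s1(3)[abs_def])
  show "(a + b) * c = a * c + b * c"
    by (cases a; cases b; cases c) (simp add: plus_eord_def times_eord_def)
  have *: "(\<Sum>a\<in>#M. image_mset (\<lambda>b. a + b) N) = (\<Sum>b\<in>#N. image_mset (\<lambda>a. b + a) M)"
    for M N :: "eord multiset"
  proof (induction M)
    case (add x M)
    have "(\<Sum>b\<in>#N. add_mset (f b) (g b)) = image_mset f N + (\<Sum>b\<in>#N. g b)"
      for f :: "eord \<Rightarrow> eord" and g
      by (induction N) auto
    with add show ?case by (simp add: s1(2)[of _ x])
  qed simp
  then show "a * b = b * a"
    by (cases a; cases b) (simp add: times_eord_def)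
  have **: "image_mset f (\<Sum>a\<in>#M. g a) = (\<Sum>a\<in>#M. image_mset f (g a))"
    for f :: "eord \<Rightarrow> eord" and M :: "eord multiset" and g
    by (induction M) auto
  have ***: "(\<Sum>x\<in>#(\<Sum>a\<in>#M. g a). f x) = (\<Sum>a\<in>#M. \<Sum>x\<in>#g a. f x)"
    for f :: "eord \<Rightarrow> eord multiset" and M :: "eord multiset" and g
    by (induction M) auto
  have ****: "(+) (a + b) = (\<lambda>c. a + (b + c))" for a b :: eord
    by (rule ext) (rule s1(1))
  show "a * b * c = a * (b * c)"
    by (cases a; cases b; cases c)
      (simp add: times_eord_def ** *** image_mset.compositionality o_def ****)
qed

end

definition omega_pow :: "eord \<Rightarrow> eord" where
  "omega_pow a = Ord {#a#}"

definition is_fin :: "eord \<Rightarrow> bool" where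
  "is_fin a \<longleftrightarrow> (\<exists>k. a = of_nat k)"

lemma of_nat_eord: "of_nat k = Ord (replicate_mset k 0)"
  by (induction k) (simp_all add: zero_eord_def one_eord_def plus_eord_def)

text \<open>
  The ordinary (non-commutative) product $\omega\cdot a$, that is, every summand
  $\omega^c$ of \<open>a\<close> becomes $\omega^{1+c}$, where $1+c$ is again the ordinary sum and
  hence equal to \<open>c\<close> for infinite \<open>c\<close>.
\<close>

definition omega_times :: "eord \<Rightarrow> eord" where
  "omega_times a = Ord (image_mset (\<lambda>c. if is_fin c then c + 1 else c) (exps a))"

text \<open>
  \<open>opred c\<close> solves $1 + x = c$ for \<open>c \<noteq> 0\<close> (ordinary sum). The lemma \<open>pow2_eq\<close> is the
  equation $2^{\omega\cdot a+k} = \omega^a\cdot 2^k$.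
\<close>

definition opred :: "eord \<Rightarrow> eord" where
  "opred c = (if is_fin c then Ord (exps c - {#0#}) else c)"

definition pow2 :: "eord \<Rightarrow> eord" where
  "pow2 a = omega_pow (Ord (image_mset opred (filter_mset (\<lambda>c. c \<noteq> 0) (exps a))))
              * 2 ^ count (exps a) 0"

lemma pow2_eq: "pow2 (omega_times a + of_nat k) = omega_pow a * 2 ^ k"
proof -
  define s where "s = (\<lambda>c. if is_fin c then c + 1 else c)"
  have ne: "s c \<noteq> 0" for c
  proof (cases "is_fin c")
    case True
    then show ?thesis by (cases c) (simp add: s_def plus_eord_def one_eord_def zero_eord_def)
  next
    case False
    then show ?thesis by (auto simp: s_def is_fin_def dest: spec[of _ 0])
  qed
  have op: "opred (s c) = c" for c
  proof (cases "is_fin c")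
    case True
    then have "is_fin (c + 1)" unfolding is_fin_def by (metis of_nat_Suc add.commute)
    with True show ?thesis by (cases c) (simp add: s_def opred_def plus_eord_def one_eord_def)
  qed (simp add: s_def opred_def)
  have e: "exps (omega_times a + of_nat k) = image_mset s (exps a) + replicate_mset k 0"
    by (simp add: omega_times_def of_nat_eord plus_eord_def s_def)
  have ne': "0 \<notin># image_mset s (exps a)"
    using ne by (auto simp: image_iff)
  then have "count (image_mset s (exps a)) 0 = 0" by (simp only: not_in_iff)
  then have "count (exps (omega_times a + of_nat k)) 0 = k"
    unfolding e by simp
  moreover have "filter_mset (\<lambda>c. c \<noteq> 0) (image_mset s (exps a) + replicate_mset k 0)
      = image_mset s (exps a)"
  proof -
    have "filter_mset (\<lambda>c. c \<noteq> 0) (image_mset s (exps a)) = image_mset s (exps a)"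
      using ne' by (intro filter_mset_eq_conv[THEN iffD2] conjI) (auto simp: image_iff)
    moreover have "filter_mset (\<lambda>c. c \<noteq> 0) (replicate_mset k 0) = ({#} :: eord multiset)"
      by (induction k) simp_all
    ultimately show ?thesis by (simp only: filter_union_mset add_0_right)
  qed
  moreover have "image_mset opred (image_mset s (exps a)) = exps a"
    using op by (simp add: image_mset.compositionality o_def)
  ultimately show ?thesis unfolding pow2_def e by (cases a) (simp only: exps.simps)
qed

fun F :: "nat \<Rightarrow> nat \<Rightarrow> nat" where
  "F 0 x = 2 ^ x"
| "F (Suc j) x = (F j ^^ (x + 1)) x"

definition Phi :: "nat \<Rightarrow> nat" where
  "Phi x = F 5 (x + 100)"

lemma finite_no_le: "finite {a. no a \<le> n}"
proof (induction n)
  case 0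
  have "a = Ord {#}" if "no a = 0" for a
    using that by (cases a rule: eord.exhaust, rename_tac M, case_tac M) auto
  then have "{a. no a \<le> 0} \<subseteq> {Ord {#}}" by blast
  then show ?case by (rule finite_subset) simp
next
  case (Suc n)
  have sz: "size M \<le> no (Ord M)" for M
    by (induction M) auto
  have "{a. no a \<le> Suc n} \<subseteq> Ord ` {M. set_mset M \<subseteq> {a. no a \<le> n} \<and> size M \<le> Suc n}"
  proof
    fix a assume a: "a \<in> {a. no a \<le> Suc n}"
    obtain M where M: "a = Ord M" by (cases a)
    have "no b \<le> n" if "b \<in># M" for b
      using no_less[OF that] a unfolding M by (simp del: no.simps)
    then have "set_mset M \<subseteq> {a. no a \<le> n}" by blast
    then show "a \<in> Ord ` {M. set_mset M \<subseteq> {a. no a \<le> n} \<and> size M \<le> Suc n}"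
      using a sz[of M] unfolding M by (auto simp del: no.simps)
  qed
  moreover have "finite {M. set_mset M \<subseteq> {a. no a \<le> n} \<and> size M \<le> Suc n}"
  proof -
    have "{M. set_mset M \<subseteq> {a. no a \<le> n} \<and> size M \<le> Suc n}
        \<subseteq> mset ` {xs. set xs \<subseteq> {a. no a \<le> n} \<and> length xs \<le> Suc n}"
    proof
      fix M assume M: "M \<in> {M. set_mset M \<subseteq> {a. no a \<le> n} \<and> size M \<le> Suc n}"
      obtain xs where "mset xs = M" using ex_mset by blast
      with M show "M \<in> mset ` {xs. set xs \<subseteq> {a. no a \<le> n} \<and> length xs \<le> Suc n}"
        by (intro image_eqI[of _ _ xs]) auto
    qed
    then show ?thesis
      using finite_lists_length_le[OF Suc] by (meson finite_imageI finite_subset)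
  qed
  ultimately show ?case by (meson finite_imageI finite_subset)
qed

text \<open>By \<open>finite_no_le\<close> the maximum in the next definition is taken over a finite set.\<close>

function psi :: "eord \<Rightarrow> nat" where
  "psi a = Max ({0} \<union> (\<lambda>b. psi b + 1) ` {b. b < a \<and> no b \<le> Phi (no a)})"
  by pat_completeness auto
termination
  by (relation "{(b, a). b < a}") (auto simp: wf)

declare psi.simps [simp del]


section \<open>Types and ordinal terms\<close>

datatype ty = Base | Arr ty ty  (infixr \<open>\<rightarrow>\<close> 65)

primrec lv :: "ty \<Rightarrow> nat" where
  "lv Base = 0"
| "lv (\<sigma> \<rightarrow> \<tau>) = max (lv \<sigma> + 1) (lv \<tau>)"

datatype tvar = TVar nat (vty: ty)

text \<open>
  \<open>OVar X i\<close> is the component $x_i$ of the vector associated with the typed variable \<open>X\<close>;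
  only \<open>i \<le> lv (vty X)\<close> is meant. \<open>OExp f g\<close> is $2^f\cdot g$ and \<open>OPsi f g\<close> is
  $\psi(\omega\cdot f+g)$.
\<close>

datatype oterm =
    OVar tvar nat
  | OZero
  | OOne
  | OOmega
  | OAdd oterm oterm
  | OExp oterm oterm
  | OPsi oterm oterm

primrec osubst :: "(tvar \<Rightarrow> nat \<Rightarrow> oterm) \<Rightarrow> oterm \<Rightarrow> oterm" where
  "osubst \<chi> (OVar X i) = \<chi> X i"
| "osubst \<chi> OZero = OZero"
| "osubst \<chi> OOne = OOne"
| "osubst \<chi> OOmega = OOmega"
| "osubst \<chi> (OAdd f g) = OAdd (osubst \<chi> f) (osubst \<chi> g)"
| "osubst \<chi> (OExp f g) = OExp (osubst \<chi> f) (osubst \<chi> g)"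
| "osubst \<chi> (OPsi f g) = OPsi (osubst \<chi> f) (osubst \<chi> g)"

text \<open>The typed variables some component of whose vector occurs in the term.\<close>

primrec ovecs :: "oterm \<Rightarrow> tvar set" where
  "ovecs (OVar X i) = {X}"
| "ovecs OZero = {}"
| "ovecs OOne = {}"
| "ovecs OOmega = {}"
| "ovecs (OAdd f g) = ovecs f \<union> ovecs g"
| "ovecs (OExp f g) = ovecs f \<union> ovecs g"
| "ovecs (OPsi f g) = ovecs f \<union> ovecs g"

definition xfree :: "tvar \<Rightarrow> oterm \<Rightarrow> bool" where
  "xfree X h \<longleftrightarrow> X \<notin> ovecs h"

text \<open>Interpretation of closed terms; the value at variables is irrelevant.\<close>

primrec oval :: "oterm \<Rightarrow> eord" where
  "oval (OVar X i) = 0"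
| "oval OZero = 0"
| "oval OOne = 1"
| "oval OOmega = omega_pow 1"
| "oval (OAdd f g) = oval f + oval g"
| "oval (OExp f g) = pow2 (oval f) * oval g"
| "oval (OPsi f g) = of_nat (psi (omega_pow 1 * oval f + oval g))"


section \<open>Vectors\<close>

text \<open>
  A vector of level \<open>n\<close> is a list of length \<open>n + 1\<close>; components beyond the level are \<open>0\<close>.
  Sums that arise in operations on vectors are formed with \<open>oplus\<close>, which omits a summand
  that is literally \<open>0\<close> (as it arises from a missing component or from an empty multiple):
  the classes of terms below do not contain \<open>0\<close>, so that $f+0$ has to be read as \<open>f\<close>.
\<close>

type_synonym vec = "oterm list"

definition level :: "vec \<Rightarrow> nat" where
  "level f = length f - 1"

definition vnth :: "vec \<Rightarrow> nat \<Rightarrow> oterm" where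
  "vnth f i = (if i < length f then f ! i else OZero)"

definition oplus :: "oterm \<Rightarrow> oterm \<Rightarrow> oterm" where
  "oplus f g = (if f = OZero then g else if g = OZero then f else OAdd f g)"

primrec omult :: "nat \<Rightarrow> oterm \<Rightarrow> oterm" where
  "omult 0 f = OZero"
| "omult (Suc k) f = oplus (omult k f) f"

definition osum :: "oterm list \<Rightarrow> oterm" where
  "osum fs = foldl oplus OZero fs"

definition vplus :: "vec \<Rightarrow> vec \<Rightarrow> vec" where
  "vplus f g = map (\<lambda>i. oplus (vnth f i) (vnth g i)) [0..<max (length f) (length g)]"

definition ones :: "nat \<Rightarrow> vec" where
  "ones n = replicate (n + 1) OOne"

definition xvec :: "tvar \<Rightarrow> vec" where
  "xvec X = map (OVar X) [0..<lv (vty X) + 1]"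

text \<open>\<open>osub X a h\<close> is $h\{\vec x := \vec a\}$.\<close>

definition osub :: "tvar \<Rightarrow> vec \<Rightarrow> oterm \<Rightarrow> oterm" where
  "osub X a = osubst (\<lambda>Y i. if Y = X then vnth a i else OVar Y i)"

definition osub1 :: "tvar \<Rightarrow> oterm \<Rightarrow> oterm" where
  "osub1 X = osub X (ones (lv (vty X)))"


section \<open>Classes of terms and the majorization orders\<close>

inductive clsB :: "nat \<Rightarrow> oterm \<Rightarrow> bool" where
  "clsB i OOne"
| "1 \<le> i \<Longrightarrow> clsB i OOmega"
| "clsB i f \<Longrightarrow> clsB i g \<Longrightarrow> clsB i (OAdd f g)"
| "1 \<le> i \<Longrightarrow> clsB (i + 1) f \<Longrightarrow> clsB i g \<Longrightarrow> clsB i (OExp f g)"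
| "clsB 1 f \<Longrightarrow> clsB 0 g \<Longrightarrow> oval g = of_nat k \<Longrightarrow> no (oval f) \<le> F 2 k \<Longrightarrow> clsB 0 (OPsi f g)"
| "clsB 0 f \<Longrightarrow> clsB i f"

definition bounded_norm :: "vec \<Rightarrow> bool" where
  "bounded_norm f \<longleftrightarrow> (\<forall>i \<le> level f. no (oval (vnth f i)) \<le> no (oval (vnth f 0)))"

definition admissible :: "tvar set \<Rightarrow> (tvar \<Rightarrow> nat \<Rightarrow> oterm) \<Rightarrow> bool" where
  "admissible V \<chi> \<longleftrightarrow>
     (\<forall>X\<in>V. (\<forall>i \<le> lv (vty X). clsB i (\<chi> X i)) \<and>
            bounded_norm (map (\<chi> X) [0..<lv (vty X) + 1]))"

definition oless :: "oterm \<Rightarrow> oterm \<Rightarrow> bool"  (infix \<open>\<prec>\<close> 50) where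
  "f \<prec> g \<longleftrightarrow>
     (\<forall>\<chi>. admissible (ovecs f \<union> ovecs g) \<chi> \<longrightarrow> oval (osubst \<chi> f) < oval (osubst \<chi> g))"

definition oleq :: "oterm \<Rightarrow> oterm \<Rightarrow> bool"  (infix \<open>\<preceq>\<close> 50) where
  "f \<preceq> g \<longleftrightarrow>
     (\<forall>\<chi>. admissible (ovecs f \<union> ovecs g) \<chi> \<longrightarrow> oval (osubst \<chi> f) \<le> oval (osubst \<chi> g))"

text \<open>
  $\mathrm{no}(f) \preceq F_2(g)$. Here and in \<open>clsB\<close>, $F_2(g)$ refers to a term \<open>g\<close> whose
  instances denote natural numbers, $F_2$ being a function on natural numbers.
\<close>

definition no_leq_F2 :: "oterm \<Rightarrow> oterm \<Rightarrow> bool" where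
  "no_leq_F2 f g \<longleftrightarrow>
     (\<forall>\<chi>. admissible (ovecs f \<union> ovecs g) \<chi> \<longrightarrow>
        (\<exists>k. oval (osubst \<chi> g) = of_nat k \<and> no (oval (osubst \<chi> f)) \<le> F 2 k))"

definition vless :: "vec \<Rightarrow> vec \<Rightarrow> bool"  (infix \<open>\<prec>\<^sub>v\<close> 50) where
  "f \<prec>\<^sub>v g \<longleftrightarrow> vnth f 0 \<prec> vnth g 0 \<and> (\<forall>i>0. vnth f i \<preceq> vnth g i)"

inductive clsC :: "tvar \<Rightarrow> nat \<Rightarrow> oterm \<Rightarrow> bool" for X :: tvar where
  "clsC X i OOne"
| "1 \<le> i \<Longrightarrow> clsC X i OOmega"
| "i \<le> lv (vty Y) \<Longrightarrow> clsC X i (OVar Y i)"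
| "clsC X i f \<Longrightarrow> clsC X i g \<Longrightarrow> clsC X i (OAdd f g)"
| "1 \<le> i \<Longrightarrow> clsC X (i + 1) f \<Longrightarrow> clsC X i g \<Longrightarrow> clsC X i (OExp f g)"
| "clsC X 1 f \<Longrightarrow> clsC X 0 g \<Longrightarrow> no_leq_F2 f g \<Longrightarrow> clsC X 0 (OPsi f g)"
| "clsC X 0 f \<Longrightarrow> xfree X f \<Longrightarrow> clsC X i f"

definition vecC :: "tvar \<Rightarrow> vec \<Rightarrow> bool" where
  "vecC X h \<longleftrightarrow> (\<forall>i \<le> level h. clsC X i (vnth h i))"


section \<open>The operators $\Box$ and $\delta$\<close>

text \<open>Meant for \<open>level f > level g\<close>. A natural number is the sum of that many ones.\<close>

function boxc :: "vec \<Rightarrow> vec \<Rightarrow> nat \<Rightarrow> oterm" where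
  "boxc f g i =
     (if i = 0 then
        OPsi (boxc f g 1)
          (oplus (oplus (vnth f 0) (vnth g 0)) (omult (level g) OOne))
      else if i \<le> level g then OExp (boxc f g (i + 1)) (oplus (vnth f i) (vnth g i))
      else vnth f i)"
  by pat_completeness auto
termination
  by (relation "measure (\<lambda>(f, g, i). level g + 1 - i)") auto

declare boxc.simps [simp del]

definition box :: "vec \<Rightarrow> vec \<Rightarrow> vec"  (infixl \<open>\<box>\<close> 65) where
  "f \<box> g = map (boxc f g) [0..<level f + 1]"

definition restr :: "vec \<Rightarrow> nat \<Rightarrow> vec"  (infixl \<open>\<restriction>\<close> 60) where
  "f \<restriction> i = take (i + 1) f"

text \<open>
  \<open>delta X i h\<close> is $\delta^{\vec x}_i h$, meant for \<open>clsC X i h\<close>; its values on other terms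
  are artefacts of the recursion on \<open>h\<close>.
\<close>

fun delta :: "tvar \<Rightarrow> nat \<Rightarrow> oterm \<Rightarrow> vec" where
  "delta X i h =
     (let n = lv (vty X) + 1 in
      if xfree X h then map (\<lambda>j. if j = i then oplus h OOne else OOne) [0..<n + 1]
      else case h of
        OAdd f g \<Rightarrow> vplus (vplus (delta X i f) (delta X i g)) (ones n)
      | OExp f g \<Rightarrow>
          vplus (vplus (vplus (delta X (i + 1) f) (delta X (i + 1) f)) (delta X i g)) (ones n)
      | OPsi f g \<Rightarrow>
          OPsi (osub1 X f) (vnth (delta X 0 g) 0) #
          map (\<lambda>j. oplus (vnth (delta X 1 f) j) (vnth (delta X 0 g) j)) [1..<n + 1]
      | _ \<Rightarrow> ones n)"

declare delta.simps [simp del]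

fun sz :: "tvar \<Rightarrow> oterm \<Rightarrow> nat" where
  "sz X h =
     (if xfree X h then 1
      else case h of
        OAdd f g \<Rightarrow> sz X f + sz X g + 1
      | OPsi f g \<Rightarrow> sz X f + sz X g + 1
      | OExp f g \<Rightarrow> 2 * sz X f + sz X g + 1
      | _ \<Rightarrow> 1)"

declare sz.simps [simp del]

text \<open>\<open>vdelta X h\<close> is $\delta^{\vec x}\vec h$, meant for \<open>vecC X h\<close>.\<close>

definition vdelta :: "tvar \<Rightarrow> vec \<Rightarrow> vec" where
  "vdelta X h =
     (let n = lv (vty X) + 1; m = level h in
      map (\<lambda>j.
        if j = 0 then
          omult (2 ^ n * (\<Sum>i\<le>m. sz X (vnth h i))) (vnth (delta X 0 (vnth h 0)) 0)
        else if j \<le> n then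
          osum (map (\<lambda>i. vnth (delta X i (vnth h i)) j) [0..<m + 1])
        else vnth h j) [0..<max n m + 1])"


section \<open>Terms and reduction\<close>

text \<open>
  \<open>Cond\<close> and \<open>Rec\<close> are the constants $\mathsf D_\tau$ and $\mathsf R_\tau$, and \<open>RecT \<tau> t\<close>
  is the term $\mathsf R_\tau^t$. Terms are named; they are not identified modulo renaming of
  bound variables.
\<close>

datatype tm =
    Var tvar
  | Zero
  | Succ
  | Cond ty
  | Rec ty
  | RecT ty tm
  | App tm tm
  | Lam tvar tm

primrec cod :: "ty \<Rightarrow> ty" where
  "cod Base = Base"
| "cod (\<sigma> \<rightarrow> \<tau>) = \<tau>"

text \<open>The type of a well-typed term; \<open>wt A\<close> says that \<open>A\<close> is well-typed, i.e. in $\mathcal T'$.\<close>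

primrec tyof :: "tm \<Rightarrow> ty" where
  "tyof (Var X) = vty X"
| "tyof Zero = Base"
| "tyof Succ = Base \<rightarrow> Base"
| "tyof (Cond \<tau>) = Base \<rightarrow> \<tau> \<rightarrow> \<tau> \<rightarrow> \<tau>"
| "tyof (Rec \<tau>) = Base \<rightarrow> (Base \<rightarrow> \<tau> \<rightarrow> \<tau>) \<rightarrow> \<tau> \<rightarrow> \<tau>"
| "tyof (RecT \<tau> t) = (Base \<rightarrow> \<tau> \<rightarrow> \<tau>) \<rightarrow> \<tau> \<rightarrow> \<tau>"
| "tyof (App A B) = cod (tyof A)"
| "tyof (Lam X A) = vty X \<rightarrow> tyof A"

primrec wt :: "tm \<Rightarrow> bool" where
  "wt (Var X) \<longleftrightarrow> True"
| "wt Zero \<longleftrightarrow> True"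
| "wt Succ \<longleftrightarrow> True"
| "wt (Cond \<tau>) \<longleftrightarrow> True"
| "wt (Rec \<tau>) \<longleftrightarrow> True"
| "wt (RecT \<tau> t) \<longleftrightarrow> wt t \<and> tyof t = Base"
| "wt (App A B) \<longleftrightarrow> wt A \<and> wt B \<and> (\<exists>\<tau>. tyof A = tyof B \<rightarrow> \<tau>)"
| "wt (Lam X A) \<longleftrightarrow> wt A"

primrec FV :: "tm \<Rightarrow> tvar set" where
  "FV (Var X) = {X}"
| "FV Zero = {}"
| "FV Succ = {}"
| "FV (Cond \<tau>) = {}"
| "FV (Rec \<tau>) = {}"
| "FV (RecT \<tau> t) = FV t"
| "FV (App A B) = FV A \<union> FV B"
| "FV (Lam X A) = FV A - {X}"

text \<open>The list of all binder occurrences.\<close>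

primrec binders :: "tm \<Rightarrow> tvar list" where
  "binders (Var X) = []"
| "binders Zero = []"
| "binders Succ = []"
| "binders (Cond \<tau>) = []"
| "binders (Rec \<tau>) = []"
| "binders (RecT \<tau> t) = binders t"
| "binders (App A B) = binders A @ binders B"
| "binders (Lam X A) = X # binders A"

definition BV :: "tm \<Rightarrow> tvar set" where
  "BV A = set (binders A)"

primrec subterms :: "tm \<Rightarrow> tm set" where
  "subterms (Var X) = {Var X}"
| "subterms Zero = {Zero}"
| "subterms Succ = {Succ}"
| "subterms (Cond \<tau>) = {Cond \<tau>}"
| "subterms (Rec \<tau>) = {Rec \<tau>}"
| "subterms (RecT \<tau> t) = {RecT \<tau> t} \<union> subterms t"
| "subterms (App A B) = {App A B} \<union> subterms A \<union> subterms B"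
| "subterms (Lam X A) = {Lam X A} \<union> subterms A"

text \<open>
  Plain replacement of the free occurrences of \<open>X\<close>; it is only used where no variable
  can be captured.
\<close>

primrec tsubst :: "tm \<Rightarrow> tvar \<Rightarrow> tm \<Rightarrow> tm"  (\<open>_{_:=_}\<close> [1000, 0, 0] 1000) where
  "tsubst (Var Y) X C = (if Y = X then C else Var Y)"
| "tsubst Zero X C = Zero"
| "tsubst Succ X C = Succ"
| "tsubst (Cond \<tau>) X C = Cond \<tau>"
| "tsubst (Rec \<tau>) X C = Rec \<tau>"
| "tsubst (RecT \<tau> t) X C = RecT \<tau> (tsubst t X C)"
| "tsubst (App A B) X C = App (tsubst A X C) (tsubst B X C)"
| "tsubst (Lam Y A) X C = Lam Y (if Y = X then A else tsubst A X C)"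

inductive red :: "tm \<Rightarrow> tm \<Rightarrow> bool"  (infix \<open>\<rhd>\<close> 50) where
  cond_Zero: "App (App (App (Cond \<tau>) Zero) A) B \<rhd> A"
| cond_Succ: "App (App (App (Cond \<tau>) (App Succ t)) A) B \<rhd> B"
| rec_RecT: "App (Rec \<tau>) t \<rhd> RecT \<tau> t"
| recT_Zero: "App (App (RecT \<tau> Zero) A) B \<rhd> B"
| recT_Succ: "App (App (RecT \<tau> (App Succ t)) A) B
                \<rhd> App (App A t) (App (App (RecT \<tau> t) A) B)"
| beta: "BV (Lam X A) \<inter> FV B = {} \<Longrightarrow> App (Lam X A) B \<rhd> A{X:=B}"
| appL: "A \<rhd> A' \<Longrightarrow> App A B \<rhd> App A' B"
| appR: "B \<rhd> B' \<Longrightarrow> App A B \<rhd> App A B'"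
| recT: "s \<rhd> t \<Longrightarrow> RecT \<tau> s \<rhd> RecT \<tau> t"
| xi: "A \<rhd> B \<Longrightarrow> Lam X A \<rhd> Lam X B"

inductive alpha :: "tm \<Rightarrow> tm \<Rightarrow> bool"  (infix \<open>\<equiv>\<^sub>\<alpha>\<close> 50) where
  "A \<equiv>\<^sub>\<alpha> A"
| "A \<equiv>\<^sub>\<alpha> B \<Longrightarrow> B \<equiv>\<^sub>\<alpha> A"
| "A \<equiv>\<^sub>\<alpha> B \<Longrightarrow> B \<equiv>\<^sub>\<alpha> C \<Longrightarrow> A \<equiv>\<^sub>\<alpha> C"
| "vty Y = vty X \<Longrightarrow> Y \<notin> FV A \<union> BV A \<Longrightarrow> Lam X A \<equiv>\<^sub>\<alpha> Lam Y (A{X:=Var Y})"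
| "s \<equiv>\<^sub>\<alpha> t \<Longrightarrow> RecT \<tau> s \<equiv>\<^sub>\<alpha> RecT \<tau> t"
| "A \<equiv>\<^sub>\<alpha> A' \<Longrightarrow> B \<equiv>\<^sub>\<alpha> B' \<Longrightarrow> App A B \<equiv>\<^sub>\<alpha> App A' B'"
| "A \<equiv>\<^sub>\<alpha> B \<Longrightarrow> Lam X A \<equiv>\<^sub>\<alpha> Lam X B"

definition well_named :: "tm \<Rightarrow> bool" where
  "well_named A \<longleftrightarrow> (\<forall>B \<in> subterms A. FV B \<inter> BV B = {} \<and> distinct (binders B))"

definition red_alpha :: "tm \<Rightarrow> tm \<Rightarrow> bool"  (infix \<open>\<rhd>\<^sub>\<alpha>\<close> 50) where
  "A \<rhd>\<^sub>\<alpha> B \<longleftrightarrow> well_named A \<and> well_named B \<and> (\<exists>B'. A \<rhd> B' \<and> B \<equiv>\<^sub>\<alpha> B')"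


section \<open>Assignment derivations\<close>

text \<open>
  Derivation trees, the term at the root of a tree, and the vector assigned to that term.
  \<open>DLam X [d\<^sub>0, \<dots>, d\<^sub>m]\<close> is the tree for $\lambda X.G$ built from derivations \<open>d\<^sub>i\<close> of $G_i$,
  where $G$ is $G_m$. Not every tree is a derivation; \<open>is_deriv\<close> states the side conditions.
\<close>

datatype deriv =
    DVar tvar
  | DZero
  | DSucc
  | DCond ty
  | DRec ty
  | DRecT ty deriv
  | DApp deriv deriv
  | DLam tvar "deriv list"

primrec dterm :: "deriv \<Rightarrow> tm" where
  "dterm (DVar X) = Var X"
| "dterm DZero = Zero"
| "dterm DSucc = Succ"
| "dterm (DCond \<tau>) = Cond \<tau>"
| "dterm (DRec \<tau>) = Rec \<tau>"
| "dterm (DRecT \<tau> d) = RecT \<tau> (dterm d)"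
| "dterm (DApp d e) = App (dterm d) (dterm e)"
| "dterm (DLam X ds) = Lam X (last (map dterm ds))"

text \<open>
  The vectors of $BC$, $\mathsf R_\tau^t$ and $\lambda X.G$ in terms of those of the
  constituents; \<open>\<tau>\<close> is the type of $BC$ in \<open>app_vec\<close>.
\<close>

definition app_vec :: "ty \<Rightarrow> vec \<Rightarrow> vec \<Rightarrow> vec" where
  "app_vec \<tau> v w = v \<box> w \<restriction> lv \<tau>"

definition recT_vec :: "ty \<Rightarrow> vec \<Rightarrow> vec" where
  "recT_vec \<tau> v = [vnth v 0] @ replicate (lv \<tau> + 1) OOne @ [vnth v 0]"

definition lam_vec :: "tvar \<Rightarrow> vec \<Rightarrow> vec \<Rightarrow> vec" where
  "lam_vec X v w = vplus (vdelta X v) (map (osub1 X) w)"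

primrec dvec :: "deriv \<Rightarrow> vec" where
  "dvec (DVar X) = xvec X"
| "dvec DZero = [OOne]"
| "dvec DSucc = [OOne, OOne]"
| "dvec (DCond \<tau>) = ones (lv \<tau> + 1)"
| "dvec (DRec \<tau>) = [omult 2 OOne] @ replicate (lv \<tau> + 1) OOne @ [OOmega]"
| "dvec (DRecT \<tau> d) = recT_vec \<tau> (dvec d)"
| "dvec (DApp d e) = app_vec (cod (tyof (dterm d))) (dvec d) (dvec e)"
| "dvec (DLam X ds) = lam_vec X (hd (map dvec ds)) (last (map dvec ds))"

text \<open>
  The condition \<open>vecC X (dvec (hd ds))\<close> on abstractions says that $\delta^{\vec x}[G_0]$ is
  defined, $\delta^{\vec x}$ being an operator on $\mathcal C^{\vec x}$.
\<close>

inductive is_deriv :: "deriv \<Rightarrow> bool" where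
  "is_deriv (DVar X)"
| "is_deriv DZero"
| "is_deriv DSucc"
| "is_deriv (DCond \<tau>)"
| "is_deriv (DRec \<tau>)"
| "is_deriv d \<Longrightarrow> tyof (dterm d) = Base \<Longrightarrow> is_deriv (DRecT \<tau> d)"
| "is_deriv d \<Longrightarrow> is_deriv e \<Longrightarrow> tyof (dterm d) = tyof (dterm e) \<rightarrow> \<tau> \<Longrightarrow> is_deriv (DApp d e)"
| "ds \<noteq> [] \<Longrightarrow>
   (\<And>d. d \<in> set ds \<Longrightarrow> is_deriv d) \<Longrightarrow>
   (\<And>i. i + 1 < length ds \<Longrightarrow> dterm (ds ! i) \<rhd>\<^sub>\<alpha> dterm (ds ! (i + 1))) \<Longrightarrow>
   (\<And>\<tau> t. RecT \<tau> t \<in> subterms (dterm (hd ds)) \<Longrightarrow> X \<notin> FV t) \<Longrightarrow>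
   (\<And>i. i + 1 < length ds \<Longrightarrow> dvec (ds ! (i + 1)) \<prec>\<^sub>v dvec (ds ! i)) \<Longrightarrow>
   vecC X (dvec (hd ds)) \<Longrightarrow>
   is_deriv (DLam X ds)"


section \<open>The assignment algorithm\<close>

text \<open>
  \<open>assign d B v\<close>: run on the derivation \<open>d\<close> and a reduction of \<open>dterm d\<close> to \<open>B\<close>, the
  algorithm assigns \<open>v\<close> to \<open>B\<close>. It is a relation since \<open>dterm d\<close> may reduce to \<open>B\<close> by
  contraction of different redexes. Only the assigned vector is recorded, not the derivation
  it comes with; for a beta redex $(\lambda X.G)H$ it is the vector
  $[G_m]\{\vec x := [H]\}$ of the derivation of $G\{X := H\}$ obtained by substitution.
\<close>

inductive assign :: "deriv \<Rightarrow> tm \<Rightarrow> vec \<Rightarrow> bool" where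
  "assign (DApp (DApp (DApp (DCond \<tau>) DZero) a) b) (dterm a) (dvec a)"
| "assign (DApp (DApp (DApp (DCond \<tau>) (DApp DSucc t)) a) b) (dterm b) (dvec b)"
| "assign (DApp (DRec \<tau>) t) (dterm (DRecT \<tau> t)) (dvec (DRecT \<tau> t))"
| "assign (DApp (DApp (DRecT \<tau> DZero) f) g) (dterm g) (dvec g)"
| "e = DApp (DApp f t) (DApp (DApp (DRecT \<tau> t) f) g) \<Longrightarrow>
   assign (DApp (DApp (DRecT \<tau> (DApp DSucc t)) f) g) (dterm e) (dvec e)"
| "G = dterm (last ds) \<Longrightarrow> BV (Lam X G) \<inter> FV (dterm h) = {} \<Longrightarrow>
   assign (DApp (DLam X ds) h) (G{X:=dterm h}) (map (osub X (dvec h)) (dvec (last ds)))"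
| "assign b B v \<Longrightarrow>
   assign (DApp b c) (App B (dterm c)) (app_vec (cod (tyof B)) v (dvec c))"
| "assign c C v \<Longrightarrow>
   assign (DApp b c) (App (dterm b) C) (app_vec (cod (tyof (dterm b))) (dvec b) v)"
| "assign s t v \<Longrightarrow> assign (DRecT \<tau> s) (RecT \<tau> t) (recT_vec \<tau> v)"
| "assign (last ds) G v \<Longrightarrow> assign (DLam X ds) (Lam X G) (lam_vec X (dvec (hd ds)) v)"

end

theory Submission
  imports Defs
begin

text \<open>
  Along the derivation every assigned vector, evaluated at an admissible substitution, stays in the
  classes $\mathcal B_i$ and has bounded norm. Hence the norms of all ordinals that occur are
  dominated by $F_2$ of the component of index 0, the norm conditions in the definition of \<open>psi\<close>
  hold automatically, and only ordinal inequalities remain. For a beta redex the point is Howard's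
  majorization: $h\{\vec x := \vec a\}$ is bounded by the matching component of
  $\delta^{\vec x}h \mathbin\Box \vec a$, by induction on $h$. In component 0 nested values of
  \<open>psi\<close> have to be absorbed, which \<open>psi\<close> does at the price of a single $\omega$ in its
  argument. For the successor case of the recursor the components of redex and contract are compared
  from the top index downwards, starting from the gap between $2^{[t]_0}$ and $2^{[\mathsf St]_0}$.
\<close>

section \<open>Ordinal arithmetic\<close>

text \<open>The obstacle is that \<open>psi\<close> is not monotone: from b < a follows psi b < psi
  a only if no b <= Phi (no a). So each inequality between collapsed values has a norm bound as its
  twin, and the shape of the vectors serves both. In a box, the finite summand below
  \<open>psi\<close> contains both components 0, which bound all norms, and the level n, which
  bounds the height 2 * n of the tower built by the nested powers; hence the norm of the coefficient
  of omega is at most F_2 of that summand. In delta, the factor 2^n makes up for the factor 2 by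
  which no f may exceed no (2^f * g), and sz is the height of a tower that bounds norms after
  substitution. A box is superadditive in its first argument on positive components, so that delta,
  which is built from sums, can be boxed summand by summand. The two summands of the vector of an
  abstraction have separate jobs: delta of the fixed [G_0] majorizes beta contraction, since [G_m]
  lies below [G_0] at all admissible substitutions, while [G_m] at x := 1 provides the strict drop
  under xi.\<close>

instantiation eord :: cancel_comm_monoid_add
begin

definition "a - b = Ord (exps a - exps b)"

instance
proof
  show "a + b - a = b" for a b :: eord
    by (cases b) (simp add: minus_eord_def plus_eord_def)
  show "a - b - c = a - (b + c)" for a b c :: eord
    by (simp add: minus_eord_def plus_eord_def)
qed

end

text \<open>Since \<open><\<close> is transitive, its multiset extension is reached in a single
  replacement: keep a common part I and exchange a nonempty J for a K, each member of which lies
  below one of J. This rule and its converse \<open>Ord_less_stepE\<close> stand in for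
  \<open>multp\<close>.\<close>

lemma Ord_less_stepI:
  "J \<noteq> {#} \<Longrightarrow> (\<And>k. k \<in># K \<Longrightarrow> \<exists>j\<in>#J. k < j) \<Longrightarrow> Ord (I + K) < Ord (I + J)"
  unfolding Ord_less_iff by (rule one_step_implies_multp) auto

lemma Ord_less_stepE:
  assumes "Ord M < Ord N"
  obtains I J K where "N = I + J" "M = I + K" "J \<noteq> {#}" "\<And>k. k \<in># K \<Longrightarrow> \<exists>j\<in>#J. k < j"
  using multp_implies_one_step[OF transp_on_less assms[unfolded Ord_less_iff]] by blast

text \<open>The instance used is the map y to x + y on exponents, that is, multiplication by
  omega^x.\<close>

lemma Ord_image_less:
  assumes "strict_mono f" "Ord M < Ord N"
  shows "Ord (image_mset f M) < Ord (image_mset f N)"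
proof -
  obtain I J K where *: "N = I + J" "M = I + K" "J \<noteq> {#}" "\<And>k. k \<in># K \<Longrightarrow> \<exists>j\<in>#J. k < j"
    using Ord_less_stepE[OF assms(2)] by metis
  have "Ord (image_mset f I + image_mset f K) < Ord (image_mset f I + image_mset f J)"
  proof (rule Ord_less_stepI)
    fix x assume "x \<in># image_mset f K"
    then obtain k where k: "k \<in># K" "x = f k" by auto
    then obtain j where "j \<in># J" "k < j" using *(4) by blast
    then show "\<exists>j\<in>#image_mset f J. x < j"
      using k assms(1) by (auto simp: strict_mono_def intro!: bexI[of _ j])
  qed (use *(3) in simp)
  then show ?thesis by (simp add: *)
qed

lemma Ord_exps [simp]: "Ord (exps a) = a"
  by (cases a) simp

lemma exps_plus [simp]: "exps (a + b) = exps a + exps b"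
  by (simp add: plus_eord_def)

lemma exps_zero [simp]: "exps 0 = {#}"
  by (simp add: zero_eord_def)

lemma exps_one [simp]: "exps 1 = {#0#}"
  by (simp add: one_eord_def)

lemma exps_omega_pow [simp]: "exps (omega_pow a) = {#a#}"
  by (simp add: omega_pow_def)

lemma exps_eq_iff: "exps a = exps b \<longleftrightarrow> a = b"
  by (metis Ord_exps)

lemma zero_le_eord [simp]: "0 \<le> (a :: eord)"
proof (cases "exps a = {#}")
  case True
  then show ?thesis by (metis Ord_exps order_refl zero_eord_def)
next
  case False
  then have "Ord ({#} + {#}) < Ord ({#} + exps a)" by (intro Ord_less_stepI) auto
  then show ?thesis by (simp add: zero_eord_def)
qed

lemma not_less_zero_eord [simp]: "\<not> a < (0 :: eord)"
  by (simp add: linorder_not_less)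

lemma eord_gr_zero_iff: "0 < (a :: eord) \<longleftrightarrow> a \<noteq> 0"
  by (metis order_le_less zero_le_eord less_irrefl)

lemma omega_pow_times: "omega_pow x * b = Ord (image_mset ((+) x) (exps b))"
  by (simp add: times_eord_def)

lemma omega_pow_plus: "omega_pow (a + b) = omega_pow a * omega_pow b"
  by (simp add: omega_pow_times) (simp add: omega_pow_def)

lemma omega_pow_zero [simp]: "omega_pow 0 = 1"
  by (simp add: omega_pow_def one_eord_def)

text \<open>Induction on the number of terms of the normal form; with natural sums the terms may be
  split off in any order.\<close>

lemma eord_induct [case_names zero add]:
  assumes "P 0" "\<And>x a. P a \<Longrightarrow> P (omega_pow x + a)"
  shows "P a"
proof -
  have "P (Ord M)" for M
  proof (induction M)
    case empty
    then show ?case using assms(1) by (simp add: zero_eord_def)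
  next
    case (add x M)
    then show ?case using assms(2)[of "Ord M" x] by (simp add: plus_eord_def)
  qed
  then show ?thesis by (metis Ord_exps)
qed

lemma eord_add_strict_left_mono: "a < b \<Longrightarrow> c + a < c + (b :: eord)"
proof -
  assume "a < b"
  then have "Ord (exps a) < Ord (exps b)" by simp
  from Ord_less_stepE[OF this] obtain I J K where *: "exps b = I + J" "exps a = I + K" "J \<noteq> {#}"
      "\<And>k. k \<in># K \<Longrightarrow> \<exists>j\<in>#J. k < j" by metis
  then show ?thesis
    using Ord_less_stepI[of J K "exps c + I"]
    by (simp add: plus_eord_def ac_simps)
qed

instance eord :: linordered_cancel_ab_semigroup_add
proof
  show "a \<le> b \<Longrightarrow> c + a \<le> c + b" for a b c :: eord
    using eord_add_strict_left_mono[of a b c] by (auto simp: order_le_less)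
qed

lemma omega_pow_pos [simp]: "0 < omega_pow a"
  by (simp add: eord_gr_zero_iff flip: exps_eq_iff)

lemma eord_mult_strict_left_mono: "a < b \<Longrightarrow> 0 < c \<Longrightarrow> c * a < c * (b :: eord)"
proof -
  assume ab: "a < b" and "0 < c"
  have *: "omega_pow x * a < omega_pow x * b" for x
    unfolding omega_pow_times
    by (rule Ord_image_less) (use ab in \<open>auto simp: strict_mono_def add_strict_left_mono\<close>)
  have "c * a \<le> c * b \<and> (0 < c \<longrightarrow> c * a < c * b)"
  proof (induction c rule: eord_induct)
    case (add x c)
    then show ?case using *[of x]
      by (auto simp: distrib_right intro: add_less_le_mono order_less_imp_le)
  qed simp
  with \<open>0 < c\<close> show ?thesis by blast
qed

instance eord :: linordered_comm_semiring_strict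
  by standard (rule eord_mult_strict_left_mono)

instance eord :: linordered_nonzero_semiring
proof
  show "(0::eord) < 1" by (simp add: eord_gr_zero_iff)
qed (auto intro: mult_left_mono add_strict_right_mono)

text \<open>Adding 1 adds one exponent 0. The proof asks in which part of the one-step decomposition
  this new 0 ends up.\<close>

lemma less_eord_add1_iff: "a < b + 1 \<longleftrightarrow> a \<le> (b :: eord)"
proof
  assume "a < b + 1"
  then have "Ord (exps a) < Ord (exps b + {#0#})" by (simp add: plus_eord_def one_eord_def)
  from Ord_less_stepE[OF this] obtain I J K where *: "exps b + {#0#} = I + J" "exps a = I + K"
      "J \<noteq> {#}" "\<And>k. k \<in># K \<Longrightarrow> \<exists>j\<in>#J. k < j" by metis
  show "a \<le> b"
  proof (cases "0 \<in># J")
    case True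
    then obtain J' where J: "J = J' + {#0#}" by (metis add_mset_add_single multi_member_split)
    then have b: "exps b = I + J'" using *(1) by simp
    have K: "\<exists>j\<in>#J'. k < j" if "k \<in># K" for k
    proof -
      obtain j where "j \<in># J" "k < j" using *(4)[OF \<open>k \<in># K\<close>] by blast
      moreover from this have "j \<noteq> 0" by auto
      ultimately show ?thesis using J by auto
    qed
    show ?thesis
    proof (cases "J' = {#}")
      case True
      then have "K = {#}" using K by fastforce
      then show ?thesis using b *(2) True by (metis exps_eq_iff order_refl)
    next
      case False
      then have "Ord (I + K) < Ord (I + J')" using K by (rule Ord_less_stepI)
      then show ?thesis using b *(2) by (metis Ord_exps order_less_imp_le)
    qed
  next
    case False
    \<comment> \<open>Now J has positive exponents only, and any of them dominates a 0 that is moved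
      from the common part to K.\<close>
    then have "0 \<in># I" using *(1) by (metis multi_member_last union_iff add_mset_add_single)
    then obtain I' where I: "I = I' + {#0#}" by (metis add_mset_add_single multi_member_split)
    then have b: "exps b = I' + J" using *(1) by simp
    obtain j where j: "j \<in># J" using *(3) by blast
    then have "0 < j" using False by (auto simp: eord_gr_zero_iff)
    then have "Ord (I' + (K + {#0#})) < Ord (I' + J)"
      using *(3,4) j by (intro Ord_less_stepI) auto
    then have "a < b" using b *(2) I by (metis Ord_exps add.assoc add.commute)
    then show ?thesis by simp
  qed
next
  assume "a \<le> b"
  then show "a < b + 1"
    using add_strict_left_mono[of 0 1 b] by (simp add: order_le_less_trans)
qed

lemma eord_less_iff_add1_le: "a < b \<longleftrightarrow> a + 1 \<le> (b :: eord)"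
  by (metis less_eord_add1_iff linorder_not_le)

lemma one_le_eord_iff: "1 \<le> a \<longleftrightarrow> 0 < (a :: eord)"
  by (simp add: eord_less_iff_add1_le)

lemma less_add_self_eord: "0 < b \<Longrightarrow> a < a + (b :: eord)"
  using add_strict_left_mono[of 0 b a] by simp

lemma add_ge_left_eord: "a \<le> a + (b :: eord)"
  using add_left_mono[of 0 b a] by simp

lemma add_ge_right_eord: "b \<le> a + (b :: eord)"
  using add_right_mono[of 0 a b] by simp

text \<open>Serves \<open>bx_superadditive\<close>: powers of two with positive exponents are at
  least 2, so their sum is at most their product.\<close>

lemma two_times_le_mult: "2 \<le> x \<Longrightarrow> 2 \<le> y \<Longrightarrow> x + y \<le> x * (y :: eord)"
proof (induction x y rule: linorder_wlog)
  case (le a b)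
  have "a + b \<le> 2 * b" using le by (simp add: mult_2 add_right_mono)
  also have "\<dots> \<le> a * b" using le by (intro mult_right_mono) simp_all
  finally show ?case .
next
  case (sym a b)
  then show ?case by (simp add: ac_simps)
qed

abbreviation omega :: eord where
  "omega \<equiv> omega_pow 1"

lemma of_nat_less_omega: "of_nat k < omega"
proof -
  have "Ord ({#} + replicate_mset k 0) < Ord ({#} + {#1#})"
    by (rule Ord_less_stepI) (auto split: if_splits)
  then show ?thesis by (simp add: of_nat_eord omega_pow_def)
qed

lemma less_omegaD: "a < omega \<Longrightarrow> \<exists>k. a = of_nat k"
proof -
  assume "a < omega"
  then have "Ord (exps a) < Ord {#1#}" by (simp add: omega_pow_def)
  from Ord_less_stepE[OF this] obtain I J K where *: "{#1#} = I + J" "exps a = I + K" "J \<noteq> {#}"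
      "\<And>k. k \<in># K \<Longrightarrow> \<exists>j\<in>#J. k < j" by metis
  then have "I = {#} \<and> J = {#1#}"
    by (simp add: single_is_union)
  then have IJ: "I = {#}" "J = {#1#}" by auto
  have "k < 0 + 1" if "k \<in># exps a" for k
    using *(4)[of k] that unfolding *(2) IJ by simp
  then have "set_mset (exps a) \<subseteq> {0}"
    unfolding less_eord_add1_iff by (auto intro: order_antisym)
  then obtain k where "exps a = replicate_mset k 0" by (metis set_mset_subset_singletonD)
  then show ?thesis by (metis Ord_exps of_nat_eord)
qed

text \<open>Here \<open>omega * a\<close> is the natural product, as in the arguments of
  \<open>psi\<close>; \<open>omega_times\<close> is the ordinary one and enters only through
  \<open>pow2\<close>.\<close>

lemma omega_times_less:
  assumes "a < (b :: eord)"
  shows "omega * a + of_nat k < omega * b + of_nat l"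
proof -
  have "omega * a + of_nat k < omega * (a + 1)"
    by (simp add: distrib_left add_strict_left_mono of_nat_less_omega)
  also have "\<dots> \<le> omega * b" using assms by (simp add: eord_less_iff_add1_le mult_left_mono)
  also have "\<dots> \<le> omega * b + of_nat l" using add_left_mono[of 0 "of_nat l" "omega * b"] by simp
  finally show ?thesis .
qed

subsection \<open>Powers of two\<close>

text \<open>Both ingredients of \<open>pow2\<close>, the multiset of shifted nonzero exponents and
  the number of exponents 0, are additive, and \<open>omega_pow\<close> turns natural sums into
  natural products.\<close>

lemma pow2_add: "pow2 (a + b) = pow2 a * pow2 b"
proof -
  let ?f = "\<lambda>a. Ord (image_mset opred (filter_mset (\<lambda>c. c \<noteq> 0) (exps a)))"
  have "?f (a + b) = ?f a + ?f b" by (simp add: plus_eord_def)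
  then show ?thesis by (simp add: pow2_def omega_pow_plus power_add ac_simps)
qed

lemma pow2_0 [simp]: "pow2 0 = 1"
  by (simp add: pow2_def flip: zero_eord_def)

lemma pow2_1 [simp]: "pow2 1 = 2"
  by (simp add: pow2_def flip: zero_eord_def)

lemma pow2_of_nat: "pow2 (of_nat k) = 2 ^ k"
  by (induction k) (simp_all add: pow2_add)

lemma is_fin_iff: "is_fin a \<longleftrightarrow> a < omega"
  using less_omegaD of_nat_less_omega by (auto simp: is_fin_def)

lemma omega_times_add: "omega_times (a + b) = omega_times a + omega_times b"
  by (simp add: omega_times_def plus_eord_def)

lemma omega_times_pow: "omega_times (omega_pow c) = omega_pow (if is_fin c then c + 1 else c)"
  by (simp add: omega_times_def) (simp add: omega_pow_def)

lemma omega_times_0 [simp]: "omega_times 0 = 0"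
  by (simp add: omega_times_def zero_eord_def)

lemma opred_inverse: "c \<noteq> 0 \<Longrightarrow> (if is_fin (opred c) then opred c + 1 else opred c) = c"
proof (cases "is_fin c")
  case True
  assume "c \<noteq> 0"
  from True obtain k where "c = of_nat k" by (auto simp: is_fin_def)
  with \<open>c \<noteq> 0\<close> obtain l where c: "c = of_nat l + 1" by (cases k) (auto simp: add.commute)
  then have "opred c = of_nat l" using True by (simp add: opred_def)
  then show ?thesis using c by (auto simp: is_fin_def)
qed (simp add: opred_def)

text \<open>With this, \<open>pow2_eq\<close> computes \<open>pow2\<close> everywhere. Nonzero
  exponents are shifted back by \<open>opred\<close>, exponents 0 are counted by k.\<close>

lemma omega_times_cases:
  obtains a0 k where "a = omega_times a0 + of_nat k"
proof -
  have "\<exists>a0 k. a = omega_times a0 + of_nat k"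
  proof (induction a rule: eord_induct)
    case zero
    show ?case by (rule exI[of _ 0], rule exI[of _ 0]) simp
  next
    case (add x a)
    then obtain a0 k where a: "a = omega_times a0 + of_nat k" by blast
    show ?case
    proof (cases "x = 0")
      case True
      show ?thesis by (rule exI[of _ a0], rule exI[of _ "Suc k"]) (simp add: True a ac_simps)
    next
      case False
      show ?thesis
        by (rule exI[of _ "omega_pow (opred x) + a0"], rule exI[of _ k])
          (simp add: omega_times_add omega_times_pow opred_inverse[OF False] a ac_simps)
    qed
  qed
  then show ?thesis using that by blast
qed

lemma omega_times_less_pow2:
  assumes "a < b"
  shows "omega_times a + of_nat k < omega_times b"
proof -
  \<comment> \<open>\<open>s c\<close> is the ordinary sum 1 + c. It is strictly increasing and
    never 0, so the k additional exponents 0 lie below every s j.\<close>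
  define s where "s = (\<lambda>c. if is_fin c then c + 1 else c)"
  have s: "strict_mono s"
  proof (rule strict_monoI)
    fix x y :: eord assume xy: "x < y"
    have "x + 1 < omega" if "x < omega"
    proof -
      obtain l where "x = of_nat l" using \<open>x < omega\<close> by (blast dest: less_omegaD)
      then have "x + 1 = of_nat (Suc l)" by (simp add: add.commute)
      then show ?thesis by (simp only: of_nat_less_omega)
    qed
    then have "x + 1 < y" if "x < omega" "\<not> y < omega"
      using that by (meson linorder_not_less order.strict_trans2)
    then show "s x < s y"
      using xy order.strict_trans[OF xy] by (auto simp: s_def is_fin_iff intro: add_strict_right_mono)
  qed
  have pos: "0 < s c" for c
  proof (cases "c < omega")
    case False
    then have "omega \<le> c" by simp
    then have "0 < c" by (rule order_less_le_trans[OF omega_pow_pos])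
    then show ?thesis by (simp add: s_def is_fin_iff False)
  qed (simp add: s_def is_fin_iff less_eord_add1_iff)
  from assms have "Ord (exps a) < Ord (exps b)" by simp
  from Ord_less_stepE[OF this] obtain I J K where *: "exps b = I + J" "exps a = I + K"
      "J \<noteq> {#}" "\<And>k. k \<in># K \<Longrightarrow> \<exists>j\<in>#J. k < j" by metis
  obtain j where j: "j \<in># J" using *(3) by blast
  have "Ord (image_mset s I + (image_mset s K + replicate_mset k 0))
      < Ord (image_mset s I + image_mset s J)"
  proof (rule Ord_less_stepI)
    fix x assume "x \<in># image_mset s K + replicate_mset k 0"
    then consider c where "c \<in># K" "x = s c" | "x = 0"
      by (cases "x = 0") (auto split: if_splits)
    then show "\<exists>j\<in>#image_mset s J. x < j"
    proof cases
      case 1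
      then obtain j where "j \<in># J" "c < j" using * by blast
      then show ?thesis using 1 s by (auto simp: strict_mono_def intro!: bexI[of _ j])
    next
      case 2
      then show ?thesis using pos[of j] j by (auto intro!: bexI[of _ j])
    qed
  qed (use * in auto)
  then show ?thesis by (simp add: omega_times_def s_def[symmetric] * of_nat_eord plus_eord_def ac_simps)
qed

lemma pow2_strict_mono: "a < b \<Longrightarrow> pow2 a < pow2 b"
proof -
  assume ab: "a < b"
  obtain a0 k where a: "a = omega_times a0 + of_nat k" by (rule omega_times_cases)
  obtain b0 l where b: "b = omega_times b0 + of_nat l" by (rule omega_times_cases)
  consider "a0 < b0" | "a0 = b0" "k < l"
  proof -
    have "omega_times a0 \<le> a"
      using add_left_mono[of 0 "of_nat k" "omega_times a0"] by (simp add: a)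
    then have "\<not> b0 < a0"
      using omega_times_less_pow2[of b0 a0 l] ab unfolding b
      by (auto dest: order.strict_trans order.strict_trans1)
    moreover have "k < l" if "a0 = b0"
      using ab by (simp add: a b that)
    ultimately show ?thesis using that by fastforce
  qed
  then show ?thesis
  proof cases
    case 1
    \<comment> \<open>omega^x * 2^m is 2^m copies of the exponent x, so a larger exponent wins
      against any coefficient.\<close>
    have pw: "omega_pow x * 2 ^ m = Ord (replicate_mset (2 ^ m) x)" for x m
    proof -
      have "(2 :: eord) ^ m = of_nat (2 ^ m)" by simp
      then show ?thesis by (simp only: omega_pow_times of_nat_eord exps.simps) simp
    qed
    have "Ord ({#} + replicate_mset (2 ^ k) a0) < Ord ({#} + replicate_mset (2 ^ l) b0)"
      by (rule Ord_less_stepI) (use 1 in auto)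
    then show ?thesis by (simp add: a b pow2_eq pw)
  next
    case 2
    have "(2::eord) ^ k = of_nat (2 ^ k)" "(2::eord) ^ l = of_nat (2 ^ l)" by simp_all
    then have "(2::eord) ^ k < 2 ^ l"
      using 2 by (simp only: of_nat_less_iff) simp
    then show ?thesis using 2 by (simp add: a b pow2_eq mult_strict_left_mono)
  qed
qed

lemma pow2_mono: "a \<le> b \<Longrightarrow> pow2 a \<le> pow2 b"
  using pow2_strict_mono[of a b] by (auto simp: order_le_less)

lemma pow2_pos [simp]: "0 < pow2 a"
  using pow2_mono[of 0 a] by (simp add: one_le_eord_iff)

lemma one_le_pow2 [simp]: "1 \<le> pow2 a"
  by (simp add: one_le_eord_iff)

lemma le_pow2_mult: "b \<le> pow2 a * b"
  using mult_right_mono[of 1 "pow2 a" b] by simp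

subsection \<open>The norm\<close>

lemma no_0 [simp]: "no 0 = 0"
  by (simp add: zero_eord_def)

lemma no_add [simp]: "no (a + b) = no a + no b"
  by (cases a; cases b) (simp add: plus_eord_def)

lemma no_sum: "no (sum f A) = (\<Sum>a\<in>A. no (f a))"
  by (induction A rule: infinite_finite_induct) auto

lemma no_omega_pow [simp]: "no (omega_pow a) = no a + 1"
  by (simp add: omega_pow_def)

lemma no_1 [simp]: "no 1 = 1"
  by (simp add: one_eord_def)

lemma no_of_nat [simp]: "no (of_nat k) = k"
  by (induction k) simp_all

lemma no_eq_0_iff [simp]: "no a = 0 \<longleftrightarrow> a = 0"
proof (induction a rule: eord_induct)
  case (add x a)
  then show ?case by (simp flip: exps_eq_iff)
qed simp

lemma no_numeral [simp]: "no (numeral k) = numeral k"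
  by (metis no_of_nat of_nat_numeral)

text \<open>Termwise: omega^x * omega^y has norm no x + no y + 1, which is at most (no x + 1) * (no
  y + 1).\<close>

lemma no_mult_le: "no (a * b) \<le> no a * no b"
proof -
  have *: "no (omega_pow x * b) \<le> (no x + 1) * no b" for x
    by (induction b rule: eord_induct)
      (simp_all add: distrib_left flip: omega_pow_plus)
  show ?thesis
  proof (induction a rule: eord_induct)
    case (add x a)
    then show ?case using *[of x] by (simp add: distrib_right)
  qed simp
qed

lemma no_mult_ge: "0 < b \<Longrightarrow> no a \<le> no (a * b)"
proof (induction b rule: eord_induct)
  case (add x b)
  have "no a \<le> no (a * omega_pow x)"
    by (induction a rule: eord_induct) (simp_all add: distrib_right flip: omega_pow_plus)
  then show ?case by (simp add: distrib_left)
qed simp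

lemma no_pow2: "no (pow2 (omega_times a + of_nat k)) = 2 ^ k * (no a + 1)"
proof -
  have "(2::eord) ^ k = of_nat (2 ^ k)" by simp
  then have "no (pow2 (omega_times a + of_nat k)) = no (of_nat (2 ^ k) * omega_pow a)"
    by (simp only: pow2_eq mult.commute)
  also have "\<dots> = 2 ^ k * (no a + 1)"
  proof -
    have "no (of_nat m * c) = m * no c" for m c
      by (induction m) (simp_all add: distrib_right)
    then show ?thesis by (simp only: no_omega_pow)
  qed
  finally show ?thesis .
qed

text \<open>The shift raises the norm of an exponent by at most 1, and each term has norm at least
  1.\<close>

lemma no_omega_times_bounds: "no a \<le> no (omega_times a) \<and> no (omega_times a) \<le> 2 * no a"
  by (induction a rule: eord_induct) (auto simp: omega_times_add omega_times_pow)

lemma no_pow2_le: "no (pow2 a) \<le> 2 ^ no a"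
proof -
  obtain a0 k where a: "a = omega_times a0 + of_nat k" by (rule omega_times_cases)
  have "no (pow2 a) \<le> 2 ^ k * 2 ^ no a0"
    unfolding a no_pow2 by (rule mult_left_mono) (simp_all add: Suc_leI)
  also have "\<dots> = 2 ^ (k + no a0)" by (simp add: power_add)
  also have "\<dots> \<le> 2 ^ no a"
    using no_omega_times_bounds[of a0] by (simp add: a)
  finally show ?thesis .
qed

text \<open>A power can have smaller norm than its exponent: omega * k has norm 2 * k, but 2^(omega
  * k) = omega^k has norm k + 1. The loss is at most a factor 2, which is the source of the powers
  of two in the bounds on \<open>delta\<close>.\<close>

lemma no_le_pow2_mult: "0 < b \<Longrightarrow> no a \<le> 2 * no (pow2 a * b)"
proof -
  assume "0 < b"
  obtain a0 k where a: "a = omega_times a0 + of_nat k" by (rule omega_times_cases)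
  have "k + 1 \<le> 2 ^ k" by (simp add: Suc_leI)
  then have "no a0 + k \<le> 2 ^ k * (no a0 + 1)"
    using mult_le_mono1[of 1 "2 ^ k" "no a0"] by (simp add: algebra_simps add_mono)
  then have "no a \<le> 2 * no (pow2 a)"
    using no_omega_times_bounds[of a0] unfolding a no_pow2 by simp
  also have "\<dots> \<le> 2 * no (pow2 a * b)" using no_mult_ge[OF \<open>0 < b\<close>] by simp
  finally show ?thesis .
qed

lemma no_omega_times_le: "no (omega * a) \<le> 2 * no a"
  using no_mult_le[of omega a] by simp

lemma no_omega_times_ge: "no a \<le> no (omega * a)"
  using no_mult_ge[of omega a] by (simp add: mult.commute)

section \<open>Fast growing functions and the collapsing function\<close>

lemma strict_mono_funpow: "strict_mono f \<Longrightarrow> strict_mono (f ^^ k)" for f :: "nat \<Rightarrow> nat"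
  by (induction k) (auto simp: strict_mono_def)

lemma funpow_mono_exponent:
  assumes "\<And>x. x \<le> f x" "k \<le> l"
  shows "(f ^^ k) x \<le> (f ^^ l) (x :: nat)"
  using assms(2)
proof (induction rule: dec_induct)
  case (step n)
  then show ?case using assms(1)[of "(f ^^ n) x"] by simp
qed simp

lemma F_increasing: "strict_mono (F j) \<and> (\<forall>x. x < F j x)"
proof (induction j)
  case 0
  then show ?case by (auto simp: strict_mono_def)
next
  case (Suc j)
  have le: "x \<le> F j x" for x using Suc by (simp add: less_imp_le)
  have "(F j ^^ (x + 1)) x < (F j ^^ (y + 1)) y" if "x < y" for x y
  proof -
    have "(F j ^^ (x + 1)) x < (F j ^^ (x + 1)) y"
      using strict_mono_funpow[of "F j" "x + 1"] Suc that unfolding strict_mono_def by blast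
    also have "\<dots> \<le> (F j ^^ (y + 1)) y" by (rule funpow_mono_exponent[OF le]) (use that in simp)
    finally show ?thesis .
  qed
  then have "strict_mono (F (Suc j))" by (simp add: strict_mono_def)
  moreover have "x < F (Suc j) x" for x
  proof -
    have "x < F j x" using Suc by simp
    also have "F j x \<le> F j ((F j ^^ x) x)"
      using funpow_mono_exponent[OF le, of 1 "x + 1" x] by simp
    finally show ?thesis by simp
  qed
  ultimately show ?case by blast
qed

lemma F_mono: "x \<le> y \<Longrightarrow> F j x \<le> F j y"
  using F_increasing[of j] by (simp add: strict_mono_less_eq)

lemma F_greater: "x < F j x"
  using F_increasing[of j] by simp

lemma funpow_F_mono: "k \<le> l \<Longrightarrow> x \<le> y \<Longrightarrow> (F j ^^ k) x \<le> (F j ^^ l) y"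
  by (meson F_greater F_increasing funpow_mono_exponent less_imp_le order_trans
      strict_mono_funpow strict_mono_less_eq)

lemma funpow_F_le: "k \<le> x + 1 \<Longrightarrow> (F j ^^ k) x \<le> F (Suc j) x"
  unfolding F.simps by (rule funpow_F_mono) simp_all

lemma F_le_F: "i \<le> j \<Longrightarrow> F i x \<le> F j x"
proof (induction rule: dec_induct)
  case (step n)
  then show ?case using funpow_F_le[of 1 x n] by simp
qed simp

lemma two_times_le_two_power: "2 * k \<le> 2 ^ (k :: nat)"
proof -
  have "2 * (z + 1) \<le> 2 ^ (z + 1)" for z :: nat by (induction z) auto
  from this[of "k - 1"] show ?thesis by (cases k) auto
qed

text \<open>F_1 (2 * y) performs 2 * y + 1 exponentiations, 2 * y is at most F_1 y, and F_2 y
  applies F_1 at least twice once y >= 1. Height 2 * y suits the box, which costs two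
  exponentiations per index.\<close>

lemma tower_le_F2:
  assumes "k \<le> 2 * y" "1 \<le> y"
  shows "(F 0 ^^ k) y \<le> F 2 y"
proof -
  have "(F 0 ^^ k) y \<le> (F 0 ^^ k) (2 * y)" by (rule funpow_F_mono) simp_all
  also have "\<dots> \<le> F 1 (2 * y)" using funpow_F_le[of k "2 * y" 0] assms by simp
  finally have le: "(F 0 ^^ k) y \<le> F 1 (2 * y)" .
  have "2 * y \<le> F 0 y" using two_times_le_two_power[of y] by simp
  also have "\<dots> \<le> F 1 y" by (rule F_le_F) simp
  finally have "2 * y \<le> F 1 y" .
  then have "F 1 (2 * y) \<le> F 1 (F 1 y)" by (rule F_mono)
  with le have "(F 0 ^^ k) y \<le> F 1 (F 1 y)" by (rule order_trans)
  also have "\<dots> \<le> F 2 y" using funpow_F_le[of 2 y 1] assms by (simp add: numeral_2_eq_2)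
  finally show ?thesis .
qed

text \<open>The slope 2 leaves room beyond the added norm y itself: in \<open>psi_nested\<close> the
  spare part pays for the increment of the counter.\<close>

lemma Phi_add: "Phi x + 2 * y \<le> Phi (x + y)"
proof (induction y)
  case (Suc y)
  let ?z = "x + y + 100"
  have "?z < F 5 ?z" by (rule F_greater)
  have p: "m + 2 \<le> 2 ^ m" if "2 \<le> m" for m :: nat
    using that by (induction m rule: dec_induct) auto
  have F5: "F 5 z = (F 4 ^^ (z + 1)) z" for z
    using F.simps(2)[of 4 z] by (simp del: F.simps)
  then have "F 5 ?z = (F 4 ^^ (?z + 1)) ?z" .
  also have "\<dots> \<le> (F 4 ^^ (?z + 1)) (?z + 1)" by (rule funpow_F_mono) simp_all
  finally have "F 5 ?z \<le> (F 4 ^^ (?z + 1)) (?z + 1)" .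
  \<comment> \<open>F_5 (z + 1) applies F_4 once more than F_5 z, and this one application is at
    least exponential.\<close>
  then have "F 4 (F 5 ?z) \<le> F 4 ((F 4 ^^ (?z + 1)) (?z + 1))" by (rule F_mono)
  also have "\<dots> = F 5 (?z + 1)" unfolding F5[of "?z + 1"] by (simp only: funpow.simps o_apply Suc_eq_plus1[symmetric])
  finally have "F 4 (F 5 ?z) \<le> F 5 (?z + 1)" .
  moreover have "F 5 ?z + 2 \<le> F 0 (F 5 ?z)"
    using p[of "F 5 ?z"] \<open>?z < F 5 ?z\<close> by simp
  moreover have "F 0 (F 5 ?z) \<le> F 4 (F 5 ?z)" by (rule F_le_F) simp
  ultimately have "F 5 ?z + 2 \<le> F 5 (?z + 1)" by linarith
  then show ?case using Suc by (simp add: Phi_def algebra_simps)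
qed simp

lemma Phi_mono: "x \<le> y \<Longrightarrow> Phi x \<le> Phi y"
  unfolding Phi_def by (rule F_mono) simp

text \<open>Three nested F_2 form the largest norm bound that arises, for the recursor at a
  successor. A fourth F_2 swallows the linear factors, and F_3 at an argument of at least 100
  contains four applications of F_2.\<close>

lemma F2_F2_F2_le_Phi: "16 * F 2 (F 2 (F 2 x)) + 16 * x \<le> Phi x"
proof -
  let ?z = "x + 100" and ?w = "F 2 (F 2 (F 2 (x + 100)))"
  have "?z < ?w" using F_greater[of _ 2] by (meson less_trans)
  \<comment> \<open>The shift by 100 in \<open>Phi\<close> keeps w clear of the small values where
    32 * w exceeds 2^w.\<close>
  have "32 * (m + 8) \<le> (2::nat) ^ (m + 8)" for m
  proof (induction m)
    case (Suc m)
    have "32 * (Suc m + 8) \<le> 32 * (m + 8) + 32 * (m + 8)" by simp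
    also have "\<dots> \<le> 2 ^ (m + 8) + 2 ^ (m + 8)" using Suc by (intro add_mono)
    also have "\<dots> = 2 ^ (Suc m + 8)" by (simp only: add_Suc power_Suc mult_2)
    finally show ?case .
  qed simp
  from this[of "?w - 8"] have w: "32 * ?w \<le> 2 ^ ?w" using \<open>?z < ?w\<close> by simp
  have "F 2 (F 2 (F 2 x)) \<le> ?w" by (intro F_mono) simp
  then have "16 * F 2 (F 2 (F 2 x)) + 16 * x \<le> 32 * ?w"
    using \<open>?z < ?w\<close> by linarith
  also have "\<dots> \<le> F 2 ?w" using w F_le_F[of 0 2 ?w] by simp
  also have "\<dots> \<le> F 3 ?z" using funpow_F_le[of 4 ?z 2] by (simp add: numeral_eq_Suc del: F.simps)
  also have "\<dots> \<le> Phi x" unfolding Phi_def by (rule F_le_F) simp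
  finally show ?thesis .
qed

lemma F2_le_F2_F2_F2: "F 2 x \<le> F 2 (F 2 (F 2 x))"
  using F_greater[of _ 2] by (meson less_imp_le order_trans)

lemma F2_le_Phi: "16 * F 2 x + 16 * x \<le> Phi x"
  using F2_le_F2_F2_F2[of x] F2_F2_F2_le_Phi[of x] by linarith

lemma le_Phi: "x \<le> Phi x"
  using F2_le_Phi[of x] by simp

section \<open>The collapsing function \<open>psi\<close>\<close>

lemma finite_psi_range: "finite {b. b < a \<and> no b \<le> n}"
  by (rule finite_subset[OF _ finite_no_le[of n]]) auto

lemma psi_less: "b < a \<Longrightarrow> no b \<le> Phi (no a) \<Longrightarrow> psi b < psi a"
proof -
  assume *: "b < a" "no b \<le> Phi (no a)"
  have "psi b + 1 \<le> psi a"
    unfolding psi.simps[of a]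
    by (rule Max_ge) (use * finite_psi_range in auto)
  then show ?thesis by simp
qed

lemma psi_le: "b \<le> a \<Longrightarrow> no b \<le> Phi (no a) \<Longrightarrow> psi b \<le> psi a"
  using psi_less[of b a] by (auto simp: order_le_less)

text \<open>So \<open>psi a\<close> is the length of a descending chain of permitted arguments; the
  inductions below walk down such a chain.\<close>

lemma psi_cases:
  obtains "psi a = 0" | b where "b < a" "no b \<le> Phi (no a)" "psi a = psi b + 1"
proof -
  have "psi a \<in> {0} \<union> (\<lambda>b. psi b + 1) ` {b. b < a \<and> no b \<le> Phi (no a)}"
    unfolding psi.simps[of a] by (rule Max_in) (use finite_psi_range in auto)
  then show ?thesis using that by auto
qed

text \<open>Adding b to all members of a chain that witnesses \<open>psi a\<close> keeps it
  descending, and \<open>Phi_add\<close> keeps each step permitted; the bottom of the new chain is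
  at least b.\<close>

lemma psi_add: "psi a + psi b \<le> psi (a + b)"
proof (induction a rule: less_induct)
  case (less a)
  show ?case
  proof (cases a rule: psi_cases)
    case 1
    have "psi b \<le> psi (a + b)"
      by (rule psi_le) (use add_right_mono[of 0 a b] le_Phi[of "no a + no b"] in auto)
    then show ?thesis using 1 by simp
  next
    case (2 c)
    have "psi (c + b) < psi (a + b)"
      by (rule psi_less) (use 2 Phi_add[of "no a" "no b"] in \<open>auto intro: add_strict_right_mono\<close>)
    then show ?thesis using less[of c] 2 by simp
  qed
qed

lemma le_psi_of_nat: "k \<le> psi (of_nat k)"
proof (induction k)
  case (Suc k)
  have "psi (of_nat k) < psi (of_nat (Suc k))"
    by (rule psi_less) (use le_Phi[of "Suc k"] in auto)
  then show ?case using Suc by simp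
qed simp

lemma psi_add_of_nat: "psi a + k \<le> psi (a + of_nat k)"
  using psi_add[of a "of_nat k"] le_psi_of_nat[of k] by simp

lemma psi_add_of_nat_mono: "k \<le> l \<Longrightarrow> psi (a + of_nat k) \<le> psi (a + of_nat l)"
  using psi_add_of_nat[of "a + of_nat k" "l - k"] by (simp add: add.assoc flip: of_nat_add)

text \<open>A natural number is its own norm, so Phi of the norm is itself a permitted argument
  below omega * a. This is why component 0 of a box, being a collapsed value, dominates the norms of
  the other components.\<close>

lemma Phi_less_psi:
  assumes "0 < a"
  shows "Phi (no (omega * a + of_nat k)) < psi (omega * a + of_nat k)"
proof -
  let ?p = "Phi (no (omega * a + of_nat k))"
  have "psi (of_nat ?p) < psi (omega * a + of_nat k)"
    by (rule psi_less) (use omega_times_less[OF assms, of ?p k] in simp_all)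
  then show ?thesis using le_psi_of_nat[of ?p] by simp
qed

text \<open>
  One more \<open>omega\<close> absorbs a nested collapse: along a maximal chain that witnesses \<open>psi b\<close>, each
  step down from \<open>b\<close> pays for an increment of the counter \<open>s\<close>.
\<close>

lemma psi_nested: "psi (a + of_nat (s + psi b)) < psi (a + omega + b + of_nat s)"
proof (induction b arbitrary: s rule: less_induct)
  case (less b)
  show ?case
  proof (cases b rule: psi_cases)
    case 1
    have "psi (a + of_nat s) < psi (a + omega + b + of_nat s)"
    proof (rule psi_less)
      have "a + of_nat s < a + (omega + (b + of_nat s))"
        by (intro add_strict_left_mono order_less_le_trans[OF of_nat_less_omega])
          (use add_left_mono[of 0 "b + of_nat s" omega] in simp)
      then show "a + of_nat s < a + omega + b + of_nat s" by (simp add: ac_simps)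
    qed (use le_Phi[of "no a + 2 + no b + s"] in simp)
    then show ?thesis using 1 by simp
  next
    case (2 c)
    have "psi (a + of_nat (s + 1 + psi c)) < psi (a + omega + c + of_nat (s + 1))"
      using less[OF 2(1), of "s + 1"] .
    also have "\<dots> \<le> psi (a + omega + b + of_nat s)"
    proof (rule psi_le)
      have "a + omega + (c + 1) + of_nat s \<le> a + omega + b + of_nat s"
        using 2(1) by (intro add_mono) (auto simp: eord_less_iff_add1_le)
      then show "a + omega + c + of_nat (s + 1) \<le> a + omega + b + of_nat s" by (simp add: ac_simps)
    qed (use 2(2) Phi_add[of "no b" "no a + 2 + s"] in \<open>simp add: ac_simps\<close>)
    finally show ?thesis using 2 by simp
  qed
qed

declare F.simps [simp del]

text \<open>Norms are measured against the finite summand l, which in the applications contains the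
  components 0 involved. A natural product with omega at most doubles a norm, so 2 * 4 for the F_2
  part and 2 * 4 + 8 for the linear part stay within the 16 of
  \<open>F2_F2_F2_le_Phi\<close>.\<close>

lemma psi_omega_less:
  assumes "a < b \<or> a = b \<and> k < l" "no a \<le> 4 * F 2 (F 2 (F 2 l)) + 4 * l" "k \<le> 8 * l"
  shows "psi (omega * a + of_nat k) < psi (omega * b + of_nat l)"
proof (rule psi_less)
  show "omega * a + of_nat k < omega * b + of_nat l"
    using assms(1) by (auto intro: omega_times_less add_strict_left_mono)
  have "no (omega * a + of_nat k) \<le> 16 * F 2 (F 2 (F 2 l)) + 16 * l"
    using no_omega_times_le[of a] assms by simp
  also have "\<dots> \<le> Phi l" by (rule F2_F2_F2_le_Phi)
  also have "\<dots> \<le> Phi (no (omega * b + of_nat l))" by (rule Phi_mono) simp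
  finally show "no (omega * a + of_nat k) \<le> Phi (no (omega * b + of_nat l))" .
qed

lemma psi_omega_le:
  assumes "a \<le> b" "k \<le> l" "no a \<le> 4 * F 2 l + 4 * l"
  shows "psi (omega * a + of_nat k) \<le> psi (omega * b + of_nat l)"
proof (cases "a < b \<or> k < l")
  case True
  have "psi (omega * a + of_nat k) < psi (omega * b + of_nat l)"
    by (rule psi_omega_less) (use True assms F2_le_F2_F2_F2[of l] in auto)
  then show ?thesis by simp
qed (use assms in auto)

lemma less_psi_omega: "k < l \<Longrightarrow> k < psi (omega * a + of_nat l)"
  using psi_add_of_nat[of "omega * a" l] by simp

section \<open>Valuations\<close>

abbreviation val :: "(tvar \<Rightarrow> nat \<Rightarrow> oterm) \<Rightarrow> oterm \<Rightarrow> eord" where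
  "val \<chi> h \<equiv> oval (osubst \<chi> h)"

abbreviation adm :: "(tvar \<Rightarrow> nat \<Rightarrow> oterm) \<Rightarrow> bool" where
  "adm \<equiv> admissible UNIV"

lemma clsB_pos: "clsB i f \<Longrightarrow> 0 < oval f"
proof (induction rule: clsB.induct)
  case (5 f g k)
  then have "Phi (no (omega * oval f + of_nat k)) < psi (omega * oval f + of_nat k)"
    by (intro Phi_less_psi)
  then show ?case using 5 by simp
qed (auto intro: add_pos_pos mult_pos_pos)

lemma clsB_not_OZero: "\<not> clsB i OZero"
  using clsB_pos by fastforce

text \<open>Class 0 has neither omega nor powers. As \<open>no\<close> inverts
  \<open>of_nat\<close>, component 0 of a vector can be handled as the number given by its
  norm.\<close>

lemma clsB_nat: "clsB 0 f \<Longrightarrow> oval f = of_nat (no (oval f))"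
proof -
  have "clsB i f \<Longrightarrow> i = 0 \<Longrightarrow> \<exists>k. oval f = of_nat k" for i f
  proof (induction rule: clsB.induct)
    case (1 i)
    show ?case by (rule exI[of _ 1]) simp
  next
    case (3 i f g)
    then show ?case by (auto simp flip: of_nat_add)
  qed auto
  then show "clsB 0 f \<Longrightarrow> ?thesis" by fastforce
qed

lemma level_map [simp]: "level (map f v) = level v"
  by (simp add: level_def)

lemma vnth_map_upt: "vnth (map f [0..<n]) i = (if i < n then f i else OZero)"
  by (simp add: vnth_def)

lemma level_map_upt [simp]: "level (map f [0..<Suc n]) = n"
  by (simp add: level_def)

lemma admissible_iff:
  "admissible V \<chi> \<longleftrightarrow> (\<forall>X\<in>V. \<forall>i\<le>lv (vty X).
     clsB i (\<chi> X i) \<and> no (oval (\<chi> X i)) \<le> no (oval (\<chi> X 0)))"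
  by (auto simp: admissible_def bounded_norm_def vnth_map_upt simp del: upt_Suc)

lemma osubst_cong: "(\<And>X. X \<in> ovecs h \<Longrightarrow> \<chi> X = \<theta> X) \<Longrightarrow> osubst \<chi> h = osubst \<theta> h"
  by (induction h) auto

lemma osubst_osubst: "osubst \<chi> (osubst \<theta> h) = osubst (\<lambda>X i. osubst \<chi> (\<theta> X i)) h"
  by (induction h) auto

text \<open>The value 1 is admissible at every variable. Hence the majorization orders can be tested
  on one class of substitutions, which does not depend on the terms compared.\<close>

lemma admissible_extend:
  assumes "admissible V \<chi>"
  obtains \<theta> where "adm \<theta>" "\<And>h. ovecs h \<subseteq> V \<Longrightarrow> osubst \<theta> h = osubst \<chi> h"
proof
  let ?\<theta> = "\<lambda>X. if X \<in> V then \<chi> X else (\<lambda>_. OOne)"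
  show "adm ?\<theta>"
    using assms by (auto simp: admissible_iff clsB.intros)
  show "osubst ?\<theta> h = osubst \<chi> h" if "ovecs h \<subseteq> V" for h
    by (rule osubst_cong) (use that in auto)
qed

lemma admissible_mono: "adm \<chi> \<Longrightarrow> admissible V \<chi>"
  by (simp add: admissible_iff)

lemma oless_iff: "f \<prec> g \<longleftrightarrow> (\<forall>\<chi>. adm \<chi> \<longrightarrow> val \<chi> f < val \<chi> g)"
  unfolding oless_def by (metis admissible_extend admissible_mono sup_ge1 sup_ge2)

lemma oleq_iff: "f \<preceq> g \<longleftrightarrow> (\<forall>\<chi>. adm \<chi> \<longrightarrow> val \<chi> f \<le> val \<chi> g)"
  unfolding oleq_def by (metis admissible_extend admissible_mono sup_ge1 sup_ge2)

lemma no_leq_F2D: "no_leq_F2 f g \<Longrightarrow> adm \<chi> \<Longrightarrow> no (val \<chi> f) \<le> F 2 (no (val \<chi> g))"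
  unfolding no_leq_F2_def using admissible_mono by fastforce

lemma vless_iff:
  "v \<prec>\<^sub>v w \<longleftrightarrow> (\<forall>\<chi>. adm \<chi> \<longrightarrow> val \<chi> (vnth v 0) < val \<chi> (vnth w 0) \<and>
     (\<forall>i>0. val \<chi> (vnth v i) \<le> val \<chi> (vnth w i)))"
  unfolding vless_def oless_iff oleq_iff by blast

text \<open>Evaluating h{x := a} under \<chi> amounts to evaluating h under this update
  (\<open>osubst_osub\<close>), so that substitution is treated semantically.\<close>

definition upd :: "(tvar \<Rightarrow> nat \<Rightarrow> oterm) \<Rightarrow> tvar \<Rightarrow> vec \<Rightarrow> tvar \<Rightarrow> nat \<Rightarrow> oterm" where
  "upd \<chi> X a = \<chi>(X := \<lambda>i. osubst \<chi> (vnth a i))"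

lemma osubst_osub: "osubst \<chi> (osub X a h) = osubst (upd \<chi> X a) h"
  unfolding osub_def osubst_osubst upd_def
  by (rule arg_cong[of _ _ "\<lambda>\<theta>. osubst \<theta> h"]) (auto simp: fun_eq_iff)

lemma osubst_upd_xfree: "xfree X h \<Longrightarrow> osubst (upd \<chi> X a) h = osubst \<chi> h"
  by (rule osubst_cong) (auto simp: upd_def xfree_def)

section \<open>Vectors of bounded norm\<close>

text \<open>The invariant of all assigned vectors. As it is required at every admissible
  substitution, a good vector of the right level may replace the vector of a variable without
  leaving the admissible substitutions (\<open>adm_upd\<close>).\<close>

definition goodv :: "vec \<Rightarrow> bool" where
  "goodv v \<longleftrightarrow> v \<noteq> [] \<and> (\<forall>\<chi> i. adm \<chi> \<longrightarrow> i \<le> level v \<longrightarrow>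
     clsB i (osubst \<chi> (vnth v i)) \<and> no (val \<chi> (vnth v i)) \<le> no (val \<chi> (vnth v 0)))"

lemma goodv_not_Nil: "goodv v \<Longrightarrow> v \<noteq> []"
  by (simp add: goodv_def)

lemma goodv_clsB: "goodv v \<Longrightarrow> adm \<chi> \<Longrightarrow> i \<le> level v \<Longrightarrow> clsB i (osubst \<chi> (vnth v i))"
  by (simp add: goodv_def)

lemma vnth_beyond: "v \<noteq> [] \<Longrightarrow> level v < i \<Longrightarrow> vnth v i = OZero"
  by (cases v) (simp_all add: level_def vnth_def)

lemma goodv_no_le: "goodv v \<Longrightarrow> adm \<chi> \<Longrightarrow> no (val \<chi> (vnth v i)) \<le> no (val \<chi> (vnth v 0))"
  by (cases "i \<le> level v") (auto simp: goodv_def vnth_beyond)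

lemma goodv_nat:
  "goodv v \<Longrightarrow> adm \<chi> \<Longrightarrow> val \<chi> (vnth v 0) = of_nat (no (val \<chi> (vnth v 0)))"
  using goodv_clsB[of v \<chi> 0] clsB_nat by simp

lemma goodv_pos: "goodv v \<Longrightarrow> adm \<chi> \<Longrightarrow> i \<le> level v \<Longrightarrow> 0 < val \<chi> (vnth v i)"
  using goodv_clsB clsB_pos by blast

lemma goodv_no_pos: "goodv v \<Longrightarrow> adm \<chi> \<Longrightarrow> 0 < no (val \<chi> (vnth v 0))"
  using goodv_pos[of v \<chi> 0] by (metis gr_zeroI no_eq_0_iff less_irrefl le0)

lemma adm_upd: "adm \<chi> \<Longrightarrow> goodv a \<Longrightarrow> level a = lv (vty X) \<Longrightarrow> adm (upd \<chi> X a)"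
  unfolding admissible_iff by (auto simp: upd_def goodv_def admissible_iff)

lemma level_ones [simp]: "level (ones n) = n"
  by (simp add: ones_def level_def)

lemma vnth_ones: "vnth (ones n) i = (if i \<le> n then OOne else OZero)"
  by (auto simp: ones_def vnth_def simp del: replicate.simps)

lemma goodv_ones: "goodv (ones n)"
  by (auto simp: goodv_def vnth_ones clsB.intros) (simp add: ones_def)

lemma vnth_map_osub [simp]: "vnth (map (osub X a) w) i = osub X a (vnth w i)"
  by (simp add: vnth_def osub_def)

lemma goodv_osub:
  assumes "goodv w" "goodv a" "level a = lv (vty X)"
  shows "goodv (map (osub X a) w)"
  using assms adm_upd[OF _ assms(2,3)]
  unfolding goodv_def by (simp add: osubst_osub)

text \<open>Vector operations leave out literal zeros, so membership in the classes is tracked modulo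
  \<open>OZero\<close> and recovered from positivity of the value.\<close>

definition clsB0 :: "nat \<Rightarrow> (tvar \<Rightarrow> nat \<Rightarrow> oterm) \<Rightarrow> oterm \<Rightarrow> bool" where
  "clsB0 i \<chi> f \<longleftrightarrow> f = OZero \<or> clsB i (osubst \<chi> f)"

lemma clsB0_imp_clsB: "clsB0 i \<chi> f \<Longrightarrow> 0 < val \<chi> f \<Longrightarrow> clsB i (osubst \<chi> f)"
  by (auto simp: clsB0_def)

lemma val_oplus [simp]: "val \<chi> (oplus f g) = val \<chi> f + val \<chi> g"
  by (auto simp: oplus_def)

lemma val_omult [simp]: "val \<chi> (omult k f) = of_nat k * val \<chi> f"
  by (induction k) (simp_all add: distrib_right add.commute)

lemma val_osum [simp]: "val \<chi> (osum fs) = (\<Sum>f\<leftarrow>fs. val \<chi> f)"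
proof -
  have "val \<chi> (foldl oplus a fs) = val \<chi> a + (\<Sum>f\<leftarrow>fs. val \<chi> f)" for a
    by (induction fs arbitrary: a) (simp_all add: add.assoc)
  then show ?thesis by (simp add: osum_def)
qed

lemma clsB0_OZero [simp]: "clsB0 i \<chi> OZero"
  by (simp add: clsB0_def)

lemma clsB0_OOne [simp]: "clsB0 i \<chi> OOne"
  by (simp add: clsB0_def clsB.intros)

lemma clsB0_oplus: "clsB0 i \<chi> f \<Longrightarrow> clsB0 i \<chi> g \<Longrightarrow> clsB0 i \<chi> (oplus f g)"
  by (auto simp: clsB0_def oplus_def intro: clsB.intros)

lemma clsB0_omult: "clsB0 i \<chi> f \<Longrightarrow> clsB0 i \<chi> (omult k f)"
  by (induction k) (auto intro: clsB0_oplus)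

lemma clsB0_osum: "(\<And>f. f \<in> set fs \<Longrightarrow> clsB0 i \<chi> f) \<Longrightarrow> clsB0 i \<chi> (osum fs)"
proof -
  have "clsB0 i \<chi> a \<Longrightarrow> (\<And>f. f \<in> set fs \<Longrightarrow> clsB0 i \<chi> f) \<Longrightarrow> clsB0 i \<chi> (foldl oplus a fs)" for a
    by (induction fs arbitrary: a) (auto intro: clsB0_oplus)
  then show "(\<And>f. f \<in> set fs \<Longrightarrow> clsB0 i \<chi> f) \<Longrightarrow> ?thesis" by (simp add: osum_def)
qed

lemma goodv_clsB0: "goodv v \<Longrightarrow> adm \<chi> \<Longrightarrow> clsB0 i \<chi> (vnth v i)"
  by (cases "i \<le> level v") (auto simp: clsB0_def goodv_def vnth_beyond)

lemma vnth_vplus [simp]: "vnth (vplus f g) i = oplus (vnth f i) (vnth g i)"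
  by (auto simp: vplus_def vnth_def oplus_def)

lemma length_vplus [simp]: "length (vplus f g) = max (length f) (length g)"
  by (simp add: vplus_def)

lemma level_vplus [simp]: "level (vplus f g) = max (level f) (level g)"
  by (auto simp: level_def)

lemma goodv_vplus:
  assumes "goodv f" "goodv g"
  shows "goodv (vplus f g)"
  unfolding goodv_def
proof (intro conjI allI impI)
  show "vplus f g \<noteq> []"
    using assms by (auto simp: goodv_def vplus_def max_def simp del: upt_Suc)
next
  fix \<chi> i assume *: "adm \<chi>" "i \<le> level (vplus f g)"
  then have "0 < val \<chi> (vnth f i) \<or> 0 < val \<chi> (vnth g i)"
    using goodv_pos assms by (auto simp: max_def split: if_splits)
  then have "0 < val \<chi> (vnth (vplus f g) i)"
    by (auto intro: add_pos_nonneg add_nonneg_pos)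
  then show "clsB i (osubst \<chi> (vnth (vplus f g) i))"
    by (intro clsB0_imp_clsB) (simp_all add: clsB0_oplus goodv_clsB0 assms *)
  show "no (val \<chi> (vnth (vplus f g) i)) \<le> no (val \<chi> (vnth (vplus f g) 0))"
    using assms * by (auto intro: add_mono goodv_no_le)
qed

section \<open>The operator $\Box$\<close>

text \<open>The ordinals denoted by a box at indices i >= 1 (\<open>val_boxc\<close>), with n the
  level of the second vector; component 0 is a collapsed value and is treated apart in
  \<open>val_boxc_0\<close>.\<close>

function bx :: "(nat \<Rightarrow> eord) \<Rightarrow> (nat \<Rightarrow> eord) \<Rightarrow> nat \<Rightarrow> nat \<Rightarrow> eord" where
  "bx f g n i = (if i \<le> n then pow2 (bx f g n (i + 1)) * (f i + g i) else f i)"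
  by pat_completeness auto
termination
  by (relation "measure (\<lambda>(f, g, n, i). n + 1 - i)") auto

declare bx.simps [simp del]

lemma bx_beyond: "n < i \<Longrightarrow> bx f g n i = f i"
  by (simp add: bx.simps)

lemma bx_step: "i \<le> n \<Longrightarrow> bx f g n i = pow2 (bx f g n (i + 1)) * (f i + g i)"
  by (simp add: bx.simps)

lemma bx_mono:
  assumes "\<And>j. i \<le> j \<Longrightarrow> f j \<le> f' j" "\<And>j. i \<le> j \<Longrightarrow> g j \<le> g' j"
  shows "bx f g n i \<le> bx f' g' n i"
  using assms
proof (induction "n + 1 - i" arbitrary: i)
  case 0
  then show ?case by (simp add: bx_beyond)
next
  case (Suc k)
  then have "bx f g n (i + 1) \<le> bx f' g' n (i + 1)" by simp
  then show ?case
    using Suc by (simp add: bx_step) (intro mult_mono pow2_mono add_mono; simp)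
qed

lemma bx_ge: "i \<le> n \<Longrightarrow> f i + g i \<le> bx f g n i"
  by (simp add: bx_step le_pow2_mult)

lemma bx_ge_left: "f i \<le> bx f g n i"
proof (cases "i \<le> n")
  case True
  have "f i \<le> f i + g i" using add_left_mono[of 0 "g i" "f i"] by simp
  also have "\<dots> \<le> bx f g n i" using True by (rule bx_ge)
  finally show ?thesis .
qed (simp add: bx_beyond)

lemma bx_pos: "0 < f i \<Longrightarrow> 0 < bx f g n i"
  using bx_ge_left[of f i g n] by (rule order_less_le_trans[rotated])

text \<open>Induction from the top index down. Positivity gives 2^a + 2^b <= 2^(a + b), which fails
  if an exponent is 0. The shared g counts twice on the left, but each occurrence carries only one
  of the two powers that are added.\<close>

lemma bx_superadditive:
  assumes "\<And>j. i \<le> j \<Longrightarrow> j \<le> n + 1 \<Longrightarrow> 0 < f j \<and> 0 < f' j"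
  shows "bx f g n i + bx f' g n i \<le> bx (\<lambda>j. f j + f' j) g n i"
  using assms
proof (induction "n + 1 - i" arbitrary: i)
  case 0
  then show ?case by (simp add: bx_beyond)
next
  case (Suc k)
  then have i: "i \<le> n" by simp
  let ?a = "bx f g n (i + 1)" and ?b = "bx f' g n (i + 1)"
    and ?c = "bx (\<lambda>j. f j + f' j) g n (i + 1)"
  have "?a + ?b \<le> ?c" using Suc by simp
  have "0 < ?a" "0 < ?b" using Suc(3)[of "i + 1"] i by (auto intro: bx_pos)
  then have "2 \<le> pow2 ?a" "2 \<le> pow2 ?b"
    using pow2_mono[of 1] by (simp_all add: one_le_eord_iff)
  then have "pow2 ?a + pow2 ?b \<le> pow2 ?a * pow2 ?b" by (rule two_times_le_mult)
  also have "\<dots> \<le> pow2 ?c" unfolding pow2_add[symmetric] by (rule pow2_mono) fact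
  finally have c: "pow2 ?a + pow2 ?b \<le> pow2 ?c" .
  have "bx f g n i + bx f' g n i = pow2 ?a * (f i + g i) + pow2 ?b * (f' i + g i)"
    by (simp add: bx_step i)
  also have "\<dots> \<le> pow2 ?a * (f i + f' i + g i) + pow2 ?b * (f i + f' i + g i)"
    using add_left_mono[of 0 "f' i" "f i + g i"] add_left_mono[of 0 "f i" "f' i + g i"]
    by (intro add_mono mult_left_mono) (simp_all add: ac_simps)
  also have "\<dots> = (pow2 ?a + pow2 ?b) * (f i + f' i + g i)" by (simp add: distrib_right)
  also have "\<dots> \<le> pow2 ?c * (f i + f' i + g i)" by (rule mult_right_mono[OF c]) simp
  finally show ?case by (simp add: bx_step i)
qed

lemma bx_superadditive_le:
  assumes "\<And>j. i \<le> j \<Longrightarrow> j \<le> n + 1 \<Longrightarrow> 0 < f j \<and> 0 < f' j" "\<And>j. i \<le> j \<Longrightarrow> f j + f' j \<le> h j"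
  shows "bx f g n i + bx f' g n i \<le> bx h g n i"
  using bx_superadditive[of i n f f' g] bx_mono[of i "\<lambda>j. f j + f' j" h g g n] assms
  by (meson order_refl order_trans)

text \<open>One index of a box costs two exponentiations: 2^x * y <= 2^(2 * t) <= 2^(2^t).\<close>

lemma mult_pow2_le_tower: "1 \<le> m \<Longrightarrow> x \<le> (F 0 ^^ k) m \<Longrightarrow> y \<le> (F 0 ^^ k) m \<Longrightarrow>
  2 ^ x * y \<le> (F 0 ^^ (k + 2)) m"
proof -
  let ?t = "(F 0 ^^ k) m"
  assume *: "1 \<le> m" "x \<le> ?t" "y \<le> ?t"
  have "2 ^ x * y \<le> 2 ^ ?t * 2 ^ ?t"
    using *(3) by (intro mult_mono power_increasing *(2)) (auto intro: order_trans[OF _ less_imp_le[OF less_exp]])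
  also have "\<dots> = 2 ^ (2 * ?t)" by (simp add: mult_2 power_add)
  also have "\<dots> \<le> 2 ^ 2 ^ ?t" using two_times_le_two_power[of ?t] by (intro power_increasing) simp_all
  finally show ?thesis by (simp add: F.simps)
qed

lemma no_bx_le_tower:
  assumes "\<And>j. i \<le> j \<Longrightarrow> no (f j) + no (g j) \<le> m" "1 \<le> m"
  shows "no (bx f g n i) \<le> (F 0 ^^ (2 * (n + 1 - i))) m"
  using assms(1)
proof (induction "n + 1 - i" arbitrary: i)
  case 0
  then have "no (f i) \<le> m" using 0(2)[of i] by linarith
  then show ?case using 0 by (simp add: bx_beyond)
next
  case (Suc k)
  then have i: "i \<le> n" by simp
  have k: "2 * (n + 1 - (i + 1)) + 2 = 2 * (n + 1 - i)" using i by simp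
  have IH: "no (bx f g n (i + 1)) \<le> (F 0 ^^ (2 * (n + 1 - (i + 1)))) m"
    using Suc by (intro Suc(1)) simp_all
  have "m \<le> (F 0 ^^ (2 * (n + 1 - (i + 1)))) m"
    using funpow_F_mono[of 0 "2 * (n + 1 - (i + 1))" m m 0] by simp
  then have m: "no (f i + g i) \<le> (F 0 ^^ (2 * (n + 1 - (i + 1)))) m"
    using Suc(3)[of i] by simp
  have "no (bx f g n i) \<le> no (pow2 (bx f g n (i + 1))) * no (f i + g i)"
    unfolding bx_step[OF i] by (rule no_mult_le)
  also have "\<dots> \<le> 2 ^ no (bx f g n (i + 1)) * no (f i + g i)"
    by (rule mult_right_mono[OF no_pow2_le]) simp
  also have "\<dots> \<le> (F 0 ^^ (2 * (n + 1 - i))) m"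
    using mult_pow2_le_tower[OF assms(2) IH m] unfolding k .
  finally show ?case .
qed

text \<open>Here the summand n in component 0 of a box pays off: the tower has height at most 2 * n,
  and \<open>tower_le_F2\<close> absorbs it because the argument is at least n.\<close>

lemma no_bx_le_F2:
  assumes "\<And>j. 1 \<le> j \<Longrightarrow> no (f j) + no (g j) \<le> m" "1 \<le> m" "1 \<le> i"
  shows "no (bx f g n i) \<le> F 2 (m + n)"
proof -
  have "no (bx f g n i) \<le> (F 0 ^^ (2 * (n + 1 - i))) m"
    using assms by (intro no_bx_le_tower) simp_all
  also have "\<dots> \<le> (F 0 ^^ (2 * (n + 1 - i))) (m + n)" by (rule funpow_F_mono) simp_all
  also have "\<dots> \<le> F 2 (m + n)" using assms by (intro tower_le_F2) simp_all
  finally show ?thesis .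
qed

abbreviation vals :: "(tvar \<Rightarrow> nat \<Rightarrow> oterm) \<Rightarrow> vec \<Rightarrow> nat \<Rightarrow> eord" where
  "vals \<chi> v \<equiv> \<lambda>i. val \<chi> (vnth v i)"

lemma boxc_beyond: "level g < i \<Longrightarrow> boxc f g i = vnth f i"
  by (subst boxc.simps) simp

lemma boxc_step: "1 \<le> i \<Longrightarrow> i \<le> level g \<Longrightarrow>
    boxc f g i = OExp (boxc f g (i + 1)) (oplus (vnth f i) (vnth g i))"
  by (subst boxc.simps) simp

lemma boxc_0: "boxc f g 0 =
    OPsi (boxc f g 1) (oplus (oplus (vnth f 0) (vnth g 0)) (omult (level g) OOne))"
  by (subst boxc.simps) simp

lemma val_boxc: "1 \<le> i \<Longrightarrow> val \<chi> (boxc f g i) = bx (vals \<chi> f) (vals \<chi> g) (level g) i"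
proof (induction "level g + 1 - i" arbitrary: i)
  case 0
  then show ?case by (simp add: bx_beyond boxc_beyond)
next
  case (Suc k)
  then have "val \<chi> (boxc f g (i + 1)) = bx (vals \<chi> f) (vals \<chi> g) (level g) (i + 1)"
    by (intro Suc(1)) simp_all
  with Suc show ?case by (simp add: bx_step boxc_step)
qed

lemma val_boxc_0:
  assumes "goodv f" "goodv g" "adm \<chi>"
  shows "val \<chi> (boxc f g 0) = of_nat (psi (omega * bx (vals \<chi> f) (vals \<chi> g) (level g) 1
    + of_nat (no (vals \<chi> f 0) + no (vals \<chi> g 0) + level g)))"
proof -
  have "vals \<chi> f 0 + vals \<chi> g 0 + of_nat (level g)
      = of_nat (no (vals \<chi> f 0) + no (vals \<chi> g 0) + level g)"
    using goodv_nat[OF assms(1,3)] goodv_nat[OF assms(2,3)]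
    by (simp only: of_nat_add)
  then show ?thesis
    by (simp add: boxc_0 val_boxc del: of_nat_add)
qed

lemma no_boxc_le:
  assumes "goodv f" "goodv g" "adm \<chi>" "1 \<le> i"
  shows "no (bx (vals \<chi> f) (vals \<chi> g) (level g) i)
    \<le> F 2 (no (vals \<chi> f 0) + no (vals \<chi> g 0) + level g)"
  by (rule no_bx_le_F2) (use assms goodv_no_pos[of f \<chi>] in \<open>auto intro: add_mono goodv_no_le\<close>)

lemma vnth_box: "vnth (f \<box> g) i = (if i \<le> level f then boxc f g i else OZero)"
  by (auto simp: box_def vnth_map_upt simp del: upt_Suc)

lemma level_box [simp]: "level (f \<box> g) = level f"
  by (simp add: box_def level_def)

lemma clsB_boxc:
  assumes "goodv f" "goodv g" "adm \<chi>" "level g < level f" "1 \<le> i" "i \<le> level f"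
  shows "clsB i (osubst \<chi> (boxc f g i))"
  using assms(5,6)
proof (induction "level g + 1 - i" arbitrary: i)
  case 0
  then show ?case using assms(1,3) by (simp add: boxc_beyond goodv_clsB)
next
  case (Suc k)
  then have "clsB (i + 1) (osubst \<chi> (boxc f g (i + 1)))"
    using assms(4) by (intro Suc(1)) simp_all
  moreover have "clsB i (osubst \<chi> (oplus (vnth f i) (vnth g i)))"
    by (rule clsB0_imp_clsB)
      (use Suc assms in \<open>auto intro: clsB0_oplus goodv_clsB0 add_pos_nonneg goodv_pos\<close>)
  ultimately show ?case
    using Suc by (simp add: boxc_step clsB.intros)
qed

lemma clsB_boxc_0:
  assumes "goodv f" "goodv g" "adm \<chi>" "level g < level f"
  shows "clsB 0 (osubst \<chi> (boxc f g 0))"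
proof -
  let ?k = "no (vals \<chi> f 0) + no (vals \<chi> g 0) + level g"
  let ?h = "oplus (oplus (vnth f 0) (vnth g 0)) (omult (level g) OOne)"
  have v: "val \<chi> ?h = of_nat ?k"
    using goodv_nat[OF assms(1,3)] goodv_nat[OF assms(2,3)] by simp
  have "clsB 0 (osubst \<chi> ?h)"
  proof (rule clsB0_imp_clsB)
    show "clsB0 0 \<chi> ?h" by (intro clsB0_oplus goodv_clsB0 assms clsB0_omult) simp
    show "0 < val \<chi> ?h" unfolding v using goodv_no_pos[OF assms(1,3)] by (simp only: of_nat_0_less_iff)
  qed
  moreover have "clsB 1 (osubst \<chi> (boxc f g 1))" using assms by (intro clsB_boxc) simp_all
  moreover have "no (val \<chi> (boxc f g 1)) \<le> F 2 ?k"
    using no_boxc_le[OF assms(1-3), of 1] by (simp add: val_boxc)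
  ultimately show ?thesis
    using v unfolding boxc_0 osubst.simps by (intro clsB.intros(5)) simp_all
qed

lemma bx_pos_goodv:
  assumes "goodv f" "adm \<chi>" "1 \<le> level f"
  shows "0 < bx (vals \<chi> f) g n 1"
  using goodv_pos[OF assms] by (rule bx_pos)

lemma no_val_boxc_0_gt:
  assumes "goodv f" "goodv g" "adm \<chi>" "level g < level f"
  shows "Phi (no (vals \<chi> f 0) + no (vals \<chi> g 0) + level g) < no (val \<chi> (boxc f g 0))"
proof -
  let ?k = "no (vals \<chi> f 0) + no (vals \<chi> g 0) + level g"
    and ?b = "bx (vals \<chi> f) (vals \<chi> g) (level g) 1"
  have "0 < ?b" by (rule bx_pos_goodv) (use assms in auto)
  have "Phi ?k \<le> Phi (no (omega * ?b + of_nat ?k))" by (rule Phi_mono) simp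
  also have "\<dots> < psi (omega * ?b + of_nat ?k)" by (rule Phi_less_psi) fact
  finally show ?thesis by (simp only: val_boxc_0[OF assms(1-3)] no_of_nat)
qed

text \<open>Norms at positive indices are at most F_2 of the finite summand, whereas component 0
  exceeds Phi of it.\<close>

lemma goodv_box:
  assumes "goodv f" "goodv g" "level g < level f"
  shows "goodv (f \<box> g)"
  unfolding goodv_def
proof (intro conjI allI impI)
  show "f \<box> g \<noteq> []" by (simp add: box_def)
next
  fix \<chi> i assume \<chi>: "adm \<chi>" and i: "i \<le> level (f \<box> g)"
  then show "clsB i (osubst \<chi> (vnth (f \<box> g) i))"
    using clsB_boxc[OF assms(1,2) \<chi> assms(3), of i] clsB_boxc_0[OF assms(1,2) \<chi> assms(3)]
    by (cases "i = 0") (auto simp: vnth_box)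
  have "no (val \<chi> (boxc f g i)) \<le> no (val \<chi> (boxc f g 0))" if "1 \<le> i"
    using no_boxc_le[OF assms(1,2) \<chi> that] no_val_boxc_0_gt[OF assms(1,2) \<chi> assms(3)]
      F2_le_Phi[of "no (vals \<chi> f 0) + no (vals \<chi> g 0) + level g"]
    by (simp add: val_boxc[OF that])
  then show "no (val \<chi> (vnth (f \<box> g) i)) \<le> no (val \<chi> (vnth (f \<box> g) 0))"
    using i by (cases "i = 0") (auto simp: vnth_box)
qed

lemma vnth_restr: "vnth (f \<restriction> n) i = (if i \<le> n then vnth f i else OZero)"
  by (auto simp: restr_def vnth_def)

lemma level_restr [simp]: "n \<le> level f \<Longrightarrow> level (f \<restriction> n) = n"
  by (auto simp: restr_def level_def)

lemma goodv_restr: "goodv f \<Longrightarrow> n \<le> level f \<Longrightarrow> goodv (f \<restriction> n)"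
  using level_restr[of n f] by (auto simp: goodv_def vnth_restr simp del: level_restr)
    (simp add: restr_def)

section \<open>The operator $\delta^{\vec x}$\<close>

text \<open>The level of \<open>delta\<close> at X. It is one above the level of the vector of X, so
  that a \<open>delta\<close> can be boxed with a vector substituted for X.\<close>

abbreviation dlev :: "tvar \<Rightarrow> nat" where
  "dlev X \<equiv> lv (vty X) + 1"

lemma xfree_simps [simp]:
  "xfree X (OVar Y i) \<longleftrightarrow> X \<noteq> Y"
  "xfree X OZero" "xfree X OOne" "xfree X OOmega"
  "xfree X (OAdd f g) \<longleftrightarrow> xfree X f \<and> xfree X g"
  "xfree X (OExp f g) \<longleftrightarrow> xfree X f \<and> xfree X g"
  "xfree X (OPsi f g) \<longleftrightarrow> xfree X f \<and> xfree X g"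
  by (auto simp: xfree_def)

lemma length_delta: "length (delta X i h) = dlev X + 1"
  by (induction h arbitrary: i; subst delta.simps)
    (simp_all add: Let_def ones_def del: upt_Suc xfree_simps)

lemma level_delta [simp]: "level (delta X i h) = dlev X"
  by (simp add: level_def length_delta)

lemma vnth_delta_beyond: "dlev X < j \<Longrightarrow> vnth (delta X i h) j = OZero"
  by (simp add: vnth_def length_delta)

lemma vnth_delta_xfree:
  "xfree X h \<Longrightarrow> vnth (delta X i h) j =
    (if j \<le> dlev X then if j = i then oplus h OOne else OOne else OZero)"
  by (subst delta.simps) (auto simp: Let_def vnth_map_upt simp del: upt_Suc)

lemma vnth_delta_var: "vnth (delta X i (OVar X k)) j = vnth (ones (dlev X)) j"
  by (subst delta.simps) (simp add: Let_def)

lemma vnth_delta_add: "\<not> xfree X (OAdd f g) \<Longrightarrow> vnth (delta X i (OAdd f g)) j =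
    oplus (oplus (vnth (delta X i f) j) (vnth (delta X i g) j)) (vnth (ones (dlev X)) j)"
  by (subst delta.simps) (simp add: Let_def del: xfree_simps)

lemma vnth_delta_exp: "\<not> xfree X (OExp f g) \<Longrightarrow> vnth (delta X i (OExp f g)) j =
    oplus (oplus (oplus (vnth (delta X (i + 1) f) j) (vnth (delta X (i + 1) f) j))
      (vnth (delta X i g) j)) (vnth (ones (dlev X)) j)"
  by (subst delta.simps) (simp add: Let_def del: xfree_simps)

lemma vnth_delta_psi: "\<not> xfree X (OPsi f g) \<Longrightarrow> vnth (delta X i (OPsi f g)) j =
    (if j = 0 then OPsi (osub1 X f) (vnth (delta X 0 g) 0)
     else oplus (vnth (delta X 1 f) j) (vnth (delta X 0 g) j))"
proof -
  assume *: "\<not> xfree X (OPsi f g)"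
  have "vnth (delta X i (OPsi f g)) j = oplus (vnth (delta X 1 f) j) (vnth (delta X 0 g) j)"
    if "j \<noteq> 0" "j \<le> dlev X"
    using that * by (subst delta.simps) (cases j, auto simp: Let_def vnth_def simp del: xfree_simps upt_Suc)
  moreover have "vnth (delta X i (OPsi f g)) 0 = OPsi (osub1 X f) (vnth (delta X 0 g) 0)"
    using * by (subst delta.simps) (simp add: Let_def vnth_def del: xfree_simps upt_Suc)
  ultimately show ?thesis
    by (cases "j \<le> dlev X") (auto simp: vnth_delta_beyond oplus_def)
qed

lemma sz_xfree: "xfree X h \<Longrightarrow> sz X h = 1"
  by (subst sz.simps) simp

lemma sz_var: "sz X (OVar X i) = 1"
  by (subst sz.simps) simp

lemma sz_add: "\<not> xfree X (OAdd f g) \<Longrightarrow> sz X (OAdd f g) = sz X f + sz X g + 1"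
  by (subst sz.simps) (simp del: xfree_simps)

lemma sz_exp: "\<not> xfree X (OExp f g) \<Longrightarrow> sz X (OExp f g) = 2 * sz X f + sz X g + 1"
  by (subst sz.simps) (simp del: xfree_simps)

lemma sz_psi: "\<not> xfree X (OPsi f g) \<Longrightarrow> sz X (OPsi f g) = sz X f + sz X g + 1"
  by (subst sz.simps) (simp del: xfree_simps)

lemma sz_pos: "1 \<le> sz X h"
  by (subst sz.simps) (auto split: oterm.splits)

section \<open>Instances of terms in the classes and of their deltas\<close>

lemma clsC_clsB: "clsC X i h \<Longrightarrow> adm \<chi> \<Longrightarrow> clsB i (osubst \<chi> h)"
proof (induction rule: clsC.induct)
  case (3 i Y)
  then show ?case by (simp add: admissible_iff)
next
  case (6 f g)
  then show ?case using clsB_nat no_leq_F2D by (auto intro!: clsB.intros(5))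
qed (auto intro: clsB.intros)

lemma clsC_0_nat: "clsC X 0 h \<Longrightarrow> adm \<chi> \<Longrightarrow> val \<chi> h = of_nat (no (val \<chi> h))"
  using clsC_clsB clsB_nat by blast

text \<open>The variable x_i enters at its own index i, sums, powers and \<open>psi\<close> never
  raise the index, and a term of class 0 is lifted only if it is x-free.\<close>

lemma clsC_xfree_beyond: "clsC X i h \<Longrightarrow> lv (vty X) < i \<Longrightarrow> xfree X h"
  by (induction rule: clsC.induct) auto

text \<open>Induction adapted to the recursion of \<open>delta\<close> and \<open>sz\<close>, which
  stops at x-free terms. In the compound cases the term is not x-free, so i <= lv (vty X), and the
  exponent of a power still has index at most \<open>dlev X\<close>.\<close>

lemma clsC_xcases [consumes 1, case_names xfree var add exp psi]:
  assumes "clsC X i h"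
    and "\<And>i h. clsC X i h \<Longrightarrow> xfree X h \<Longrightarrow> P i h"
    and "\<And>i. i \<le> lv (vty X) \<Longrightarrow> P i (OVar X i)"
    and "\<And>i f g. clsC X i f \<Longrightarrow> P i f \<Longrightarrow> clsC X i g \<Longrightarrow> P i g \<Longrightarrow> \<not> xfree X (OAdd f g) \<Longrightarrow>
      i \<le> lv (vty X) \<Longrightarrow> P i (OAdd f g)"
    and "\<And>i f g. 1 \<le> i \<Longrightarrow> clsC X (i + 1) f \<Longrightarrow> P (i + 1) f \<Longrightarrow> clsC X i g \<Longrightarrow> P i g \<Longrightarrow>
      \<not> xfree X (OExp f g) \<Longrightarrow> i \<le> lv (vty X) \<Longrightarrow> P i (OExp f g)"
    and "\<And>f g. clsC X 1 f \<Longrightarrow> P 1 f \<Longrightarrow> clsC X 0 g \<Longrightarrow> P 0 g \<Longrightarrow> no_leq_F2 f g \<Longrightarrow>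
      \<not> xfree X (OPsi f g) \<Longrightarrow> P 0 (OPsi f g)"
  shows "P i h"
  using assms(1)
proof (induction rule: clsC.induct)
  case (3 i Y)
  then show ?case using assms(2)[of i "OVar Y i"] assms(3) clsC.intros(3) by (cases "Y = X") auto
next
  case (4 i f g)
  then show ?case
    using clsC.intros(4)[of X i f g] clsC_xfree_beyond[of X i "OAdd f g"] assms(2)[of i "OAdd f g"]
      assms(4)[of i f g] by (cases "xfree X (OAdd f g)") (auto simp: linorder_not_less[symmetric] simp del: xfree_simps)
next
  case (5 i f g)
  then show ?case
    using clsC.intros(5)[of i X f g] clsC_xfree_beyond[of X i "OExp f g"] assms(2)[of i "OExp f g"]
      assms(5)[of i f g] by (cases "xfree X (OExp f g)") (auto simp: linorder_not_less[symmetric] simp del: xfree_simps)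
next
  case (6 f g)
  then show ?case
    using clsC.intros(6)[of X f g] assms(2)[of 0 "OPsi f g"] assms(6)[of f g]
    by (cases "xfree X (OPsi f g)") (auto simp del: xfree_simps)
qed (auto intro: assms(2) clsC.intros simp del: One_nat_def)

abbreviation upd1 :: "(tvar \<Rightarrow> nat \<Rightarrow> oterm) \<Rightarrow> tvar \<Rightarrow> tvar \<Rightarrow> nat \<Rightarrow> oterm" where
  "upd1 \<chi> X \<equiv> upd \<chi> X (ones (lv (vty X)))"

lemma adm_upd1: "adm \<chi> \<Longrightarrow> adm (upd1 \<chi> X)"
  by (rule adm_upd) (simp_all add: goodv_ones)

lemma osubst_osub1: "osubst \<chi> (osub1 X h) = osubst (upd1 \<chi> X) h"
  by (simp add: osub1_def osubst_osub)

lemma val_upd_var: "val (upd \<chi> X a) (OVar X i) = val \<chi> (vnth a i)"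
  by (simp add: upd_def)

lemma clsB_oplus:
  "clsB i (osubst \<chi> f) \<Longrightarrow> clsB i (osubst \<chi> g) \<Longrightarrow> clsB i (osubst \<chi> (oplus f g))"
  using clsB.intros(3) by (auto simp: oplus_def)

text \<open>The second conjunct supports the first: for a \<open>psi\<close> term the norm condition
  is known for f and g at x := 1, and it carries over because g at x := 1 is at most component 0 of
  its \<open>delta\<close>.\<close>

lemma delta_clsB:
  assumes "clsC X i h" "adm \<chi>"
  shows "(\<forall>j\<le>dlev X. clsB j (osubst \<chi> (vnth (delta X i h) j))) \<and>
    (i = 0 \<longrightarrow> no (val (upd1 \<chi> X) h) \<le> no (val \<chi> (vnth (delta X 0 h) 0)))"
  using assms(1)
proof (induction rule: clsC_xcases)
  case (xfree i h)
  have h: "clsB i (osubst \<chi> h)" using clsC_clsB[OF xfree(1) assms(2)] .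
  then have "h \<noteq> OZero" by (auto simp: clsB_not_OZero)
  then have "clsB i (osubst \<chi> (oplus h OOne))"
    using h clsB.intros(1,3) by (simp add: oplus_def)
  then show ?case
    using xfree(2) clsB.intros(1) by (simp add: vnth_delta_xfree osubst_upd_xfree)
next
  case (var i)
  then show ?case
    using clsB.intros(1) by (simp add: vnth_delta_var vnth_ones val_upd_var del: osubst.simps(1))
next
  case (add i f g)
  then show ?case
    using clsB.intros(1) by (auto simp: vnth_delta_add vnth_ones clsB_oplus simp del: xfree_simps)
next
  case (exp i f g)
  then show ?case
    using clsB.intros(1) by (auto simp: vnth_delta_exp vnth_ones clsB_oplus simp del: xfree_simps)
next
  case (psi f g)
  let ?k = "no (val \<chi> (vnth (delta X 0 g) 0))" and ?f = "val (upd1 \<chi> X) f"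
  have g: "clsB 0 (osubst \<chi> (vnth (delta X 0 g) 0))" and le: "no (val (upd1 \<chi> X) g) \<le> ?k"
    using psi by auto
  have "no ?f \<le> F 2 (no (val (upd1 \<chi> X) g))"
    using no_leq_F2D[OF psi(3) adm_upd1[OF assms(2)]] .
  also have "\<dots> \<le> F 2 ?k" by (rule F_mono[OF le])
  finally have 0: "clsB 0 (osubst \<chi> (vnth (delta X 0 (OPsi f g)) 0))"
    using clsC_clsB[OF psi(1) adm_upd1[OF assms(2)]] g clsB_nat[OF g]
    by (auto simp: vnth_delta_psi[OF psi(4)] osubst_osub1 intro!: clsB.intros(5))
  have "clsB j (osubst \<chi> (vnth (delta X 0 (OPsi f g)) j))" if "j \<le> dlev X" for j
    using psi 0 that
    by (cases "j = 0")
      (auto simp: vnth_delta_psi[OF psi(4)] clsB_oplus simp del: xfree_simps)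
  moreover have "no (val (upd1 \<chi> X) (OPsi f g)) \<le> no (val \<chi> (vnth (delta X 0 (OPsi f g)) 0))"
  proof -
    have "psi (omega * ?f + of_nat (no (val (upd1 \<chi> X) g))) \<le> psi (omega * ?f + of_nat ?k)"
      by (rule psi_add_of_nat_mono[OF le])
    then show ?thesis
      using clsB_nat[OF g] clsC_0_nat[OF psi(2) adm_upd1[OF assms(2)]]
      by (simp add: vnth_delta_psi[OF psi(4)] osubst_osub1)
  qed
  ultimately show ?case by blast
qed

lemma delta_pos: "clsC X i h \<Longrightarrow> adm \<chi> \<Longrightarrow> j \<le> dlev X \<Longrightarrow> 0 < vals \<chi> (delta X i h) j"
  using delta_clsB[of X i h \<chi>] clsB_pos by blast

lemma delta_0_nat:
  "clsC X 0 h \<Longrightarrow> adm \<chi> \<Longrightarrow> vals \<chi> (delta X 0 h) 0 = of_nat (no (vals \<chi> (delta X 0 h) 0))"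
  using delta_clsB[of X 0 h \<chi>] clsB_nat by blast

lemma delta_0_ge:
  "clsC X 0 h \<Longrightarrow> adm \<chi> \<Longrightarrow> no (val (upd1 \<chi> X) h) \<le> no (vals \<chi> (delta X 0 h) 0)"
  using delta_clsB[of X 0 h \<chi>] by blast

lemma delta_0_pos: "clsC X 0 h \<Longrightarrow> adm \<chi> \<Longrightarrow> 1 \<le> no (vals \<chi> (delta X 0 h) 0)"
  using delta_pos[of X 0 h \<chi> 0] by (metis One_nat_def Suc_leI gr_zeroI no_eq_0_iff less_irrefl le0)

section \<open>Norm bounds for the components of delta\<close>

lemma no_vals_ones_le: "no (vals \<chi> (ones n) j) \<le> 1"
  by (simp add: vnth_ones)

lemma two_power_pred: "1 \<le> i \<Longrightarrow> i \<le> n \<Longrightarrow> x \<le> 2 ^ (i - 1) * R \<Longrightarrow> 1 \<le> R \<Longrightarrow> x + 1 \<le> 2 ^ n * (R :: nat)"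
proof -
  assume *: "1 \<le> i" "i \<le> n" "x \<le> 2 ^ (i - 1) * R" "1 \<le> R"
  have "2 ^ (i - 1) * R \<le> 2 ^ (n - 1) * R" using * by (intro mult_right_mono power_increasing) auto
  moreover have "1 \<le> 2 ^ (n - 1) * R" using * by simp
  moreover have "2 ^ n * R = 2 ^ (n - 1) * R + 2 ^ (n - 1) * R" using * by (cases n) auto
  ultimately show ?thesis using * by linarith
qed

lemma no_exp_parts_le:
  assumes "0 < val \<chi> g" "no (val \<chi> (OExp f g)) \<le> r"
  shows "no (val \<chi> f) \<le> 2 * r" "no (val \<chi> g) \<le> r"
proof -
  show "no (val \<chi> f) \<le> 2 * r"
    using no_le_pow2_mult[OF assms(1), of "val \<chi> f"] assms(2) by simp
  have "no (val \<chi> g) \<le> no (val \<chi> g * pow2 (val \<chi> f))" by (rule no_mult_ge) simp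
  then show "no (val \<chi> g) \<le> r" using assms(2) by (simp add: mult.commute)
qed

text \<open>The hypothesis is scaled by the index: going from 2^f * g to f raises the index by 1 and
  at most doubles the norm, so R stays fixed in the induction. The index never exceeds n =
  \<open>dlev X\<close>, whence the factor 2^n.\<close>

lemma no_delta_le:
  assumes "clsC X i h" "1 \<le> i" "i \<le> dlev X" "adm \<chi>" "1 \<le> R"
    "no (val (upd1 \<chi> X) h) \<le> 2 ^ (i - 1) * R"
  shows "no (vals \<chi> (delta X i h) j) \<le> 2 ^ dlev X * sz X h * R"
  using assms(1-3,6)
proof (induction rule: clsC_xcases)
  case (xfree i h)
  have "no (val \<chi> h) + 1 \<le> 2 ^ dlev X * R"
    using two_power_pred[of i "dlev X" "no (val \<chi> h)" R] xfree assms(5)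
    by (simp add: osubst_upd_xfree)
  then show ?case using xfree assms(5) by (auto simp: vnth_delta_xfree sz_xfree)
next
  case (var i)
  have "1 \<le> 2 ^ dlev X * R" using assms(5) by simp
  then show ?case using no_vals_ones_le[of \<chi> "dlev X" j]
    by (simp only: vnth_delta_var sz_var)
next
  case (add i f g)
  have "1 \<le> 2 ^ dlev X * R" using assms(5) by simp
  moreover have "no (vals \<chi> (delta X i f) j) \<le> 2 ^ dlev X * sz X f * R"
    "no (vals \<chi> (delta X i g) j) \<le> 2 ^ dlev X * sz X g * R"
    using add by simp_all
  moreover have "2 ^ dlev X * (sz X f + sz X g + 1) * R
      = 2 ^ dlev X * sz X f * R + 2 ^ dlev X * sz X g * R + 2 ^ dlev X * R"
    by (simp add: algebra_simps)
  ultimately show ?case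
    using no_vals_ones_le[of \<chi> "dlev X" j]
    unfolding vnth_delta_add[OF add(3)] sz_add[OF add(3)] val_oplus no_add by linarith
next
  case (exp i f g)
  have "0 < val (upd1 \<chi> X) g"
    using clsC_clsB[OF exp(3) adm_upd1[OF assms(4)]] clsB_pos by blast
  note * = no_exp_parts_le[OF this exp(10)]
  have "no (val (upd1 \<chi> X) f) \<le> 2 ^ (i + 1 - 1) * R" using *(1) exp(1) by (cases i) auto
  with exp(5) have "no (vals \<chi> (delta X (i + 1) f) j) \<le> 2 ^ dlev X * sz X f * R"
    by (intro exp(6)) simp_all
  moreover have "no (vals \<chi> (delta X i g) j) \<le> 2 ^ dlev X * sz X g * R"
    using * exp by simp
  moreover have "1 \<le> 2 ^ dlev X * R" using assms(5) by simp
  moreover have "2 ^ dlev X * (2 * sz X f + sz X g + 1) * R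
      = 2 * (2 ^ dlev X * sz X f * R) + 2 ^ dlev X * sz X g * R + 2 ^ dlev X * R"
    by (simp add: algebra_simps)
  ultimately show ?case
    using no_vals_ones_le[of \<chi> "dlev X" j]
    unfolding vnth_delta_exp[OF exp(4)] sz_exp[OF exp(4)] val_oplus no_add by linarith
qed simp

lemma delta_psi_0:
  assumes "clsC X 0 g" "adm \<chi>" "\<not> xfree X (OPsi f g)"
  shows "no (vals \<chi> (delta X 0 (OPsi f g)) 0)
    = psi (omega * val (upd1 \<chi> X) f + of_nat (no (vals \<chi> (delta X 0 g) 0)))"
  using delta_0_nat[OF assms(1,2)] by (simp add: vnth_delta_psi[OF assms(3)] osubst_osub1)

lemma delta_psi_0_ge:
  assumes "clsC X 1 f" "clsC X 0 g" "adm \<chi>" "\<not> xfree X (OPsi f g)"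
  shows "no (val (upd1 \<chi> X) f) \<le> no (vals \<chi> (delta X 0 (OPsi f g)) 0)"
    "no (vals \<chi> (delta X 0 g) 0) \<le> no (vals \<chi> (delta X 0 (OPsi f g)) 0)"
proof -
  let ?f = "val (upd1 \<chi> X) f" and ?k = "no (vals \<chi> (delta X 0 g) 0)"
  have "0 < ?f" using clsC_clsB[OF assms(1) adm_upd1[OF assms(3)]] clsB_pos by blast
  then have "Phi (no (omega * ?f + of_nat ?k)) < psi (omega * ?f + of_nat ?k)" by (rule Phi_less_psi)
  then have "no (omega * ?f + of_nat ?k) \<le> psi (omega * ?f + of_nat ?k)"
    using le_Phi by (meson less_imp_le order_trans)
  then show "no ?f \<le> no (vals \<chi> (delta X 0 (OPsi f g)) 0)"
    "?k \<le> no (vals \<chi> (delta X 0 (OPsi f g)) 0)"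
    using no_omega_times_ge[of ?f] unfolding delta_psi_0[OF assms(2-4)] by simp_all
qed

text \<open>The bound at index 0, with component 0 of \<open>delta\<close> itself as R. For a
  \<open>psi\<close> term this qualifies because a collapsed value exceeds the norm of its argument
  (\<open>delta_psi_0_ge\<close>). The index is given by an equation for the sake of the
  induction.\<close>

lemma no_delta_0_le:
  assumes "clsC X i h" "i = 0" "adm \<chi>"
  shows "no (vals \<chi> (delta X 0 h) j) \<le> 2 ^ dlev X * sz X h * no (vals \<chi> (delta X 0 h) 0)"
  using assms(1,2)
proof (induction rule: clsC_xcases)
  case (xfree i h)
  have "1 * (no (val \<chi> h) + 1) \<le> 2 ^ dlev X * (no (val \<chi> h) + 1)"
    by (rule mult_right_mono) simp_all
  moreover have "no (vals \<chi> (delta X 0 h) j) \<le> no (val \<chi> h) + 1"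
    "no (vals \<chi> (delta X 0 h) 0) = no (val \<chi> h) + 1"
    using xfree by (simp_all add: vnth_delta_xfree)
  ultimately show ?case by (simp add: sz_xfree[OF xfree(2)])
next
  case (var i)
  then show ?case by (auto simp: vnth_delta_var vnth_ones sz_var)
next
  case (add i f g)
  let ?P = "2 ^ dlev X :: nat" and ?a = "no (vals \<chi> (delta X 0 f) 0)" and ?b = "no (vals \<chi> (delta X 0 g) 0)"
  have "no (vals \<chi> (delta X 0 f) j) + no (vals \<chi> (delta X 0 g) j) + 1 \<le>
      ?P * sz X f * ?a + ?P * sz X g * ?b + ?P"
    using add by (intro add_mono) auto
  also have "\<dots> \<le> ?P * (sz X f + sz X g + 1) * (?a + ?b + 1)" by (simp add: algebra_simps)
  finally show ?case
    unfolding vnth_delta_add[OF add(3)] sz_add[OF add(3)]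
    using no_vals_ones_le[of \<chi> "dlev X" j] by (simp add: vnth_ones)
next
  case (psi f g)
  let ?D = "no (vals \<chi> (delta X 0 (OPsi f g)) 0)" and ?P = "2 ^ dlev X :: nat"
  have D: "1 \<le> ?D" using delta_0_pos[OF clsC.intros(6)[OF psi(1,2,3)] assms(3)] .
  show ?case
  proof (cases "j = 0")
    case True
    have "1 * ?D \<le> ?P * sz X (OPsi f g) * ?D" by (rule mult_right_mono) (use sz_pos in auto)
    then show ?thesis using True by simp
  next
    case False
    have "no (vals \<chi> (delta X 1 f) j) \<le> ?P * sz X f * ?D"
      using delta_psi_0_ge(1)[OF psi(1,2) assms(3) psi(4)]
      by (intro no_delta_le[OF psi(1) _ _ assms(3) D]) simp_all
    moreover have "no (vals \<chi> (delta X 0 g) j) \<le> ?P * sz X g * no (vals \<chi> (delta X 0 g) 0)"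
      using psi by simp
    moreover have "\<dots> \<le> ?P * sz X g * ?D"
      using delta_psi_0_ge(2)[OF psi(1,2) assms(3) psi(4)] by (intro mult_left_mono) simp_all
    moreover have "?P * sz X f * ?D + ?P * sz X g * ?D \<le> ?P * sz X (OPsi f g) * ?D"
      unfolding sz_psi[OF psi(4)] by (simp add: algebra_simps)
    ultimately have "no (vals \<chi> (delta X 1 f) j) + no (vals \<chi> (delta X 0 g) j) \<le> ?P * sz X (OPsi f g) * ?D"
      by linarith
    then show ?thesis using False by (subst vnth_delta_psi[OF psi(4)]) simp
  qed
qed simp

lemma level_vdelta [simp]: "level (vdelta X h) = max (dlev X) (level h)"
  by (simp add: vdelta_def Let_def level_def del: upt_Suc)

lemma vnth_vdelta: "vnth (vdelta X h) j =
   (if j = 0 then omult (2 ^ dlev X * (\<Sum>i\<le>level h. sz X (vnth h i))) (vnth (delta X 0 (vnth h 0)) 0)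
    else if j \<le> dlev X then osum (map (\<lambda>i. vnth (delta X i (vnth h i)) j) [0..<level h + 1])
    else if j \<le> level h then vnth h j else OZero)"
  by (auto simp: vdelta_def Let_def vnth_map_upt simp del: upt_Suc)

lemma vals_vdelta:
  "vals \<chi> (vdelta X h) 0 = of_nat (2 ^ dlev X * (\<Sum>i\<le>level h. sz X (vnth h i))) *
      vals \<chi> (delta X 0 (vnth h 0)) 0"
  "1 \<le> j \<Longrightarrow> j \<le> dlev X \<Longrightarrow>
    vals \<chi> (vdelta X h) j = (\<Sum>i\<le>level h. vals \<chi> (delta X i (vnth h i)) j)"
  by (simp_all add: vnth_vdelta o_def interv_sum_list_conv_sum_set_nat atLeast0AtMost
      atLeastLessThanSuc_atLeastAtMost del: upt_Suc sum.atMost_Suc)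

lemma no_of_nat_mult: "no (of_nat k * of_nat m) = k * m"
  by (metis no_of_nat of_nat_mult)

lemma no_vals_vdelta_0:
  assumes "vecC X h" "adm \<chi>"
  shows "no (vals \<chi> (vdelta X h) 0) =
    2 ^ dlev X * (\<Sum>i\<le>level h. sz X (vnth h i)) * no (vals \<chi> (delta X 0 (vnth h 0)) 0)"
proof -
  have "clsC X 0 (vnth h 0)" using assms(1) by (simp add: vecC_def)
  from delta_0_nat[OF this assms(2)] show ?thesis
    unfolding vals_vdelta by (metis no_of_nat_mult)
qed

text \<open>This is what the factor in component 0 is for: component j is a sum over i of terms of
  norm at most 2^n * sz (h_i) * D, where D is component 0 of the \<open>delta\<close> of
  h_0.\<close>

lemma goodv_vdelta:
  assumes "goodv h" "vecC X h"
  shows "goodv (vdelta X h)"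
  unfolding goodv_def
proof (intro conjI allI impI)
  show "vdelta X h \<noteq> []" by (simp add: vdelta_def Let_def)
next
  fix \<chi> j assume \<chi>: "adm \<chi>" and j: "j \<le> level (vdelta X h)"
  let ?d = "\<lambda>i. delta X i (vnth h i)" and ?P = "2 ^ dlev X :: nat"
  let ?D = "no (vals \<chi> (?d 0) 0)"
  have C: "clsC X i (vnth h i)" if "i \<le> level h" for i using assms(2) that by (simp add: vecC_def)
  have D: "1 \<le> ?D" using C \<chi> by (intro delta_0_pos) simp_all
  let ?S = "\<Sum>i\<le>level h. sz X (vnth h i)"
  have S: "1 \<le> ?S" using sz_pos[of X "vnth h 0"] member_le_sum[of 0 "{..level h}" "\<lambda>i. sz X (vnth h i)"] by simp
  have no0: "no (vals \<chi> (vdelta X h) 0) = ?P * ?S * ?D" by (rule no_vals_vdelta_0[OF assms(2) \<chi>])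
  have B0: "clsB0 i' \<chi> (vnth (?d i) i')" if "i \<le> level h" "i' \<le> dlev X" for i i'
    using delta_clsB[OF C[OF that(1)] \<chi>] that(2) by (simp add: clsB0_def)
  \<comment> \<open>At x := 1 all components of h have norm at most that of h_0, which is bounded by
    component 0 of its \<open>delta\<close>.\<close>
  have le: "no (val (upd1 \<chi> X) (vnth h i)) \<le> ?D" for i
    using goodv_no_le[OF assms(1) adm_upd1[OF \<chi>]] delta_0_ge[OF C[of 0] \<chi>] by (meson le0 order_trans)
  consider "j = 0" | "1 \<le> j" "j \<le> dlev X" | "dlev X < j" "j \<le> level h" using j by fastforce
  then have "clsB j (osubst \<chi> (vnth (vdelta X h) j)) \<and> no (vals \<chi> (vdelta X h) j) \<le> ?P * ?S * ?D"
  proof cases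
    case 1
    have "0 < ?P * ?S * ?D" using D S by (intro mult_pos_pos) (linarith | simp)+
    then have "no (vals \<chi> (vdelta X h) 0) \<noteq> 0" unfolding no0 by linarith
    then have "0 < vals \<chi> (vdelta X h) 0" by (simp add: eord_gr_zero_iff)
    moreover have "clsB0 0 \<chi> (vnth (vdelta X h) 0)"
      using B0[of 0 0] by (simp add: vnth_vdelta clsB0_omult)
    ultimately show ?thesis using no0 1 by (auto intro: clsB0_imp_clsB)
  next
    case 2
    have "vals \<chi> (?d 0) j \<le> vals \<chi> (vdelta X h) j"
      unfolding vals_vdelta(2)[OF 2] by (rule member_le_sum) auto
    with delta_pos[OF C[of 0] \<chi> 2(2)] have "0 < vals \<chi> (vdelta X h) j" by simp
    moreover have "clsB0 j \<chi> (vnth (vdelta X h) j)"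
      using 2 by (auto simp: vnth_vdelta less_Suc_eq_le simp del: upt_Suc intro!: clsB0_osum B0)
    moreover have "no (vals \<chi> (vdelta X h) j) \<le> ?P * ?S * ?D"
    proof -
      have "no (vals \<chi> (?d i) j) \<le> ?P * sz X (vnth h i) * ?D" if i: "i \<le> level h" for i
      proof (cases "i = 0")
        case True
        then show ?thesis using no_delta_0_le[OF C[of 0] refl \<chi>] by simp
      next
        case False
        show ?thesis
        proof (cases "i \<le> dlev X")
          case True
          have "?D \<le> 2 ^ (i - 1) * ?D" by simp
          then show ?thesis
            using le[of i] False True
            by (intro no_delta_le[OF C[OF i] _ _ \<chi> D]) (auto intro: order_trans)
        next
          case False
          \<comment> \<open>h_i is x-free here, and j <= \<open>dlev X\<close> < i, so only the
            default entry 1 is met.\<close>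
          then have "no (vals \<chi> (?d i) j) \<le> 1"
            using clsC_xfree_beyond[OF C[OF i]] by (auto simp: vnth_delta_xfree)
          also have "\<dots> \<le> ?P * sz X (vnth h i) * ?D" using D sz_pos by (simp add: Suc_le_eq)
          finally show ?thesis .
        qed
      qed
      then have "no (vals \<chi> (vdelta X h) j) \<le> (\<Sum>i\<le>level h. ?P * sz X (vnth h i) * ?D)"
        unfolding vals_vdelta(2)[OF 2] no_sum by (intro sum_mono) simp
      then show ?thesis by (simp add: sum_distrib_left sum_distrib_right)
    qed
    ultimately show ?thesis by (auto intro: clsB0_imp_clsB)
  next
    case 3
    then have eq: "vnth (vdelta X h) j = vnth h j" by (simp add: vnth_vdelta)
    have "xfree X (vnth h j)" using clsC_xfree_beyond[OF C[OF 3(2)]] 3(1) by simp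
    then have "no (val \<chi> (vnth h j)) \<le> ?D" using le[of j] by (simp add: osubst_upd_xfree)
    also have "1 * ?D \<le> ?P * ?S * ?D" by (rule mult_right_mono) (use S in \<open>simp_all add: Suc_le_eq\<close>)
    then have "?D \<le> ?P * ?S * ?D" by simp
    finally show ?thesis unfolding eq using goodv_clsB[OF assms(1) \<chi> 3(2)] by blast
  qed
  then show "clsB j (osubst \<chi> (vnth (vdelta X h) j))"
    "no (vals \<chi> (vdelta X h) j) \<le> no (vals \<chi> (vdelta X h) 0)"
    unfolding no0 by simp_all
qed

lemma map_osub1: "map (osub1 X) w = map (osub X (ones (lv (vty X)))) w"
  by (simp add: osub1_def)

lemma goodv_lam_vec: "goodv v \<Longrightarrow> vecC X v \<Longrightarrow> goodv w \<Longrightarrow> goodv (lam_vec X v w)"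
  unfolding lam_vec_def map_osub1
  by (intro goodv_vplus goodv_vdelta goodv_osub) (simp_all add: goodv_ones)

section \<open>Howard's majorization\<close>

text \<open>Sums are handled by superadditivity of the box. For a power, strictness comes from the
  factor g; the boxes one index higher, F for the exponent and G for g, satisfy F + G <= H, so that
  2^F * 2^G <= 2^H restores the shape of a box.\<close>

lemma val_upd_less_bx:
  assumes "clsC X i h" "1 \<le> i" "i \<le> dlev X" "adm \<chi>"
  shows "val (upd \<chi> X a) h < bx (vals \<chi> (delta X i h)) (vals \<chi> a) (lv (vty X)) i"
  using assms(1-3)
proof (induction rule: clsC_xcases)
  case (xfree i h)
  have "val (upd \<chi> X a) h < val \<chi> h + 1"
    by (simp add: osubst_upd_xfree xfree less_eord_add1_iff)
  also have "\<dots> = vals \<chi> (delta X i h) i" using xfree by (simp add: vnth_delta_xfree)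
  also have "\<dots> \<le> bx (vals \<chi> (delta X i h)) (vals \<chi> a) (lv (vty X)) i" by (rule bx_ge_left)
  finally show ?case .
next
  case (var i)
  have "val \<chi> (vnth a i) < 1 + val \<chi> (vnth a i)" by (simp add: less_eord_add1_iff add.commute)
  also have "\<dots> = vals \<chi> (delta X i (OVar X i)) i + vals \<chi> a i"
    using var by (simp add: vnth_delta_var vnth_ones)
  also have "\<dots> \<le> bx (vals \<chi> (delta X i (OVar X i))) (vals \<chi> a) (lv (vty X)) i"
    by (rule bx_ge[OF var(1)])
  finally show ?case unfolding val_upd_var .
next
  case (add i f g)
  have "val (upd \<chi> X a) f + val (upd \<chi> X a) g <
      bx (vals \<chi> (delta X i f)) (vals \<chi> a) (lv (vty X)) i +
      bx (vals \<chi> (delta X i g)) (vals \<chi> a) (lv (vty X)) i"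
    using add by (intro add_strict_mono) auto
  also have "\<dots> \<le> bx (vals \<chi> (delta X i (OAdd f g))) (vals \<chi> a) (lv (vty X)) i"
  proof (rule bx_superadditive_le)
    show "vals \<chi> (delta X i f) j + vals \<chi> (delta X i g) j \<le> vals \<chi> (delta X i (OAdd f g)) j" for j
      by (simp add: vnth_delta_add[OF add(3)] add_ge_left_eord)
  qed (use add(1,2) assms(4) in \<open>auto intro: delta_pos\<close>)
  finally show ?case by simp
next
  case (exp i f g)
  let ?F = "bx (vals \<chi> (delta X (i + 1) f)) (vals \<chi> a) (lv (vty X)) (i + 1)"
    and ?G = "bx (vals \<chi> (delta X i g)) (vals \<chi> a) (lv (vty X)) (i + 1)"
    and ?H = "bx (vals \<chi> (delta X i (OExp f g))) (vals \<chi> a) (lv (vty X)) (i + 1)"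
  have le: "vals \<chi> (delta X (i + 1) f) j + vals \<chi> (delta X i g) j \<le> vals \<chi> (delta X i (OExp f g)) j" for j
  proof -
    have "vals \<chi> (delta X i (OExp f g)) j = (vals \<chi> (delta X (i + 1) f) j + vals \<chi> (delta X i g) j)
        + (vals \<chi> (delta X (i + 1) f) j + vals \<chi> (ones (dlev X)) j)"
      by (simp add: vnth_delta_exp[OF exp(4)] ac_simps)
    then show ?thesis by (simp only: add_ge_left_eord)
  qed
  have FG: "?F + ?G \<le> ?H"
    by (rule bx_superadditive_le[OF _ le]) (use exp(2,3) assms(4) in \<open>auto intro: delta_pos\<close>)
  have "val (upd \<chi> X a) f \<le> ?F" using exp by simp
  then have "pow2 (val (upd \<chi> X a) f) \<le> pow2 ?F" by (rule pow2_mono)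
  have "pow2 (val (upd \<chi> X a) f) * val (upd \<chi> X a) g < pow2 (val (upd \<chi> X a) f) *
      bx (vals \<chi> (delta X i g)) (vals \<chi> a) (lv (vty X)) i"
    using exp by (intro mult_strict_left_mono) simp_all
  also have "\<dots> = pow2 (val (upd \<chi> X a) f) * (pow2 ?G * (vals \<chi> (delta X i g) i + vals \<chi> a i))"
    by (simp only: bx_step[OF exp(5)])
  also have "\<dots> \<le> pow2 ?F * (pow2 ?G * (vals \<chi> (delta X i (OExp f g)) i + vals \<chi> a i))"
  proof (intro mult_mono add_mono order_refl)
    show "vals \<chi> (delta X i g) i \<le> vals \<chi> (delta X i (OExp f g)) i"
      using le[of i] add_ge_right_eord by (rule order_trans[rotated])
  qed (fact | simp)+
  also have "\<dots> = pow2 (?F + ?G) * (vals \<chi> (delta X i (OExp f g)) i + vals \<chi> a i)"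
    by (simp only: pow2_add mult.assoc)
  also have "\<dots> \<le> pow2 ?H * (vals \<chi> (delta X i (OExp f g)) i + vals \<chi> a i)"
    by (intro mult_right_mono pow2_mono FG) simp
  finally show ?case by (simp only: osubst.simps oval.simps bx_step[OF exp(5)])
qed simp

text \<open>A sum costs one exponentiation and a power two, and \<open>sz\<close> grows at least
  accordingly; x-free parts and variables start from m. The scaling by 2^(i - 1) is that of
  \<open>no_delta_le\<close>.\<close>

lemma no_val_upd_le_tower:
  assumes "clsC X i h" "1 \<le> i" "i \<le> dlev X" "adm \<chi>" "goodv a" "1 \<le> R"
    "no (val (upd1 \<chi> X) h) \<le> 2 ^ (i - 1) * R"
    "2 ^ dlev X * R \<le> m" "no (vals \<chi> a 0) \<le> m"
  shows "no (val (upd \<chi> X a) h) \<le> (F 0 ^^ sz X h) m"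
proof -
  have "1 \<le> 2 ^ dlev X * R" using assms(6) by simp
  then have m: "1 \<le> m" using assms(8) by linarith
  have ge: "m \<le> (F 0 ^^ k) m" for k using funpow_F_mono[of 0 k m m 0] by simp
  show ?thesis
    using assms(1-3,7)
  proof (induction rule: clsC_xcases)
    case (xfree i h)
    have "no (val \<chi> h) + 1 \<le> m"
      using two_power_pred[of i "dlev X" "no (val \<chi> h)" R] xfree assms(6,8)
      by (simp add: osubst_upd_xfree)
    then show ?case using ge[of "sz X h"] by (simp add: osubst_upd_xfree[OF xfree(2)])
  next
    case (var i)
    have "no (vals \<chi> a i) \<le> m" using goodv_no_le[OF assms(5,4)] assms(9) by (rule order_trans)
    then show ?case using ge[of "sz X (OVar X i)"] unfolding val_upd_var by (rule order_trans)
  next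
    case (add i f g)
    let ?k = "max (sz X f) (sz X g)"
    have "no (val (upd \<chi> X a) f) \<le> (F 0 ^^ sz X f) m" "no (val (upd \<chi> X a) g) \<le> (F 0 ^^ sz X g) m"
      using add by simp_all
    then have *: "no (val (upd \<chi> X a) f) \<le> (F 0 ^^ ?k) m" "no (val (upd \<chi> X a) g) \<le> (F 0 ^^ ?k) m"
      by (meson funpow_F_mono max.cobounded1 max.cobounded2 order_refl order_trans)+
    have "(F 0 ^^ ?k) m + (F 0 ^^ ?k) m \<le> 2 ^ (F 0 ^^ ?k) m"
      using two_times_le_two_power[of "(F 0 ^^ ?k) m"] by (simp only: mult_2)
    also have "\<dots> = (F 0 ^^ (?k + 1)) m" by (simp add: F.simps)
    also have "\<dots> \<le> (F 0 ^^ (sz X f + sz X g + 1)) m" by (intro funpow_F_mono) simp_all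
    finally show ?case using * unfolding sz_add[OF add(3)] osubst.simps oval.simps no_add by linarith
  next
    case (exp i f g)
    let ?k = "max (sz X f) (sz X g)"
    have "0 < val (upd1 \<chi> X) g"
      using clsC_clsB[OF exp(3) adm_upd1[OF assms(4)]] clsB_pos by blast
    note 1 = no_exp_parts_le[OF this exp(10)]
    have "no (val (upd1 \<chi> X) f) \<le> 2 ^ (i + 1 - 1) * R" using 1 exp(1) by (cases i) auto
    then have "no (val (upd \<chi> X a) f) \<le> (F 0 ^^ sz X f) m" "no (val (upd \<chi> X a) g) \<le> (F 0 ^^ sz X g) m"
      using exp 1 by simp_all
    then have *: "no (val (upd \<chi> X a) f) \<le> (F 0 ^^ ?k) m" "no (val (upd \<chi> X a) g) \<le> (F 0 ^^ ?k) m"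
      by (meson funpow_F_mono max.cobounded1 max.cobounded2 order_refl order_trans)+
    have "no (pow2 (val (upd \<chi> X a) f) * val (upd \<chi> X a) g)
        \<le> no (pow2 (val (upd \<chi> X a) f)) * no (val (upd \<chi> X a) g)" by (rule no_mult_le)
    also have "\<dots> \<le> 2 ^ no (val (upd \<chi> X a) f) * no (val (upd \<chi> X a) g)"
      by (rule mult_right_mono[OF no_pow2_le]) simp
    also have "\<dots> \<le> (F 0 ^^ (?k + 2)) m" by (rule mult_pow2_le_tower[OF m *])
    also have "\<dots> \<le> (F 0 ^^ (2 * sz X f + sz X g + 1)) m"
      using sz_pos[of X f] sz_pos[of X g] by (intro funpow_F_mono) (auto simp: max_def)
    finally show ?case unfolding sz_exp[OF exp(4)] by simp
  qed simp
qed

lemma no_bx_delta_0_le: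
  assumes "clsC X 0 h" "adm \<chi>" "goodv a" "1 \<le> i"
  shows "no (bx (vals \<chi> (delta X 0 h)) (vals \<chi> a) n i)
    \<le> F 2 (2 ^ dlev X * sz X h * no (vals \<chi> (delta X 0 h) 0) + no (vals \<chi> a 0) + n)"
proof (rule no_bx_le_F2)
  show "no (vals \<chi> (delta X 0 h) j) + no (vals \<chi> a j)
      \<le> 2 ^ dlev X * sz X h * no (vals \<chi> (delta X 0 h) 0) + no (vals \<chi> a 0)" for j
    by (intro add_mono no_delta_0_le[OF assms(1) refl assms(2)] goodv_no_le assms)
  show "1 \<le> 2 ^ dlev X * sz X h * no (vals \<chi> (delta X 0 h) 0) + no (vals \<chi> a 0)"
    using goodv_no_pos[OF assms(3,2)] by simp
qed (fact assms(4))

text \<open>At index 0 the majorant is a collapsed value. Sums are merged by \<open>psi_add\<close>,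
  a nested \<open>psi\<close> by \<open>psi_nested\<close>; the coefficient of omega has to leave
  room for this, and the finite summand, through \<open>sz\<close>, has to control the
  norms.\<close>

lemma val_upd_less_psi:
  assumes "clsC X i h" "i = 0" "adm \<chi>" "goodv a" "level a = lv (vty X)"
  shows "no (val (upd \<chi> X a) h) <
    psi (omega * bx (vals \<chi> (delta X 0 h)) (vals \<chi> a) (lv (vty X)) 1 +
      of_nat (2 ^ dlev X * sz X h * no (vals \<chi> (delta X 0 h) 0) + no (vals \<chi> a 0) + lv (vty X)))"
  using assms(1,2)
proof (induction rule: clsC_xcases)
  case (xfree i h)
  have "1 * (no (val \<chi> h) + 1) \<le> 2 ^ dlev X * (no (val \<chi> h) + 1)"
    by (rule mult_right_mono) simp_all
  moreover have "no (vals \<chi> (delta X 0 h) 0) = no (val \<chi> h) + 1"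
    using xfree by (simp add: vnth_delta_xfree)
  ultimately show ?case
    by (intro less_psi_omega) (simp add: sz_xfree[OF xfree(2)] osubst_upd_xfree[OF xfree(2)])
next
  case (var i)
  have "no (val (upd \<chi> X a) (OVar X i)) = no (vals \<chi> a 0)" by (simp only: val_upd_var var(2))
  then show ?case
    using var by (intro less_psi_omega) (simp add: sz_var vnth_delta_var vnth_ones del: osubst.simps(1))
next
  case (add i f g)
  let ?n = "lv (vty X)" and ?P = "2 ^ dlev X :: nat" and ?g0 = "no (vals \<chi> a 0)"
  let ?b = "\<lambda>h. bx (vals \<chi> (delta X 0 h)) (vals \<chi> a) ?n 1"
  let ?d = "\<lambda>h. no (vals \<chi> (delta X 0 h) 0)"
  let ?y = "\<lambda>h. ?P * sz X h * ?d h + ?g0 + ?n"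
  let ?h = "OAdd f g"
  have f: "clsC X 0 f" and g: "clsC X 0 g" using add by simp_all
  have dh: "?d ?h = ?d f + ?d g + 1"
    by (simp add: vnth_delta_add[OF add(3)] vnth_ones)
  have y: "?P * sz X f * ?d f + ?P * sz X g * ?d g \<le> ?P * sz X ?h * ?d ?h"
    unfolding sz_add[OF add(3)] dh by (simp add: algebra_simps)
  \<comment> \<open>The ones that \<open>delta\<close> adds at a sum make the coefficient of omega
    strictly larger, so the finite summands need only agree up to a constant factor.\<close>
  have "?b f + ?b g < ?b f + ?b g + bx (vals \<chi> (ones (dlev X))) (vals \<chi> a) ?n 1"
    by (intro less_add_self_eord bx_pos) (simp add: vnth_ones)
  also have "\<dots> \<le> bx (\<lambda>j. vals \<chi> (delta X 0 f) j + vals \<chi> (delta X 0 g) j) (vals \<chi> a) ?n 1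
      + bx (vals \<chi> (ones (dlev X))) (vals \<chi> a) ?n 1"
    by (intro add_right_mono bx_superadditive) (use f g assms(3) in \<open>auto intro: delta_pos\<close>)
  also have "\<dots> \<le> ?b ?h"
    by (rule bx_superadditive_le)
      (use f g assms(3) in \<open>auto simp: vnth_delta_add[OF add(3)] vnth_ones intro!: add_pos_pos delta_pos\<close>)
  finally have b: "?b f + ?b g < ?b ?h" .
  have "no (val (upd \<chi> X a) ?h) = no (val (upd \<chi> X a) f) + no (val (upd \<chi> X a) g)" by simp
  also have "\<dots> < psi (omega * ?b f + of_nat (?y f)) + psi (omega * ?b g + of_nat (?y g))"
    using add by (intro add_strict_mono) simp_all
  also have "\<dots> \<le> psi (omega * ?b f + of_nat (?y f) + (omega * ?b g + of_nat (?y g)))"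
    by (rule psi_add)
  also have "\<dots> = psi (omega * (?b f + ?b g) + of_nat (?y f + ?y g))"
    by (simp only: distrib_left of_nat_add ac_simps)
  also have "\<dots> < psi (omega * ?b ?h + of_nat (?y ?h))"
  proof (rule psi_omega_less[OF disjI1[OF b]])
    have yf: "?y f \<le> ?y ?h" and yg: "?y g \<le> ?y ?h" using y by linarith+
    have "no (?b f) \<le> F 2 (?y ?h)"
      using no_bx_delta_0_le[OF f assms(3,4), of 1 ?n] F_mono[OF yf, of 2] by (meson order_refl order_trans)
    moreover have "no (?b g) \<le> F 2 (?y ?h)"
      using no_bx_delta_0_le[OF g assms(3,4), of 1 ?n] F_mono[OF yg, of 2] by (meson order_refl order_trans)
    moreover have "no (?b f + ?b g) \<le> 4 * F 2 (F 2 (F 2 m)) + 4 * m"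
      if "no (?b f) \<le> F 2 m" "no (?b g) \<le> F 2 m" for m
      using that F2_le_F2_F2_F2[of m] by simp
    ultimately show "no (?b f + ?b g) \<le> 4 * F 2 (F 2 (F 2 (?y ?h))) + 4 * ?y ?h" by blast
    have "x + x' \<le> 8 * m" if "x \<le> m" "x' \<le> m" for x x' m :: nat using that by simp
    from this[OF yf yg] show "?y f + ?y g \<le> 8 * ?y ?h" .
  qed
  finally show ?case .
next
  case (psi f g)
  let ?n = "lv (vty X)" and ?P = "2 ^ dlev X :: nat" and ?g0 = "no (vals \<chi> a 0)"
  let ?b = "\<lambda>h. bx (vals \<chi> (delta X 0 h)) (vals \<chi> a) ?n 1"
  let ?d = "\<lambda>h. no (vals \<chi> (delta X 0 h) 0)"
  let ?y = "\<lambda>h. ?P * sz X h * ?d h + ?g0 + ?n"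
  let ?h = "OPsi f g"
  let ?f = "val (upd \<chi> X a) f" and ?k = "no (val (upd \<chi> X a) g)"
  let ?a = "bx (vals \<chi> (delta X 1 f)) (vals \<chi> a) ?n 1"
  have D: "1 \<le> ?d ?h" using delta_0_pos[OF clsC.intros(6)[OF psi(1,2,3)] assms(3)] .
  have adm': "adm (upd \<chi> X a)" by (rule adm_upd[OF assms(3-5)])
  have "?f < ?a" using val_upd_less_bx[OF psi(1) _ _ assms(3)] by simp
  have ab: "?a + ?b g \<le> ?b ?h"
    by (rule bx_superadditive_le)
      (use psi(1,2) assms(3) in \<open>auto simp: vnth_delta_psi[OF psi(4)] intro: delta_pos\<close>)
  \<comment> \<open>The 1 is the omega that \<open>psi_nested\<close> spends below; the strict bound
    on f provides it.\<close>
  have "?f + 1 + ?b g \<le> ?a + ?b g"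
    using \<open>?f < ?a\<close> by (intro add_right_mono) (simp add: eord_less_iff_add1_le)
  with ab have le: "?f + 1 + ?b g \<le> ?b ?h" by (rule order_trans[rotated])
  have dd: "?d g \<le> ?d ?h" by (rule delta_psi_0_ge(2)[OF psi(1,2) assms(3) psi(4)])
  have szh: "sz X g \<le> sz X ?h" "sz X f \<le> sz X ?h" by (simp_all add: sz_psi[OF psi(4)])
  have yg: "?y g \<le> ?y ?h"
    by (intro add_right_mono mult_mono dd szh order_refl) simp_all
  have yf: "?P * ?d ?h + ?g0 \<le> ?y ?h"
  proof -
    have "?P * 1 * ?d ?h \<le> ?P * sz X ?h * ?d ?h"
      by (intro mult_right_mono mult_left_mono sz_pos) simp_all
    then show ?thesis unfolding mult_1_right by linarith
  qed
  \<comment> \<open>The tower bounding the norm of f has height \<open>sz X f\<close>; F_2 absorbs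
    it because the finite summand is at least that large.\<close>
  have szy: "sz X f \<le> ?y ?h"
  proof -
    have "1 * sz X ?h * 1 \<le> ?P * sz X ?h * ?d ?h" by (intro mult_mono D order_refl) simp_all
    then show ?thesis using szh(2) by linarith
  qed
  have y1: "1 \<le> ?y ?h" using goodv_no_pos[OF assms(4,3)] by linarith
  have "no ?f \<le> (F 0 ^^ sz X f) (?P * ?d ?h + ?g0)"
    by (rule no_val_upd_le_tower[OF psi(1) _ _ assms(3,4) D])
      (use delta_psi_0_ge(1)[OF psi(1,2) assms(3) psi(4)] in simp_all)
  also have "\<dots> \<le> (F 0 ^^ sz X f) (?y ?h)" by (rule funpow_F_mono[OF order_refl yf])
  also have "\<dots> \<le> F 2 (?y ?h)" using szy y1 by (intro tower_le_F2) simp_all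
  finally have nf: "no ?f \<le> F 2 (?y ?h)" .
  have ng: "no (?b g) \<le> F 2 (?y ?h)"
    using no_bx_delta_0_le[OF psi(2) assms(3,4), of 1 ?n] F_mono[OF yg, of 2]
    by (meson order_refl order_trans)
  have "no (val (upd \<chi> X a) ?h) = psi (omega * ?f + of_nat ?k)"
    using clsC_0_nat[OF psi(2) adm'] by simp
  also have "\<dots> \<le> psi (omega * ?f + of_nat (0 + psi (omega * ?b g + of_nat (?y g))))"
    using psi(6) by (intro psi_add_of_nat_mono) simp
  also have "\<dots> < psi (omega * ?f + omega + (omega * ?b g + of_nat (?y g)) + of_nat 0)"
    by (rule psi_nested)
  also have "\<dots> = psi (omega * (?f + 1 + ?b g) + of_nat (?y g))"
    by (simp only: distrib_left of_nat_0 add_0_left mult_1_left ac_simps)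
  also have "\<dots> \<le> psi (omega * ?b ?h + of_nat (?y ?h))"
  proof (rule psi_omega_le[OF le yg])
    have "no (?f + 1 + ?b g) \<le> 4 * F 2 m + 4 * m"
      if "no ?f \<le> F 2 m" "no (?b g) \<le> F 2 m" "1 \<le> m" for m
      using that by simp
    from this[OF nf ng y1] show "no (?f + 1 + ?b g) \<le> 4 * F 2 (?y ?h) + 4 * ?y ?h" .
  qed
  finally show ?case .
qed simp

section \<open>Application and the redexes\<close>

lemma level_app_vec [simp]: "lv \<tau> \<le> level v \<Longrightarrow> level (app_vec \<tau> v a) = lv \<tau>"
  by (simp add: app_vec_def)

lemma goodv_app_vec:
  "goodv v \<Longrightarrow> goodv a \<Longrightarrow> level a < level v \<Longrightarrow> lv \<tau> \<le> level v \<Longrightarrow> goodv (app_vec \<tau> v a)"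
  unfolding app_vec_def by (intro goodv_restr goodv_box) simp_all

lemma vals_app_vec:
  assumes "1 \<le> i" "lv \<tau> \<le> level v"
  shows "vals \<chi> (app_vec \<tau> v a) i =
    (if i \<le> lv \<tau> then bx (vals \<chi> v) (vals \<chi> a) (level a) i else 0)"
  using assms by (simp add: app_vec_def vnth_restr vnth_box val_boxc)

lemma vals_app_vec_0:
  assumes "goodv v" "goodv a" "adm \<chi>"
  shows "vals \<chi> (app_vec \<tau> v a) 0 = of_nat (psi (omega * bx (vals \<chi> v) (vals \<chi> a) (level a) 1
    + of_nat (no (vals \<chi> v 0) + no (vals \<chi> a 0) + level a)))"
  using val_boxc_0[OF assms] by (simp add: app_vec_def vnth_restr vnth_box)

lemma vals_app_vec_0_gt:
  assumes "goodv v" "goodv a" "adm \<chi>"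
  shows "vals \<chi> v 0 < vals \<chi> (app_vec \<tau> v a) 0" "vals \<chi> a 0 < vals \<chi> (app_vec \<tau> v a) 0"
proof -
  have *: "of_nat k < vals \<chi> (app_vec \<tau> v a) 0" if "k < no (vals \<chi> v 0) + no (vals \<chi> a 0)" for k
    unfolding vals_app_vec_0[OF assms] of_nat_less_iff using that by (intro less_psi_omega) simp
  show "vals \<chi> v 0 < vals \<chi> (app_vec \<tau> v a) 0"
    by (subst goodv_nat[OF assms(1,3)]) (use goodv_no_pos[OF assms(2,3)] in \<open>simp add: *\<close>)
  show "vals \<chi> a 0 < vals \<chi> (app_vec \<tau> v a) 0"
    by (subst goodv_nat[OF assms(2,3)]) (use goodv_no_pos[OF assms(1,3)] in \<open>simp add: *\<close>)
qed

text \<open>For contractions whose result is an argument of the redex;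
  \<open>vless_app_vec_left\<close> carries the comparison past a further argument.\<close>

lemma vless_app_vec_right:
  assumes "goodv v" "goodv a" "level a < level v" "lv \<tau> \<le> level v" "level a \<le> lv \<tau>"
  shows "a \<prec>\<^sub>v app_vec \<tau> v a"
  unfolding vless_iff
proof (intro allI impI conjI)
  fix \<chi> i assume \<chi>: "adm \<chi>"
  show "vals \<chi> a 0 < vals \<chi> (app_vec \<tau> v a) 0" by (rule vals_app_vec_0_gt(2)[OF assms(1,2) \<chi>])
  assume "(0::nat) < i"
  show "vals \<chi> a i \<le> vals \<chi> (app_vec \<tau> v a) i"
  proof (cases "i \<le> level a")
    case True
    have "vals \<chi> a i \<le> vals \<chi> v i + vals \<chi> a i" by (rule add_ge_right_eord)
    also have "\<dots> \<le> bx (vals \<chi> v) (vals \<chi> a) (level a) i" using True by (rule bx_ge)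
    finally show ?thesis using \<open>0 < i\<close> True assms by (simp add: vals_app_vec)
  qed (simp add: vnth_beyond goodv_not_Nil assms)
qed

lemma vless_app_vec_left:
  assumes "goodv v" "goodv a" "lv \<tau> \<le> level v" "u \<noteq> []" "level u \<le> lv \<tau>" "u \<prec>\<^sub>v v"
  shows "u \<prec>\<^sub>v app_vec \<tau> v a"
  unfolding vless_iff
proof (intro allI impI conjI)
  fix \<chi> i assume \<chi>: "adm \<chi>"
  note u = assms(6)[unfolded vless_iff, rule_format, OF \<chi>]
  show "vals \<chi> u 0 < vals \<chi> (app_vec \<tau> v a) 0"
    using u vals_app_vec_0_gt(1)[OF assms(1,2) \<chi>] by (blast intro: less_trans)
  assume i: "(0::nat) < i"
  show "vals \<chi> u i \<le> vals \<chi> (app_vec \<tau> v a) i"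
  proof (cases "i \<le> level u")
    case True
    then have "vals \<chi> (app_vec \<tau> v a) i = bx (vals \<chi> v) (vals \<chi> a) (level a) i"
      using i assms by (simp add: vals_app_vec)
    moreover have "vals \<chi> u i \<le> vals \<chi> v i" using u i by simp
    ultimately show ?thesis using bx_ge_left[of "vals \<chi> v" i] by (simp add: order_trans)
  qed (simp add: vnth_beyond assms)
qed

text \<open>The coefficients of omega are compared weakly, since the finite summand drops strictly.
  The norm condition concerns the smaller side and follows from \<open>no_boxc_le\<close> for v' and
  a'.\<close>

lemma app_vec_mono:
  assumes "goodv v'" "goodv a'" "goodv v" "goodv a" "level v' = level v" "level a' = level a"
    "level a < level v" "lv \<tau> \<le> level v"
    "\<And>\<chi> i. adm \<chi> \<Longrightarrow> vals \<chi> v' i \<le> vals \<chi> v i" "\<And>\<chi> i. adm \<chi> \<Longrightarrow> vals \<chi> a' i \<le> vals \<chi> a i"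
    "\<And>\<chi>. adm \<chi> \<Longrightarrow> vals \<chi> v' 0 < vals \<chi> v 0 \<or> vals \<chi> a' 0 < vals \<chi> a 0"
  shows "app_vec \<tau> v' a' \<prec>\<^sub>v app_vec \<tau> v a"
  unfolding vless_iff
proof (intro allI impI conjI)
  fix \<chi> i assume \<chi>: "adm \<chi>"
  have mono: "bx (vals \<chi> v') (vals \<chi> a') n j \<le> bx (vals \<chi> v) (vals \<chi> a) n j" for n j
    using assms(9,10)[OF \<chi>] by (intro bx_mono)
  have nat: "no (vals \<chi> u' 0) \<le> no (vals \<chi> u 0)"
    "vals \<chi> u' 0 < vals \<chi> u 0 \<Longrightarrow> no (vals \<chi> u' 0) < no (vals \<chi> u 0)"
    if "goodv u'" "goodv u" "vals \<chi> u' 0 \<le> vals \<chi> u 0" for u u'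
    using goodv_nat[OF that(1) \<chi>] goodv_nat[OF that(2) \<chi>] that(3)
    by (metis of_nat_le_iff, metis of_nat_less_iff)
  have v: "no (vals \<chi> v' 0) \<le> no (vals \<chi> v 0)" and a: "no (vals \<chi> a' 0) \<le> no (vals \<chi> a 0)"
    using nat(1)[OF assms(1,3) assms(9)[OF \<chi>]] nat(1)[OF assms(2,4) assms(10)[OF \<chi>]] .
  have va: "no (vals \<chi> v' 0) + no (vals \<chi> a' 0) + level a < no (vals \<chi> v 0) + no (vals \<chi> a 0) + level a"
    using assms(11)[OF \<chi>] v a nat(2)[OF assms(1,3) assms(9)[OF \<chi>]] nat(2)[OF assms(2,4) assms(10)[OF \<chi>]]
    by auto
  show "vals \<chi> (app_vec \<tau> v' a') 0 < vals \<chi> (app_vec \<tau> v a) 0"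
    unfolding vals_app_vec_0[OF assms(1,2) \<chi>] vals_app_vec_0[OF assms(3,4) \<chi>] of_nat_less_iff assms(6)
  proof (rule psi_omega_less)
    let ?l = "no (vals \<chi> v 0) + no (vals \<chi> a 0) + level a"
    show "no (bx (vals \<chi> v') (vals \<chi> a') (level a) 1) \<le> 4 * F 2 (F 2 (F 2 ?l)) + 4 * ?l"
      using no_boxc_le[OF assms(1,2) \<chi>, of 1] F_mono[OF less_imp_le[OF va], of 2] F2_le_F2_F2_F2[of ?l]
      unfolding assms(6) by linarith
  qed (use va mono[of "level a" 1] in \<open>auto simp: order_le_less\<close>)
  assume "(0::nat) < i"
  then show "vals \<chi> (app_vec \<tau> v' a') i \<le> vals \<chi> (app_vec \<tau> v a) i"
    using mono assms by (simp add: vals_app_vec)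
qed

lemma vless_vals_le: "u \<prec>\<^sub>v v \<Longrightarrow> adm \<chi> \<Longrightarrow> vals \<chi> u i \<le> vals \<chi> v i"
  unfolding vless_iff by (cases i) (auto intro: less_imp_le)

lemma app_vec_mono_left:
  assumes "goodv v'" "goodv v" "goodv a" "level v' = level v" "level a < level v" "lv \<tau> \<le> level v"
    "v' \<prec>\<^sub>v v"
  shows "app_vec \<tau> v' a \<prec>\<^sub>v app_vec \<tau> v a"
  by (rule app_vec_mono) (use assms vless_vals_le in \<open>auto simp: vless_iff\<close>)

lemma app_vec_mono_right:
  assumes "goodv a'" "goodv v" "goodv a" "level a' = level a" "level a < level v" "lv \<tau> \<le> level v"
    "a' \<prec>\<^sub>v a"
  shows "app_vec \<tau> v a' \<prec>\<^sub>v app_vec \<tau> v a"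
  by (rule app_vec_mono) (use assms vless_vals_le in \<open>auto simp: vless_iff\<close>)

lemma vnth_lam_vec: "vnth (lam_vec X v w) i = oplus (vnth (vdelta X v) i) (osub1 X (vnth w i))"
  unfolding lam_vec_def map_osub1 vnth_vplus vnth_map_osub by (simp add: osub1_def)

lemma level_lam_vec [simp]: "level (lam_vec X v w) = max (max (dlev X) (level v)) (level w)"
  by (simp add: lam_vec_def map_osub1)

text \<open>v and w stand for [G_0] and [G_m]. At the substitution updated by a, which is
  admissible, w is at most v, and v is majorized through its \<open>delta\<close>, a summand of the
  vector of the abstraction.\<close>

lemma beta_vless:
  assumes "goodv v" "vecC X v" "goodv w" "\<And>\<chi> i. adm \<chi> \<Longrightarrow> vals \<chi> w i \<le> vals \<chi> v i"
    "level v = level w" "goodv a" "level a = lv (vty X)" "lv \<tau> = level w"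
  shows "map (osub X a) w \<prec>\<^sub>v app_vec \<tau> (lam_vec X v w) a"
  unfolding vless_iff
proof (intro allI impI conjI)
  let ?L = "lam_vec X v w" and ?n = "lv (vty X)"
  have L: "goodv ?L" by (rule goodv_lam_vec[OF assms(1-3)])
  have lvL: "lv \<tau> \<le> level ?L" using assms(8) by simp
  fix \<chi> i assume \<chi>: "adm \<chi>"
  have adm': "adm (upd \<chi> X a)" by (rule adm_upd[OF \<chi> assms(6,7)])
  have C: "clsC X i (vnth v i)" if "i \<le> level v" for i using assms(2) that by (simp add: vecC_def)
  have valsL: "vals \<chi> (vdelta X v) i \<le> vals \<chi> ?L i" for i
    by (simp add: vnth_lam_vec add_ge_left_eord)
  have delta_le: "vals \<chi> (delta X i (vnth v i)) j \<le> vals \<chi> ?L j" if "i \<le> level v" "1 \<le> j" for i j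
  proof (cases "j \<le> dlev X")
    case True
    have "vals \<chi> (delta X i (vnth v i)) j \<le> vals \<chi> (vdelta X v) j"
      unfolding vals_vdelta(2)[OF that(2) True] by (rule member_le_sum) (use that in auto)
    then show ?thesis using valsL by (rule order_trans)
  next
    case False
    then show ?thesis by (simp add: vnth_delta_beyond)
  qed
  show "vals \<chi> (map (osub X a) w) 0 < vals \<chi> (app_vec \<tau> ?L a) 0"
  proof -
    let ?K = "2 ^ dlev X * sz X (vnth v 0) * no (vals \<chi> (delta X 0 (vnth v 0)) 0)"
    have "sz X (vnth v 0) \<le> (\<Sum>i\<le>level v. sz X (vnth v i))" by (rule member_le_sum) auto
    then have "?K \<le> no (vals \<chi> (vdelta X v) 0)"
      unfolding no_vals_vdelta_0[OF assms(2) \<chi>] by (intro mult_right_mono mult_left_mono) simp_all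
    also have "\<dots> \<le> no (vals \<chi> ?L 0)" by (simp add: vnth_lam_vec)
    finally have K: "?K + no (vals \<chi> a 0) + ?n \<le> no (vals \<chi> ?L 0) + no (vals \<chi> a 0) + ?n" by simp
    have "vals \<chi> (map (osub X a) w) 0 \<le> val (upd \<chi> X a) (vnth v 0)"
      unfolding vnth_map_osub osubst_osub by (rule assms(4)[OF adm'])
    also have "\<dots> = of_nat (no (val (upd \<chi> X a) (vnth v 0)))"
      by (rule clsC_0_nat[OF C adm']) simp
    also have "\<dots> < of_nat (psi (omega * bx (vals \<chi> (delta X 0 (vnth v 0))) (vals \<chi> a) ?n 1 +
        of_nat (?K + no (vals \<chi> a 0) + ?n)))"
      unfolding of_nat_less_iff by (rule val_upd_less_psi[OF C refl \<chi> assms(6,7)]) simp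
    also have "\<dots> \<le> vals \<chi> (app_vec \<tau> ?L a) 0"
      unfolding vals_app_vec_0[OF L assms(6) \<chi>] of_nat_le_iff assms(7)
    proof (rule psi_omega_le[OF _ K])
      show "bx (vals \<chi> (delta X 0 (vnth v 0))) (vals \<chi> a) ?n 1 \<le> bx (vals \<chi> ?L) (vals \<chi> a) ?n 1"
        by (intro bx_mono delta_le) simp_all
      show "no (bx (vals \<chi> (delta X 0 (vnth v 0))) (vals \<chi> a) ?n 1)
          \<le> 4 * F 2 (no (vals \<chi> ?L 0) + no (vals \<chi> a 0) + ?n) + 4 * (no (vals \<chi> ?L 0) + no (vals \<chi> a 0) + ?n)"
        using no_bx_delta_0_le[OF C[of 0] \<chi> assms(6), of 1 ?n] F_mono[OF K, of 2] by simp
    qed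
    finally show ?thesis .
  qed
  assume i: "(0::nat) < i"
  show "vals \<chi> (map (osub X a) w) i \<le> vals \<chi> (app_vec \<tau> ?L a) i"
  proof (cases "i \<le> level w")
    case False
    then show ?thesis using vnth_beyond[OF goodv_not_Nil[OF assms(3)]] by (simp add: osubst_osub)
  next
    case True
    then have Ci: "clsC X i (vnth v i)" using C assms(5) by simp
    have "vals \<chi> (map (osub X a) w) i \<le> val (upd \<chi> X a) (vnth v i)"
      unfolding vnth_map_osub osubst_osub by (rule assms(4)[OF adm'])
    also have "\<dots> \<le> bx (vals \<chi> ?L) (vals \<chi> a) ?n i"
    proof (cases "i \<le> dlev X")
      case le: True
      have "val (upd \<chi> X a) (vnth v i) \<le> bx (vals \<chi> (delta X i (vnth v i))) (vals \<chi> a) ?n i"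
        using val_upd_less_bx[OF Ci _ le \<chi>, of a] i by simp
      also have "\<dots> \<le> bx (vals \<chi> ?L) (vals \<chi> a) ?n i"
        using i True assms(5) by (intro bx_mono delta_le) simp_all
      finally show ?thesis .
    next
      case False
      \<comment> \<open>Above \<open>dlev X\<close> the component is x-free, and
        \<open>vdelta\<close> passes it on unchanged.\<close>
      then have "val (upd \<chi> X a) (vnth v i) = val \<chi> (vnth v i)"
        using clsC_xfree_beyond[OF Ci] by (simp add: osubst_upd_xfree)
      also have "\<dots> = vals \<chi> (vdelta X v) i" using False i True assms(5) by (simp add: vnth_vdelta)
      also have "\<dots> \<le> vals \<chi> ?L i" by (rule valsL)
      also have "\<dots> = bx (vals \<chi> ?L) (vals \<chi> a) ?n i" using False by (simp add: bx_beyond)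
      finally show ?thesis .
    qed
    also have "\<dots> = vals \<chi> (app_vec \<tau> ?L a) i"
      using i True assms(7,8) lvL by (simp add: vals_app_vec)
    finally show ?thesis .
  qed
qed

section \<open>Vectors of the recursor and its successor redex\<close>

lemma vnth_recT_vec: "vnth (recT_vec \<tau> v) i =
   (if i = 0 then vnth v 0 else if i \<le> lv \<tau> + 1 then OOne
    else if i = lv \<tau> + 2 then vnth v 0 else OZero)"
  by (auto simp: recT_vec_def vnth_def nth_append nth_Cons' simp del: replicate.simps)

lemma level_recT_vec [simp]: "level (recT_vec \<tau> v) = lv \<tau> + 2"
  by (simp add: recT_vec_def level_def)

lemma goodv_recT_vec:
  assumes "goodv v"
  shows "goodv (recT_vec \<tau> v)"
  unfolding goodv_def
proof (intro conjI allI impI)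
  show "recT_vec \<tau> v \<noteq> []" by (simp add: recT_vec_def)
next
  fix \<chi> i assume \<chi>: "adm \<chi>" and i: "i \<le> level (recT_vec \<tau> v)"
  have "clsB 0 (osubst \<chi> (vnth v 0))" using goodv_clsB[OF assms \<chi>] by simp
  then have "clsB i (osubst \<chi> (vnth v 0))" by (rule clsB.intros(6))
  then show "clsB i (osubst \<chi> (vnth (recT_vec \<tau> v) i))"
    using i clsB.intros(1) by (auto simp: vnth_recT_vec)
  show "no (vals \<chi> (recT_vec \<tau> v) i) \<le> no (vals \<chi> (recT_vec \<tau> v) 0)"
    using goodv_no_pos[OF assms \<chi>] by (simp add: vnth_recT_vec)
qed

lemma recT_vec_mono: "v' \<prec>\<^sub>v v \<Longrightarrow> recT_vec \<tau> v' \<prec>\<^sub>v recT_vec \<tau> v"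
  unfolding vless_iff by (auto simp: vnth_recT_vec intro: less_imp_le)

lemma lam_vec_mono:
  assumes "w' \<prec>\<^sub>v w"
  shows "lam_vec X v w' \<prec>\<^sub>v lam_vec X v w"
  using assms unfolding vless_iff
  by (auto simp: vnth_lam_vec osubst_osub1 adm_upd1 intro: add_left_mono add_strict_left_mono)

text \<open>To be read with f = [F], g = [G], R = [R^t], R' = [R^St], a = [R^t F], a' = [R^St F], b
  = [R^t F G]. The first summand belongs to F t (R^t F G); the next two are there because component
  0 has to absorb the collapsed values of R^t F G and F t. The 4 reproduces itself in the step,
  where 8 copies of q are needed and 2^4 are available.\<close>

lemma recT_Succ_components:
  fixes f g :: "nat \<Rightarrow> eord" and R R' a a' b c b' :: "nat \<Rightarrow> eord"
  assumes "\<And>j. 1 \<le> j \<Longrightarrow> j \<le> p + 1 \<Longrightarrow> R j = 1" "\<And>j. 1 \<le> j \<Longrightarrow> j \<le> p + 1 \<Longrightarrow> R' j = 1"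
    "R (p + 2) = of_nat t" "R' (p + 2) = of_nat s" "t + 3 \<le> s"
    "\<And>j. 1 \<le> j \<Longrightarrow> j \<le> p + 1 \<Longrightarrow> a j = bx R f (p + 1) j"
    "\<And>j. 1 \<le> j \<Longrightarrow> j \<le> p + 1 \<Longrightarrow> a' j = bx R' f (p + 1) j"
    "\<And>j. 1 \<le> j \<Longrightarrow> j \<le> p \<Longrightarrow> b j = bx a g p j"
    "1 \<le> j" "j \<le> p + 1"
    "\<And>j. 1 \<le> j \<Longrightarrow> j \<le> p + 1 \<Longrightarrow> a j \<le> a' j"
  shows "bx f b p j + bx a g p j + f j + 4 \<le> bx a' g p j"
  using assms(9,10)
proof (induction "p + 1 - j" arbitrary: j)
  case 0
  then have j: "j = p + 1" by simp
  \<comment> \<open>At the top index the exponents are t and s. Their gap of 3 yields the factor 8,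
    enough for the 7 copies of y needed below.\<close>
  have ap: "a j = pow2 (of_nat t) * (1 + f j)" "a' j = pow2 (of_nat s) * (1 + f j)"
    using assms(1-4) assms(6,7)[of j] j by (simp_all add: bx_step bx_beyond)
  let ?y = "pow2 (of_nat t) * (1 + f j)"
  have "1 + f j \<le> ?y" by (rule le_pow2_mult)
  then have y1: "1 \<le> ?y" and yf: "f j \<le> ?y"
    using add_ge_left_eord[of 1 "f j"] add_ge_right_eord[of "f j" 1] by (meson order_trans)+
  have "f j + ?y + f j + 4 * 1 \<le> ?y + ?y + ?y + 4 * ?y"
    by (intro add_mono mult_left_mono y1 yf order_refl) simp
  also have "\<dots> \<le> 8 * ?y"
  proof -
    have "(8 :: eord) = (1 + 1 + 1 + 4) + 1" by simp
    then have "8 * ?y = (?y + ?y + ?y + 4 * ?y) + ?y" by (simp only: distrib_right mult_1_left)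
    then show ?thesis by (simp only: add_ge_left_eord)
  qed
  also have "\<dots> = pow2 (of_nat (t + 3)) * (1 + f j)"
    by (simp add: pow2_add pow2_of_nat ac_simps numeral_3_eq_3 del: of_nat_add)
  also have "\<dots> \<le> a' j"
    unfolding ap using assms(5) by (intro mult_right_mono pow2_mono) (simp_all only: of_nat_le_iff zero_le_eord)
  finally show ?case using j ap by (simp add: bx_beyond)
next
  case (Suc k)
  then have j: "j \<le> p" by simp
  let ?c = "bx f b p (j + 1)" and ?b = "bx a g p (j + 1)" and ?b' = "bx a' g p (j + 1)"
  have IH: "?c + ?b + f (j + 1) + 4 \<le> ?b'" using Suc j by simp
  \<comment> \<open>q is 2^c * b_j, the main part of component j of F t (R^t F G); the whole left
    side is at most 8 * q.\<close>
  let ?q = "pow2 ?c * (pow2 ?b * (a j + g j))"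
  have aj: "1 + f j \<le> a j" and a'j: "a j \<le> a' j"
  proof -
    have "R j + f j \<le> bx R f (p + 1) j" using j by (intro bx_ge) simp
    then show "1 + f j \<le> a j" using assms(1,6) j Suc(3) by simp
    show "a j \<le> a' j" using assms(11) j Suc(3) by simp
  qed
  have ag: "1 \<le> a j + g j" "f j \<le> a j + g j"
    using aj add_ge_left_eord[of 1 "f j"] add_ge_right_eord[of "f j" 1] add_ge_left_eord[of "a j" "g j"]
    by (meson order_trans)+
  have bag: "a j + g j \<le> pow2 ?b * (a j + g j)" by (rule le_pow2_mult)
  have q: "pow2 ?b * (a j + g j) \<le> ?q" by (rule le_pow2_mult)
  have cf: "pow2 ?c * f j \<le> ?q"
    using ag(2) bag by (intro mult_left_mono) auto
  have q1: "1 \<le> ?q" "f j \<le> ?q" using ag bag q by (meson order_trans)+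
  have bj: "b j = pow2 ?b * (a j + g j)" "bx a g p j = pow2 ?b * (a j + g j)"
    using assms(8)[of j] j Suc(3) by (simp_all add: bx_step)
  have "bx f b p j + bx a g p j + f j + 4 * 1 = (pow2 ?c * f j + ?q) + pow2 ?b * (a j + g j) + f j + 4 * 1"
    by (simp add: bx_step j bj distrib_left)
  also have "\<dots> \<le> (?q + ?q) + ?q + ?q + 4 * ?q"
    by (intro add_mono mult_left_mono cf q q1 order_refl) simp
  also have "\<dots> \<le> 16 * ?q"
  proof -
    have "(16 :: eord) = (1 + 1 + 1 + 1 + 4) + 8" by simp
    then have "16 * ?q = (?q + ?q + ?q + ?q + 4 * ?q) + 8 * ?q"
      by (simp only: distrib_right mult_1_left)
    then show ?thesis by (simp only: add_ge_left_eord)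
  qed
  also have "\<dots> = pow2 (?c + ?b + 4) * (a j + g j)"
  proof -
    have "pow2 4 = (16 :: eord)" using pow2_of_nat[of 4] by simp
    then show ?thesis by (simp add: pow2_add ac_simps)
  qed
  also have "\<dots> \<le> pow2 ?b' * (a' j + g j)"
  proof (intro mult_mono pow2_mono add_right_mono a'j)
    have "?c + ?b + 4 \<le> ?c + ?b + f (j + 1) + 4"
      by (intro add_right_mono add_ge_left_eord)
    then show "?c + ?b + 4 \<le> ?b'" using IH by (rule order_trans)
  qed simp_all
  finally show ?case by (simp add: bx_step j)
qed

lemma recT_Succ_vless:
  assumes "goodv t" "goodv f" "goodv g" "level t = 0" "level f = lv \<tau> + 1" "level g = lv \<tau>"
  shows "app_vec \<tau> (app_vec (\<tau> \<rightarrow> \<tau>) f t) (app_vec \<tau> (app_vec (\<tau> \<rightarrow> \<tau>) (recT_vec \<tau> t) f) g)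
    \<prec>\<^sub>v app_vec \<tau> (app_vec (\<tau> \<rightarrow> \<tau>) (recT_vec \<tau> (app_vec Base [OOne, OOne] t)) f) g"
  unfolding vless_iff
proof (intro allI impI conjI)
  define S where "S = app_vec Base [OOne, OOne] t"
  define u where "u = app_vec (\<tau> \<rightarrow> \<tau>) f t"
  define a where "a = app_vec (\<tau> \<rightarrow> \<tau>) (recT_vec \<tau> t) f"
  define a' where "a' = app_vec (\<tau> \<rightarrow> \<tau>) (recT_vec \<tau> S) f"
  define b where "b = app_vec \<tau> a g"
  have ones1: "[OOne, OOne] = ones 1" by (simp add: ones_def)
  let ?p = "lv \<tau>"
  have S: "goodv S" "level S = 0"
    unfolding S_def ones1 using assms by (auto intro!: goodv_app_vec goodv_ones)
  have lvtt: "lv (\<tau> \<rightarrow> \<tau>) = ?p + 1" by simp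
  have u: "goodv u" "level u = ?p + 1"
    unfolding u_def using assms by (auto intro!: goodv_app_vec)
  have a: "goodv a" "level a = ?p + 1"
    unfolding a_def using assms by (auto intro!: goodv_app_vec goodv_recT_vec)
  have a': "goodv a'" "level a' = ?p + 1"
    unfolding a'_def using assms S by (auto intro!: goodv_app_vec goodv_recT_vec)
  have b: "goodv b" "level b = ?p"
    unfolding b_def using assms a by (auto intro!: goodv_app_vec)
  have "t \<prec>\<^sub>v S"
    unfolding S_def ones1 using assms by (intro vless_app_vec_right goodv_ones) simp_all
  then have aa': "a \<prec>\<^sub>v a'"
    unfolding a_def a'_def using assms S
    by (intro app_vec_mono_left recT_vec_mono goodv_recT_vec) simp_all
  fix \<chi> i assume \<chi>: "adm \<chi>"
  define T where "T = no (vals \<chi> t 0)"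
  define s where "s = no (vals \<chi> S 0)"
  have t0: "vals \<chi> t 0 = of_nat T" unfolding T_def by (rule goodv_nat[OF assms(1) \<chi>])
  have s0: "vals \<chi> S 0 = of_nat s" unfolding s_def by (rule goodv_nat[OF S(1) \<chi>])
  have "s = psi (omega * 1 + of_nat (1 + T))"
    using vals_app_vec_0[OF goodv_ones assms(1) \<chi>, of Base 1] assms(4)
    unfolding s_def S_def ones1 by (simp add: bx_beyond vnth_ones T_def)
  moreover have "Phi (no (omega * 1 + of_nat (1 + T))) < psi (omega * 1 + of_nat (1 + T))"
    by (rule Phi_less_psi) simp
  \<comment> \<open>omega + (1 + T) has norm T + 3, and its collapse exceeds Phi of that norm; hence
    the gap of 3.\<close>
  ultimately have sT: "T + 3 \<le> s" using le_Phi[of "no (omega * 1 + of_nat (1 + T))"] by simp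
  \<comment> \<open>[t] has level 0, so boxing with it leaves the positive indices of [F]
    unchanged.\<close>
  have uj: "vals \<chi> u j = vals \<chi> f j" if "1 \<le> j" for j
    using that assms by (auto simp: u_def vals_app_vec bx_beyond vnth_beyond goodv_not_Nil)
  have aj: "vals \<chi> a j = bx (vals \<chi> (recT_vec \<tau> t)) (vals \<chi> f) (?p + 1) j" if "1 \<le> j" "j \<le> ?p + 1" for j
    using that assms by (simp add: a_def vals_app_vec)
  have a'j: "vals \<chi> a' j = bx (vals \<chi> (recT_vec \<tau> S)) (vals \<chi> f) (?p + 1) j" if "1 \<le> j" "j \<le> ?p + 1" for j
    using that assms by (simp add: a'_def vals_app_vec)
  have bj: "vals \<chi> b j = bx (vals \<chi> a) (vals \<chi> g) ?p j" if "1 \<le> j" "j \<le> ?p" for j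
    using that assms a by (simp add: b_def vals_app_vec)
  let ?c = "bx (vals \<chi> u) (vals \<chi> b) ?p" and ?b = "bx (vals \<chi> a) (vals \<chi> g) ?p"
    and ?b' = "bx (vals \<chi> a') (vals \<chi> g) ?p"
  have cf: "?c j = bx (vals \<chi> f) (vals \<chi> b) ?p j" if "1 \<le> j" for j
    by (intro order_antisym bx_mono) (use that in \<open>simp_all add: uj\<close>)
  have main: "?c j + ?b j + vals \<chi> f j + 4 \<le> ?b' j" if "1 \<le> j" "j \<le> ?p + 1" for j
    unfolding cf[OF that(1)]
    by (rule recT_Succ_components[OF _ _ _ _ sT aj a'j bj that vless_vals_le[OF aa' \<chi>]])
      (simp_all add: vnth_recT_vec t0 s0)
  show "vals \<chi> (app_vec \<tau> u b) 0 < vals \<chi> (app_vec \<tau> a' g) 0"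
  proof -
    let ?F = "no (vals \<chi> f 0)" and ?G = "no (vals \<chi> g 0)" and ?A = "no (vals \<chi> a 0)"
      and ?A' = "no (vals \<chi> a' 0)" and ?U = "no (vals \<chi> u 0)" and ?B = "no (vals \<chi> b 0)"
    let ?y = "?A' + ?G + ?p"
    have U: "?U = psi (omega * vals \<chi> f 1 + of_nat (?F + T))"
      using vals_app_vec_0[OF assms(2,1) \<chi>, of "\<tau> \<rightarrow> \<tau>"] assms(4)
      unfolding u_def T_def by (simp add: bx_beyond)
    have B: "?B = psi (omega * ?b 1 + of_nat (?A + ?G + ?p))"
      using vals_app_vec_0[OF a(1) assms(3) \<chi>, of \<tau>] assms(6) unfolding b_def by simp
    have A: "?A = psi (omega * vals \<chi> a 1 + of_nat (T + ?F + (?p + 1)))"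
      using vals_app_vec_0[OF goodv_recT_vec[OF assms(1)] assms(2) \<chi>, of "\<tau> \<rightarrow> \<tau>" \<tau>] assms(5) aj[of 1]
      unfolding a_def by (simp add: vnth_recT_vec T_def)
    have A': "?A' = psi (omega * vals \<chi> a' 1 + of_nat (s + ?F + (?p + 1)))"
      using vals_app_vec_0[OF goodv_recT_vec[OF S(1)] assms(2) \<chi>, of "\<tau> \<rightarrow> \<tau>" \<tau>] assms(5) a'j[of 1]
      unfolding a'_def by (simp add: vnth_recT_vec s_def)
    have Ay: "s + ?F \<le> ?A'" unfolding A' by (rule less_imp_le, rule less_psi_omega) simp
    have AA: "?A \<le> ?A'"
      using vless_vals_le[OF aa' \<chi>, of 0] goodv_nat[OF a(1) \<chi>] goodv_nat[OF a'(1) \<chi>]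
      by (metis of_nat_le_iff)
    have nb: "no (?b j) \<le> F 2 ?y" if "1 \<le> j" for j
    proof -
      have "no (?b j) \<le> F 2 (?A + ?G + ?p)"
        using no_boxc_le[OF a(1) assms(3) \<chi> that] assms(6) by simp
      also have "\<dots> \<le> F 2 ?y" using AA by (intro F_mono) simp
      finally show ?thesis .
    qed
    \<comment> \<open>The components of [R^t F G] are boxes bounded by F_2, and boxing again adds an
      outer F_2; the one in the middle absorbs the sum with [F]_0 and p.\<close>
    have nc: "no (?c 1) \<le> F 2 (F 2 (F 2 ?y))"
    proof -
      have "no (?c 1) \<le> F 2 (?F + F 2 ?y + ?p)"
      proof (rule no_bx_le_F2)
        fix j :: nat assume j: "1 \<le> j"
        have "no (vals \<chi> u j) \<le> ?F" unfolding uj[OF j] by (rule goodv_no_le[OF assms(2) \<chi>])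
        moreover have "no (vals \<chi> b j) \<le> F 2 ?y"
          using nb[OF j] bj[OF j] b vnth_beyond[OF goodv_not_Nil[OF b(1)], of j]
          by (cases "j \<le> ?p") simp_all
        ultimately show "no (vals \<chi> u j) + no (vals \<chi> b j) \<le> ?F + F 2 ?y" by (rule add_mono)
      qed (use goodv_no_pos[OF assms(2) \<chi>] in simp_all)
      also have "\<dots> \<le> F 2 (F 2 (F 2 ?y))"
      proof (rule F_mono)
        have "?F + F 2 ?y + ?p \<le> 2 * F 2 ?y" using Ay F_greater[of ?y 2] by linarith
        also have "\<dots> \<le> F 0 (F 2 ?y)" using two_times_le_two_power[of "F 2 ?y"] by (simp add: F.simps)
        also have "\<dots> \<le> F 2 (F 2 ?y)" by (rule F_le_F) simp
        finally show "?F + F 2 ?y + ?p \<le> F 2 (F 2 ?y)" .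
      qed
      finally show ?thesis .
    qed
    have FF: "F 2 ?y \<le> F 2 (F 2 (F 2 ?y))" "?y < F 2 (F 2 (F 2 ?y))"
      using F_greater[of _ 2] by (meson less_imp_le less_trans order_trans)+
    \<comment> \<open>\<open>psi_add\<close> merges the collapsed values of F t and R^t F G, so that
      one use of \<open>psi_nested\<close>, at the price of one omega, absorbs both.\<close>
    let ?\<beta> = "omega * vals \<chi> f 1 + of_nat (?F + T) + (omega * ?b 1 + of_nat (?A + ?G + ?p))"
    have "psi (omega * ?c 1 + of_nat (?U + ?B + ?p)) \<le> psi (omega * ?c 1 + of_nat (?p + psi ?\<beta>))"
      using psi_add[of "omega * vals \<chi> f 1 + of_nat (?F + T)" "omega * ?b 1 + of_nat (?A + ?G + ?p)"]
      unfolding U B by (intro psi_add_of_nat_mono) simp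
    also have "\<dots> < psi (omega * ?c 1 + omega + ?\<beta> + of_nat ?p)" by (rule psi_nested)
    also have "\<dots> = psi (omega * (?c 1 + ?b 1 + vals \<chi> f 1 + 1) + of_nat (?F + T + (?A + ?G + ?p) + ?p))"
      by (simp add: distrib_left ac_simps)
    also have "\<dots> < psi (omega * ?b' 1 + of_nat ?y)"
    proof (rule psi_omega_less)
      have "?c 1 + ?b 1 + vals \<chi> f 1 + 1 < ?c 1 + ?b 1 + vals \<chi> f 1 + 4"
        by (rule add_strict_left_mono) simp
      also have "\<dots> \<le> ?b' 1" by (rule main) simp_all
      finally show "?c 1 + ?b 1 + vals \<chi> f 1 + 1 < ?b' 1 \<or>
          ?c 1 + ?b 1 + vals \<chi> f 1 + 1 = ?b' 1 \<and> ?F + T + (?A + ?G + ?p) + ?p < ?y"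
        by (rule disjI1)
      have "no (vals \<chi> f 1) \<le> ?F" by (rule goodv_no_le[OF assms(2) \<chi>])
      then show "no (?c 1 + ?b 1 + vals \<chi> f 1 + 1) \<le> 4 * F 2 (F 2 (F 2 ?y)) + 4 * ?y"
        using nb[of 1] nc FF Ay AA sT unfolding no_add no_1 by linarith
      show "?F + T + (?A + ?G + ?p) + ?p \<le> 8 * ?y" using Ay AA sT by simp
    qed
    finally show ?thesis
      using vals_app_vec_0[OF u(1) b(1) \<chi>, of \<tau>] vals_app_vec_0[OF a'(1) assms(3) \<chi>, of \<tau>] b(2) assms(6)
      by simp
  qed
  assume "(0::nat) < i"
  then have i: "1 \<le> i" by simp
  have "vals \<chi> (app_vec \<tau> u b) i \<le> vals \<chi> (app_vec \<tau> a' g) i"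
  proof (cases "i \<le> ?p")
    case True
    have "?c i \<le> ?c i + (?b i + vals \<chi> f i + 4)" by (rule add_ge_left_eord)
    also have "\<dots> \<le> ?b' i" using main[OF i] True by (simp add: add.assoc)
    finally show ?thesis using i True u a' b assms by (simp add: vals_app_vec)
  qed (use i u a' in \<open>simp add: vals_app_vec\<close>)
  then show "vals \<chi> (app_vec \<tau> (app_vec (\<tau> \<rightarrow> \<tau>) f t) (app_vec \<tau> (app_vec (\<tau> \<rightarrow> \<tau>) (recT_vec \<tau> t) f) g)) i
    \<le> vals \<chi> (app_vec \<tau> (app_vec (\<tau> \<rightarrow> \<tau>) (recT_vec \<tau> (app_vec Base [OOne, OOne] t)) f) g) i"
    unfolding u_def a_def a'_def b_def S_def .
qed

section \<open>Subject reduction\<close>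

lemma tyof_tsubst: "tyof B = vty X \<Longrightarrow> tyof (A{X:=B}) = tyof A"
  by (induction A) auto

text \<open>An equivalence, since alpha equivalence is symmetric and typing has to be carried in
  both directions.\<close>

lemma wt_tsubst_iff: "wt B \<Longrightarrow> tyof B = vty X \<Longrightarrow> wt (A{X:=B}) \<longleftrightarrow> wt A"
  by (induction A) (auto simp: tyof_tsubst)

lemma red_tyof: "A \<rhd> B \<Longrightarrow> wt A \<Longrightarrow> wt B \<and> tyof B = tyof A"
proof (induction rule: red.induct)
  case (recT_Succ \<tau> t A B)
  then have "tyof A = Base \<rightarrow> tyof B \<rightarrow> tyof B" by auto
  with recT_Succ show ?case by auto
qed (auto simp: tyof_tsubst wt_tsubst_iff)

lemma alpha_tyof: "A \<equiv>\<^sub>\<alpha> B \<Longrightarrow> (wt A \<longleftrightarrow> wt B) \<and> tyof A = tyof B"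
  by (induction rule: alpha.induct) (auto simp: tyof_tsubst wt_tsubst_iff)

lemma red_alpha_tyof: "A \<rhd>\<^sub>\<alpha> B \<Longrightarrow> wt A \<Longrightarrow> tyof B = tyof A"
  unfolding red_alpha_def using red_tyof alpha_tyof by metis

section \<open>Assignment derivations\<close>

inductive_cases is_deriv_DRecT: "is_deriv (DRecT \<tau> d)"
inductive_cases is_deriv_DApp: "is_deriv (DApp d e)"
inductive_cases is_deriv_DLam: "is_deriv (DLam X ds)"

lemma level_xvec [simp]: "level (xvec X) = lv (vty X)"
  by (simp add: xvec_def level_def)

lemma goodv_xvec: "goodv (xvec X)"
  by (auto simp: goodv_def xvec_def vnth_map_upt admissible_iff simp del: upt_Suc)

text \<open>A name that keeps the simplifier from unfolding this vector into list
  operations.\<close>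

definition rec_vec :: "ty \<Rightarrow> vec" where
  "rec_vec \<tau> = [omult 2 OOne] @ replicate (lv \<tau> + 1) OOne @ [OOmega]"

lemma dvec_DRec [simp]: "dvec (DRec \<tau>) = rec_vec \<tau>"
  by (simp add: rec_vec_def)

declare dvec.simps(5) [simp del]

lemma vnth_rec: "vnth (rec_vec \<tau>) i =
    (if i = 0 then OAdd OOne OOne else if i \<le> lv \<tau> + 1 then OOne
     else if i = lv \<tau> + 2 then OOmega else OZero)"
  by (auto simp: rec_vec_def vnth_def nth_append nth_Cons' oplus_def numeral_2_eq_2 simp del: replicate.simps)

lemma level_rec: "level (rec_vec \<tau>) = lv \<tau> + 2"
  by (simp add: level_def rec_vec_def)

lemma goodv_rec: "goodv (rec_vec \<tau>)"
  unfolding goodv_def level_rec vnth_rec using clsB.intros(1-3) by (auto simp: rec_vec_def)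

text \<open>The level clause supplies at each application the side condition under which a box is
  meaningful; typing is carried along to determine the levels.\<close>

definition goodd :: "deriv \<Rightarrow> bool" where
  "goodd d \<longleftrightarrow> wt (dterm d) \<and> goodv (dvec d) \<and> level (dvec d) = lv (tyof (dterm d))"

lemma chain_vals_le:
  assumes "\<And>i. i + 1 < length ds \<Longrightarrow> dvec (ds ! (i + 1)) \<prec>\<^sub>v dvec (ds ! i)" "ds \<noteq> []" "adm \<chi>"
  shows "vals \<chi> (dvec (last ds)) i \<le> vals \<chi> (dvec (hd ds)) i"
proof -
  have "vals \<chi> (dvec (ds ! k)) i \<le> vals \<chi> (dvec (ds ! 0)) i" if "k < length ds" for k
    using that
  proof (induction k)
    case (Suc k)
    then show ?case using vless_vals_le[OF assms(1)[of k] assms(3), of i] by fastforce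
  qed simp
  then show ?thesis using assms(2) by (simp add: last_conv_nth hd_conv_nth)
qed

lemma chain_tyof:
  assumes "\<And>i. i + 1 < length ds \<Longrightarrow> dterm (ds ! i) \<rhd>\<^sub>\<alpha> dterm (ds ! (i + 1))" "ds \<noteq> []"
    "\<And>d. d \<in> set ds \<Longrightarrow> wt (dterm d)"
  shows "tyof (dterm (hd ds)) = tyof (dterm (last ds))"
proof -
  have "tyof (dterm (ds ! k)) = tyof (dterm (ds ! 0))" if "k < length ds" for k
    using that
  proof (induction k)
    case (Suc k)
    then show ?case using red_alpha_tyof[OF assms(1)[of k]] assms(3) by simp
  qed simp
  from this[of "length ds - 1"] show ?thesis
    using assms(2) by (simp add: last_conv_nth hd_conv_nth)
qed

lemma is_deriv_goodd: "is_deriv d \<Longrightarrow> goodd d"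
proof (induction rule: is_deriv.induct)
  case 3
  have "[OOne, OOne] = ones 1" by (simp add: ones_def)
  then show ?case by (simp add: goodd_def goodv_ones)
next
  case 2
  have "[OOne] = ones 0" by (simp add: ones_def)
  then show ?case by (simp add: goodd_def goodv_ones)
next
  case (5 \<tau>)
  then show ?case using goodv_rec level_rec by (simp add: goodd_def)
next
  case (7 d e \<tau>)
  then show ?case by (auto simp: goodd_def intro!: goodv_app_vec)
next
  case (8 ds X)
  have "hd ds \<in> set ds" "last ds \<in> set ds" using 8(1) by simp_all
  then have *: "goodd (hd ds)" "goodd (last ds)" using 8 by blast+
  have "tyof (dterm (hd ds)) = tyof (dterm (last ds))"
    by (rule chain_tyof) (use 8 in \<open>auto simp: goodd_def\<close>)
  then show ?case
    using 8(1) * \<open>vecC X (dvec (hd ds))\<close> goodv_lam_vec unfolding goodd_def by (auto simp: last_map hd_map)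
qed (auto simp: goodd_def goodv_xvec goodv_ones goodv_recT_vec)

lemma is_deriv_DLamD:
  assumes "is_deriv (DLam X ds)"
  shows "ds \<noteq> []" "is_deriv (last ds)" "goodd (hd ds)" "goodd (last ds)" "vecC X (dvec (hd ds))"
    "level (dvec (hd ds)) = level (dvec (last ds))"
    "adm \<chi> \<Longrightarrow> vals \<chi> (dvec (last ds)) i \<le> vals \<chi> (dvec (hd ds)) i"
    "dvec (DLam X ds) = lam_vec X (dvec (hd ds)) (dvec (last ds))"
    "dterm (DLam X ds) = Lam X (dterm (last ds))"
proof -
  from assms have *: "ds \<noteq> []" "\<And>d. d \<in> set ds \<Longrightarrow> is_deriv d" "vecC X (dvec (hd ds))"
    and red: "\<And>i. i + 1 < length ds \<Longrightarrow> dterm (ds ! i) \<rhd>\<^sub>\<alpha> dterm (ds ! (i + 1))"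
    and less: "\<And>i. i + 1 < length ds \<Longrightarrow> dvec (ds ! (i + 1)) \<prec>\<^sub>v dvec (ds ! i)"
    by (auto elim: is_deriv_DLam)
  show "ds \<noteq> []" "vecC X (dvec (hd ds))" by fact+
  show l: "is_deriv (last ds)" "goodd (hd ds)" "goodd (last ds)" using * is_deriv_goodd by simp_all
  have "tyof (dterm (hd ds)) = tyof (dterm (last ds))"
    by (rule chain_tyof[OF red]) (use * is_deriv_goodd in \<open>auto simp: goodd_def\<close>)
  then show "level (dvec (hd ds)) = level (dvec (last ds))" using l by (simp add: goodd_def)
  show "vals \<chi> (dvec (last ds)) i \<le> vals \<chi> (dvec (hd ds)) i" if "adm \<chi>"
    by (rule chain_vals_le[OF less *(1) that])
  show "dvec (DLam X ds) = lam_vec X (dvec (hd ds)) (dvec (last ds))"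
    "dterm (DLam X ds) = Lam X (dterm (last ds))"
    using *(1) by (simp_all add: last_map hd_map)
qed

lemma is_deriv_DAppD:
  assumes "is_deriv (DApp d e)"
  obtains \<tau> where "tyof (dterm d) = tyof (dterm e) \<rightarrow> \<tau>" "is_deriv d" "is_deriv e"
    "goodv (dvec d)" "goodv (dvec e)" "level (dvec e) < level (dvec d)" "lv \<tau> \<le> level (dvec d)"
    "level (dvec e) = lv (tyof (dterm e))" "dvec (DApp d e) = app_vec \<tau> (dvec d) (dvec e)"
  using assms is_deriv_goodd[of d] is_deriv_goodd[of e]
  by (elim is_deriv_DApp) (auto simp: goodd_def)

lemma vless_DApp_right:
  assumes "is_deriv (DApp d e)" "lv (tyof (dterm e)) \<le> lv (cod (tyof (dterm d)))"
  shows "dvec e \<prec>\<^sub>v dvec (DApp d e)"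
proof -
  obtain \<tau> where *: "tyof (dterm d) = tyof (dterm e) \<rightarrow> \<tau>" "goodv (dvec d)" "goodv (dvec e)"
    "level (dvec e) < level (dvec d)" "lv \<tau> \<le> level (dvec d)"
    "level (dvec e) = lv (tyof (dterm e))" "dvec (DApp d e) = app_vec \<tau> (dvec d) (dvec e)"
    using assms(1) by (rule is_deriv_DAppD)
  show ?thesis unfolding *(7) using assms(2) * by (intro vless_app_vec_right) simp_all
qed

lemma vless_DApp_left:
  assumes "is_deriv (DApp d e)" "u \<prec>\<^sub>v dvec d" "u \<noteq> []" "level u \<le> lv (cod (tyof (dterm d)))"
  shows "u \<prec>\<^sub>v dvec (DApp d e)"
proof -
  obtain \<tau> where *: "tyof (dterm d) = tyof (dterm e) \<rightarrow> \<tau>" "goodv (dvec d)" "goodv (dvec e)"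
    "lv \<tau> \<le> level (dvec d)" "dvec (DApp d e) = app_vec \<tau> (dvec d) (dvec e)"
    using assms(1) by (rule is_deriv_DAppD)
  show ?thesis unfolding *(5) using assms * by (intro vless_app_vec_left) simp_all
qed

lemma level_dvec_DApp: "is_deriv (DApp d e) \<Longrightarrow> level (dvec (DApp d e)) = lv (cod (tyof (dterm d)))"
  by (drule is_deriv_goodd) (simp add: goodd_def)

text \<open>[t] has level 0, so the box keeps the positive components of [R], and the top one,
  omega, exceeds the natural number [t]_0.\<close>

lemma rec_vless:
  assumes "goodv t" "level t = 0"
  shows "recT_vec \<tau> t \<prec>\<^sub>v
    app_vec ((Base \<rightarrow> \<tau> \<rightarrow> \<tau>) \<rightarrow> \<tau> \<rightarrow> \<tau>) (rec_vec \<tau>) t"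
    (is "_ \<prec>\<^sub>v app_vec ?\<sigma> ?r t")
  unfolding vless_iff
proof (intro allI impI conjI)
  have lv: "lv ?\<sigma> = lv \<tau> + 2" by simp
  fix \<chi> i assume \<chi>: "adm \<chi>"
  show "vals \<chi> (recT_vec \<tau> t) 0 < vals \<chi> (app_vec ?\<sigma> ?r t) 0"
    using vals_app_vec_0_gt(2)[OF goodv_rec assms(1) \<chi>] unfolding vnth_recT_vec by simp
  assume i: "(0::nat) < i"
  have "vals \<chi> t 0 \<le> omega"
    by (subst goodv_nat[OF assms(1) \<chi>]) (rule less_imp_le[OF of_nat_less_omega])
  then show "vals \<chi> (recT_vec \<tau> t) i \<le> vals \<chi> (app_vec ?\<sigma> ?r t) i"
    using i assms(2) vals_app_vec[of i ?\<sigma> ?r \<chi> t] unfolding lv level_rec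
    by (simp add: bx_beyond vnth_recT_vec vnth_rec)
qed

text \<open>The first three conjuncts strengthen the induction: the congruence rules need a good
  vector of unchanged level, and the reduction fixes the type of B, at which \<open>assign\<close>
  cuts the vector of an application.\<close>

lemma assign_vless:
  assumes "assign d B v" "is_deriv d"
  shows "dterm d \<rhd> B \<and> goodv v \<and> level v = level (dvec d) \<and> v \<prec>\<^sub>v dvec d"
  using assms
proof (induction rule: assign.induct)
  case (1 \<tau> a b)
  then have d: "is_deriv (DApp (DApp (DCond \<tau>) DZero) a)" "is_deriv a" "tyof (dterm a) = \<tau>"
    by (auto elim!: is_deriv_DApp)
  then have a: "goodv (dvec a)" "level (dvec a) = lv \<tau>" using is_deriv_goodd by (auto simp: goodd_def)
  have "dvec a \<prec>\<^sub>v dvec (DApp (DApp (DCond \<tau>) DZero) a)"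
    by (rule vless_DApp_right[OF d(1)]) (simp add: d)
  then have "dvec a \<prec>\<^sub>v dvec (DApp (DApp (DApp (DCond \<tau>) DZero) a) b)"
    by (rule vless_DApp_left[OF 1]) (simp_all add: a goodv_not_Nil)
  then show ?case using red.cond_Zero a level_dvec_DApp[OF 1] by simp
next
  case (2 \<tau> t a b)
  then have d: "is_deriv b" "tyof (dterm b) = \<tau>"
    by (auto elim!: is_deriv_DApp)
  then have b: "goodv (dvec b)" "level (dvec b) = lv \<tau>" using is_deriv_goodd by (auto simp: goodd_def)
  have "dvec b \<prec>\<^sub>v dvec (DApp (DApp (DApp (DCond \<tau>) (DApp DSucc t)) a) b)"
    by (rule vless_DApp_right[OF 2]) (simp add: d)
  then show ?case using red.cond_Succ b level_dvec_DApp[OF 2] by simp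
next
  case (3 \<tau> t)
  then have "is_deriv t" "tyof (dterm t) = Base" by (auto elim!: is_deriv_DApp)
  then have t: "goodv (dvec t)" "level (dvec t) = 0" using is_deriv_goodd[of t] by (simp_all add: goodd_def)
  show ?case
    using red.rec_RecT goodv_recT_vec[OF t(1)] rec_vless[OF t] level_dvec_DApp[OF 3] by simp
next
  case (4 \<tau> f g)
  then have d: "is_deriv g" "tyof (dterm g) = \<tau>" by (auto elim!: is_deriv_DApp)
  then have g: "goodv (dvec g)" "level (dvec g) = lv \<tau>" using is_deriv_goodd by (auto simp: goodd_def)
  have "dvec g \<prec>\<^sub>v dvec (DApp (DApp (DRecT \<tau> DZero) f) g)"
    by (rule vless_DApp_right[OF 4]) (simp add: d)
  then show ?case using red.recT_Zero g level_dvec_DApp[OF 4] by simp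
next
  case (5 e f t \<tau> g)
  then have d: "is_deriv t" "is_deriv f" "is_deriv g" "tyof (dterm t) = Base"
      "tyof (dterm f) = Base \<rightarrow> \<tau> \<rightarrow> \<tau>" "tyof (dterm g) = \<tau>"
    by (auto elim!: is_deriv_DApp is_deriv_DRecT)
  then have *: "goodv (dvec t)" "goodv (dvec f)" "goodv (dvec g)" "level (dvec t) = 0"
      "level (dvec f) = lv \<tau> + 1" "level (dvec g) = lv \<tau>"
    using is_deriv_goodd[of t] is_deriv_goodd[of f] is_deriv_goodd[of g] by (simp_all add: goodd_def)
  have "is_deriv e"
    unfolding 5(1) by (intro is_deriv.intros) (use d in simp_all)
  then have e: "goodv (dvec e)" "level (dvec e) = lv \<tau>"
    using is_deriv_goodd[of e] d 5(1) by (simp_all add: goodd_def)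
  have "dvec e \<prec>\<^sub>v dvec (DApp (DApp (DRecT \<tau> (DApp DSucc t)) f) g)"
    using recT_Succ_vless[OF *] d 5(1) by simp
  then show ?case using red.recT_Succ e level_dvec_DApp[OF 5(2)] 5(1) by simp
next
  case (6 G ds X h)
  then have d: "is_deriv (DLam X ds)" "is_deriv h" "vty X = tyof (dterm h)"
    by (auto elim!: is_deriv_DApp)
  note lam = is_deriv_DLamD[OF d(1)]
  have h: "goodv (dvec h)" "level (dvec h) = lv (vty X)"
    using is_deriv_goodd[OF d(2)] d(3) by (simp_all add: goodd_def)
  have w: "goodv (dvec (hd ds))" "goodv (dvec (last ds))"
      "level (dvec (last ds)) = lv (tyof (dterm (last ds)))"
    using lam(3,4) by (simp_all add: goodd_def)
  have "map (osub X (dvec h)) (dvec (last ds)) \<prec>\<^sub>v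
      app_vec (tyof (dterm (last ds))) (lam_vec X (dvec (hd ds)) (dvec (last ds))) (dvec h)"
    by (rule beta_vless) (use w lam(5-7) h in simp_all)
  moreover have "dterm (DApp (DLam X ds) h) \<rhd> G{X:=dterm h}"
    using red.beta[OF 6(2)] 6(1) lam(9) by simp
  moreover have "dvec (DApp (DLam X ds) h) =
      app_vec (tyof (dterm (last ds))) (lam_vec X (dvec (hd ds)) (dvec (last ds))) (dvec h)"
    using lam(8,9) by simp
  ultimately show ?case
    using goodv_osub[OF w(2) h] w(3) by simp
next
  case (7 b B v c)
  obtain \<tau> where *: "tyof (dterm b) = tyof (dterm c) \<rightarrow> \<tau>" "is_deriv b"
    "goodv (dvec b)" "goodv (dvec c)" "level (dvec c) < level (dvec b)" "lv \<tau> \<le> level (dvec b)"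
    "dvec (DApp b c) = app_vec \<tau> (dvec b) (dvec c)"
    using 7(3) by (rule is_deriv_DAppD)
  note IH = 7(2)[OF *(2)]
  have "tyof B = tyof (dterm b)" using red_tyof IH is_deriv_goodd[OF *(2)] by (auto simp: goodd_def)
  then show ?case
    using IH * by (auto intro!: red.appL goodv_app_vec app_vec_mono_left)
next
  case (8 c C v b)
  obtain \<tau> where *: "tyof (dterm b) = tyof (dterm c) \<rightarrow> \<tau>" "is_deriv c"
    "goodv (dvec b)" "goodv (dvec c)" "level (dvec c) < level (dvec b)" "lv \<tau> \<le> level (dvec b)"
    "dvec (DApp b c) = app_vec \<tau> (dvec b) (dvec c)"
    using 8(3) by (rule is_deriv_DAppD)
  note IH = 8(2)[OF *(2)]
  show ?case
    using IH * by (auto intro!: red.appR goodv_app_vec app_vec_mono_right)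
next
  case (9 s t v \<tau>)
  then have "is_deriv s" by (auto elim: is_deriv_DRecT)
  with 9 show ?case by (auto intro: red.recT goodv_recT_vec recT_vec_mono)
next
  case (10 ds G v X)
  note lam = is_deriv_DLamD[OF 10(3)]
  note IH = 10(2)[OF lam(2)]
  then show ?case
    using lam(3,5,8,9) goodv_lam_vec lam_vec_mono unfolding goodd_def by (auto intro: red.xi)
qed

section \<open>Existence of the assigned vector\<close>

lemma dterm_eq_iff:
  "dterm d = Zero \<longleftrightarrow> d = DZero"
  "dterm d = Succ \<longleftrightarrow> d = DSucc"
  "dterm d = Cond \<tau> \<longleftrightarrow> d = DCond \<tau>"
  "dterm d = Rec \<tau> \<longleftrightarrow> d = DRec \<tau>"
  "dterm d = RecT \<tau> t \<longleftrightarrow> (\<exists>e. d = DRecT \<tau> e \<and> dterm e = t)"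
  "dterm d = App A B \<longleftrightarrow> (\<exists>b c. d = DApp b c \<and> dterm b = A \<and> dterm c = B)"
  "dterm d = Lam X A \<longleftrightarrow> (\<exists>ds. d = DLam X ds \<and> last (map dterm ds) = A)"
  by (cases d; auto)+

text \<open>Distinct constructors of \<open>deriv\<close> produce distinct constructors of terms, so
  the shape of a redex can be read back from the derivation.\<close>

lemma assign_exists:
  assumes "A \<rhd> B" "is_deriv d" "dterm d = A"
  shows "\<exists>v. assign d B v"
  using assms
proof (induction arbitrary: d rule: red.induct)
  case (beta X A B)
  then obtain ds h where d: "d = DApp (DLam X ds) h" "last (map dterm ds) = A" "dterm h = B"
    by (auto simp: dterm_eq_iff)
  then have "is_deriv (DLam X ds)" using beta by (auto elim: is_deriv_DApp)
  then have "dterm (last ds) = A" using d(2) is_deriv_DLamD(1)[of X ds] by (simp add: last_map)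
  then show ?case using assign.intros(6)[of A ds X h] beta d by auto
next
  case (appL A A' B)
  then obtain b c where "d = DApp b c" "dterm b = A" "dterm c = B" "is_deriv b"
    by (auto simp: dterm_eq_iff elim: is_deriv_DApp)
  then show ?case using appL.IH[of b] assign.intros(7) by blast
next
  case (appR B B' A)
  then obtain b c where "d = DApp b c" "dterm b = A" "dterm c = B" "is_deriv c"
    by (auto simp: dterm_eq_iff elim: is_deriv_DApp)
  then show ?case using appR.IH[of c] assign.intros(8) by blast
next
  case (recT s t \<tau>)
  then obtain e where "d = DRecT \<tau> e" "dterm e = s" "is_deriv e"
    by (auto simp: dterm_eq_iff elim: is_deriv_DRecT)
  then show ?case using recT.IH[of e] assign.intros(9) by blast
next
  case (xi A B X)
  then obtain ds where d: "d = DLam X ds" "last (map dterm ds) = A" "is_deriv (DLam X ds)"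
    by (auto simp: dterm_eq_iff)
  then have "dterm (last ds) = A" "is_deriv (last ds)"
    using is_deriv_DLamD(1,2)[of X ds] by (simp_all add: last_map)
  then show ?case using xi.IH[of "last ds"] assign.intros(10) d(1) by blast
next
  case (recT_Succ \<tau> t A B)
  then obtain t' a b where "d = DApp (DApp (DRecT \<tau> (DApp DSucc t')) a) b"
      "dterm t' = t" "dterm a = A" "dterm b = B"
    by (auto simp: dterm_eq_iff)
  then show ?case using assign.intros(5)[OF refl, of \<tau> t' a b] by auto
qed (auto simp: dterm_eq_iff intro: assign.intros(1-4) assign.intros(3)[unfolded dterm.simps])

text \<open>As \<open>assign\<close> is a relation, existence is included to keep the majorization
  from holding vacuously.\<close>

theorem theorem3p5:
  assumes "wt A" and "wt B" and "A \<rhd> B"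
    and "is_deriv d" and "dterm d = A"
  shows "(\<exists>v. assign d B v) \<and> (\<forall>v. assign d B v \<longrightarrow> v \<prec>\<^sub>v dvec d)"
  using assign_exists[OF assms(3-5)] assign_vless[OF _ assms(4)] by blast

end
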